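(* Let $n\ge2$, $\lambda=\frac{n-1}2$, and let a zonal function $f=\sum_{l=0}^\infty a_l^0(f)\,Y_l^0$ on $\mathcal S^n$ be given. Let $d\in\mathbb N$ and write $\epsilon_d\in\{0,1\}$ for $d \bmod 2$. Then $$ f^{(d)}(x):=\left.\frac{\partial^{d}}{\partial\Theta^{d}}\left(f(\Upsilon_\Theta x)\right)\right|_{\Theta=0} =\sum_{l=0}^\infty\sum_{j=0}^{[d/2]}a_l^{2j+\epsilon_d}(f^{(d)})\,Y_l^{(2j+\epsilon_d,0,\dots,0)}(x) $$ for $n\ge3$, or $$ f^{(d)}=\sum_{l=0}^\infty\sum_{j=0}^{[d/2]}a_l^{2j+\epsilon_d}(f^{(d)})\left(Y_l^{2j+\epsilon_d}+Y_l^{-(2j+\epsilon_d)}\right) $$ for $n=2$, with coefficients $a_l^k(f^{(d)})$ obtained recursively (starting from $f^{(0)}=f$) via $$ a_l^{2j+1}(f^{(d)})=\beta_{l,2j+1}\,a_l^{2j+2}(f^{(d-1)})-\beta_{l,2j}\,a_l^{2j}(f^{(d-1)}),\qquad a_l^{2j}(f^{(d)})=0 $$ for an odd $d$, and $$ a_l^0(f^{(d)})=-\beta_{l,0}\,a_l^1(f^{(d-1)})\ \ (\text{for }n\ge3),\qquad a_l^0(f^{(d)})=-2\beta_{l,0}\,a_l^1(f^{(d-1)})\ \ (\text{for }n=2), $$ $$ a_l^{2j}(f^{(d)})=\beta_{l,2j-1}\,a_l^{2j-1}(f^{(d-1)})-\beta_{l,2j}\,a_l^{2j+1}(f^{(d-1)})\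 \ (j\ge1),\qquad a_l^{2j+1}(f^{(d)})=0 $$ for an even $d$.
   Context: $\mathcal S^n\subset\mathbb R^{n+1}$ is the unit sphere; inner product $\langle f,g\rangle=\frac1{\Sigma_n}\int_{\mathcal S^n}\overline f g\,d\sigma$, where $\Sigma_n$ is the total surface measure. Spherical coordinates $(\theta_1,\dots,\theta_{n-1},\varphi)\in[0,\pi]^{n-1}\times[0,2\pi)$: $x_1=\cos\theta_1$, $x_2=\sin\theta_1\cos\theta_2$, ..., $x_{n-1}=\sin\theta_1\cdots\sin\theta_{n-2}\cos\theta_{n-1}$, $x_n=\sin\theta_1\cdots\sin\theta_{n-1}\cos\varphi$, $x_{n+1}=\sin\theta_1\cdots\sin\theta_{n-1}\sin\varphi$ (for $n=2$, $\theta_2$ means $\varphi$). A function is zonal if it depends only on $\theta_1$. $C_l^\mu$ are the Gegenbauer polynomials, $\sum_l C_l^\mu(t)r^l=(1-2tr+r^2)^{-\mu}$. The hyperspherical harmonics used are: for $n\ge3$ and $0\le k_1\le l$, $Y_l^{(k_1,0,\dots,0)}(x)=A\,C_{l-k_1}^{\lambda+k_1}(\cos\theta_1)\sin^{k_1}\theta_1\,C_{k_1}^{\lambda-\frac12}(\cos\theta_2)$; for $n=2$ and $0\le k\le l$, $Y_l^{\pm k}(x)=A\,C_{l-k}^{k+\frac12}(\cos\theta_1)\sin^k\theta_1\,e^{\pm ik\varphi}$; in each case $A>0$ is the constant making the function of unit norm with respect to $\langle\cdot,\cdot\rangle$. They are part of the standard orthonormal basis of hyperspherical harmonics. $Y_l^0$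 denotes $Y_l^{(0,\dots,0)}$, a positive multiple of $C_l^\lambda(\cos\theta_1)$, and $a_l^0(f)=\langle Y_l^0,f\rangle$. By convention $Y_l^{(k_1,0,\dots,0)}=0$ (respectively $Y_l^{\pm k}=0$) for index $k_1>l$ (respectively $k>l$), which can also be read as $a_l^{k}(f^{(d)})=0$ for $k>l$. $\Upsilon_\Theta$ is the rotation of $\mathbb R^{n+1}$ mapping $(x_1,x_2,x_3,\dots)$ to $(x_1\cos\Theta-x_2\sin\Theta,\;x_1\sin\Theta+x_2\cos\Theta,\;x_3,\dots)$. For $0\le k\le l$: $\beta_{l,k}=\sqrt{\frac{(k+1)(2\lambda+k-1)(l-k)(2\lambda+l+k)}{(2\lambda+2k-1)(2\lambda+2k+1)}}$, which for $n=2$ (i.e. $\lambda=\frac12$) is understood in its simplified form $\beta_{l,k}=\frac{\sqrt{(l-k)(l+k+1)}}2$.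
   Formalization: For even d the printed signs are reversed (they fail for f=x_1, d=2); for n=2 the term Y_l^0+Y_l^{-0} counts once; f^(0),…,f^(d) are assumed to exist and be square integrable; series converge in L², and pointwise if f has all derivatives. *)

theory Defs
  imports "HOL-Analysis.Analysis"
begin

text \<open>
  The ambient space \<open>\<real>\<^sup>n\<^sup>+\<^sup>1\<close> is \<^typ>\<open>real^'m\<close>; the numbering of the coordinates is given by a
  bijection \<open>ix\<close> from \<open>{1..n+1}\<close> onto the index type, so that \<open>x\<^sub>j\<close> is \<open>x $ ix j\<close>.
\<close>

section \<open>Surface measure and inner product\<close>

text \<open>
  The surface measure of a Borel set \<open>A\<close> of the unit sphere is \<open>n + 1\<close> times the volume of the
  cone \<open>{r x | 0 < r \<le> 1, x \<in> A}\<close>.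
\<close>

definition surface_measure :: "(real^'m) measure" where
  "surface_measure =
     scale_measure (of_nat CARD('m))
       (distr (restrict_space lborel (cball 0 1 - {0})) (restrict_space borel (sphere 0 1)) sgn)"

definition sph_inner :: "(real^'m \<Rightarrow> complex) \<Rightarrow> (real^'m \<Rightarrow> complex) \<Rightarrow> complex" where
  "sph_inner f g =
     (1 / complex_of_real (measure (surface_measure :: (real^'m) measure) (sphere 0 1))) *
     (LINT x|surface_measure. cnj (f x) * g x)"

definition sph_square_integrable :: "(real^'m \<Rightarrow> complex) \<Rightarrow> bool" where
  "sph_square_integrable f \<longleftrightarrow>
     f \<in> borel_measurable surface_measure \<and> integrable surface_measure (\<lambda>x. (cmod (f x))\<^sup>2)"

definition sph_L2_sums :: "(nat \<Rightarrow> real^'m \<Rightarrow> complex) \<Rightarrow> (real^'m \<Rightarrow> complex) \<Rightarrow> bool" where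
  "sph_L2_sums u f \<longleftrightarrow>
     (\<lambda>N. \<integral>\<^sup>+ x. ennreal ((cmod (f x - (\<Sum>l<N. u l x)))\<^sup>2) \<partial>surface_measure) \<longlonglongrightarrow> 0"

section \<open>Spherical coordinates\<close>

definition sph_angles :: "nat \<Rightarrow> ((nat \<Rightarrow> real) \<times> real) set" where
  "sph_angles n = ({1..n-1} \<rightarrow>\<^sub>E {0..pi}) \<times> {0..<2*pi}"

definition sph_point :: "nat \<Rightarrow> (nat \<Rightarrow> 'm) \<Rightarrow> (nat \<Rightarrow> real) \<times> real \<Rightarrow> real^'m" where
  "sph_point n ix = (\<lambda>(\<theta>, \<phi>). \<chi> i.
     let j = inv_into {1..n+1} ix i in
       if j < n then (\<Prod>k=1..<j. sin (\<theta> k)) * cos (\<theta> j)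
       else if j = n then (\<Prod>k=1..<n. sin (\<theta> k)) * cos \<phi>
       else (\<Prod>k=1..<n. sin (\<theta> k)) * sin \<phi>)"

text \<open>
  Where some \<open>sin \<theta>\<^sub>k\<close> vanishes the remaining angles are not determined by the point, and an
  arbitrary choice is made.  The harmonics below do not depend on it, since at \<open>sin \<theta>\<^sub>1 = 0\<close> the
  factor \<open>sin\<^sup>k \<theta>\<^sub>1\<close> vanishes for \<open>k > 0\<close>, while for \<open>k = 0\<close> only \<open>\<theta>\<^sub>1\<close> enters.
\<close>

definition sph_coords :: "nat \<Rightarrow> (nat \<Rightarrow> 'm) \<Rightarrow> real^'m \<Rightarrow> (nat \<Rightarrow> real) \<times> real" where
  "sph_coords n ix x = (SOME p. p \<in> sph_angles n \<and> sph_point n ix p = x)"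

abbreviation sph_theta :: "nat \<Rightarrow> (nat \<Rightarrow> 'm) \<Rightarrow> nat \<Rightarrow> real^'m \<Rightarrow> real" where
  "sph_theta n ix j x \<equiv> fst (sph_coords n ix x) j"

abbreviation sph_phi :: "nat \<Rightarrow> (nat \<Rightarrow> 'm) \<Rightarrow> real^'m \<Rightarrow> real" where
  "sph_phi n ix x \<equiv> snd (sph_coords n ix x)"

definition zonal :: "nat \<Rightarrow> (nat \<Rightarrow> 'm) \<Rightarrow> (real^'m \<Rightarrow> complex) \<Rightarrow> bool" where
  "zonal n ix f \<longleftrightarrow>
     (\<exists>g. \<forall>\<theta> \<phi>. (\<theta>, \<phi>) \<in> sph_angles n \<longrightarrow> f (sph_point n ix (\<theta>, \<phi>)) = g (\<theta> 1))"

lemma sph_coords_partial: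
  fixes y :: "nat \<Rightarrow> real"
  assumes "(\<Sum>j=1..n+1. (y j)\<^sup>2) = 1" "i \<le> n - 1" "n \<ge> 2"
  shows "\<exists>\<theta>. \<theta> \<in> {1..i} \<rightarrow>\<^sub>E {0..pi} \<and>
           (\<forall>j\<in>{1..i}. y j = (\<Prod>k=1..<j. sin (\<theta> k)) * cos (\<theta> j)) \<and>
           (\<Prod>k=1..<Suc i. sin (\<theta> k))\<^sup>2 = (\<Sum>j=Suc i..n+1. (y j)\<^sup>2)"
  using assms(2)
proof (induction i)
  case 0
  then show ?case using assms by auto
next
  case (Suc i)
  then obtain \<theta> where th: "\<theta> \<in> {1..i} \<rightarrow>\<^sub>E {0..pi}"
    and y: "\<And>j. j \<in> {1..i} \<Longrightarrow> y j = (\<Prod>k=1..<j. sin (\<theta> k)) * cos (\<theta> j)"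
    and P: "(\<Prod>k=1..<Suc i. sin (\<theta> k))\<^sup>2 = (\<Sum>j=Suc i..n+1. (y j)\<^sup>2)"
    by auto
  define P where "P = (\<Prod>k=1..<Suc i. sin (\<theta> k))"
  have P0: "P \<ge> 0"
    unfolding P_def using th by (intro prod_nonneg) (auto intro!: sin_ge_zero dest!: PiE_mem)
  have split: "P\<^sup>2 = (y (Suc i))\<^sup>2 + (\<Sum>j=Suc (Suc i)..n+1. (y j)\<^sup>2)"
    using P Suc.prems by (simp add: P_def sum.atLeast_Suc_atMost)
  have "(y (Suc i))\<^sup>2 \<le> P\<^sup>2"
    unfolding split by (simp add: sum_nonneg)
  hence le: "\<bar>y (Suc i)\<bar> \<le> P"
    using P0 by (simp add: power2_le_iff_abs_le)
  define t where "t = arccos (if P = 0 then 0 else y (Suc i) / P)"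
  have b: "\<bar>if P = 0 then 0 else y (Suc i) / P\<bar> \<le> 1"
    using le P0 by (auto simp: divide_simps)
  have t: "0 \<le> t" "t \<le> pi" "P * cos t = y (Suc i)"
    using b le by (auto simp: t_def arccos_bounded abs_le_iff intro!: arccos_lbound arccos_ubound)
  have sq: "(P * sin t)\<^sup>2 = (\<Sum>j=Suc (Suc i)..n+1. (y j)\<^sup>2)"
  proof -
    have "(P * sin t)\<^sup>2 = P\<^sup>2 - (P * cos t)\<^sup>2"
      by (simp add: power_mult_distrib sin_squared_eq algebra_simps)
    thus ?thesis using split t by simp
  qed
  let ?\<theta> = "\<theta>(Suc i := t)"
  have pr: "(\<Prod>k=1..<j. sin (?\<theta> k)) = (\<Prod>k=1..<j. sin (\<theta> k))" if "j \<le> Suc i" for j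
    using that by (intro prod.cong) auto
  have "?\<theta> \<in> {1..Suc i} \<rightarrow>\<^sub>E {0..pi}"
    using th t by (auto simp: PiE_iff extensional_def)
  moreover have "\<forall>j\<in>{1..Suc i}. y j = (\<Prod>k=1..<j. sin (?\<theta> k)) * cos (?\<theta> j)"
    using y t pr by (auto simp: P_def le_Suc_eq)
  moreover have "(\<Prod>k=1..<Suc (Suc i). sin (?\<theta> k)) = P * sin t"
    using pr[of "Suc i"] by (simp add: P_def prod.atLeastLessThan_Suc del: fun_upd_apply) simp
  ultimately show ?case using sq by metis
qed

lemma sum_coords:
  fixes x :: "real^'m"
  assumes "bij_betw ix {1..n+1} (UNIV :: 'm set)"
  shows "(\<Sum>j=1..n+1. (x $ ix j)\<^sup>2) = (norm x)\<^sup>2"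
  using sum.reindex_bij_betw[OF assms, of "\<lambda>i. (x $ i)\<^sup>2"]
  by (simp add: norm_vec_def L2_set_def sum_nonneg)

lemma sph_coords_exist:
  fixes x :: "real^'m"
  assumes ix: "bij_betw ix {1..n+1} (UNIV :: 'm set)" and n: "n \<ge> 2" and x: "x \<in> sphere 0 1"
  shows "sph_coords n ix x \<in> sph_angles n" "sph_point n ix (sph_coords n ix x) = x"
proof -
  define y where "y = (\<lambda>j. x $ ix j)"
  have y1: "(\<Sum>j=1..n+1. (y j)\<^sup>2) = 1"
    using sum_coords[OF ix, of x] x by (simp add: y_def)
  obtain \<theta> where th: "\<theta> \<in> {1..n-1} \<rightarrow>\<^sub>E {0..pi}"
    and yj: "\<And>j. j \<in> {1..n-1} \<Longrightarrow> y j = (\<Prod>k=1..<j. sin (\<theta> k)) * cos (\<theta> j)"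
    and P: "(\<Prod>k=1..<Suc (n-1). sin (\<theta> k))\<^sup>2 = (\<Sum>j=Suc (n-1)..n+1. (y j)\<^sup>2)"
    using sph_coords_partial[OF y1 order.refl n] by blast
  define P where "P = (\<Prod>k=1..<n. sin (\<theta> k))"
  have PP: "P\<^sup>2 = (y n)\<^sup>2 + (y (Suc n))\<^sup>2"
    using P n by (simp add: P_def)
  have "\<exists>\<phi>\<ge>0. \<phi> < 2*pi \<and> y n = P * cos \<phi> \<and> y (Suc n) = P * sin \<phi>"
  proof (cases "P = 0")
    case True
    thus ?thesis using PP by (intro exI[of _ 0]) auto
  next
    case False
    have "(y n / P)\<^sup>2 + (y (Suc n) / P)\<^sup>2 = ((y n)\<^sup>2 + (y (Suc n))\<^sup>2) / P\<^sup>2"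
      by (simp add: power_divide add_divide_distrib)
    also have "\<dots> = 1" using False by (simp flip: PP)
    finally obtain \<phi> where "0 \<le> \<phi>" "\<phi> < 2*pi" "y n / P = cos \<phi>" "y (Suc n) / P = sin \<phi>"
      by (rule sincos_total_2pi)
    thus ?thesis using False by (intro exI[of _ \<phi>]) (auto simp: field_simps)
  qed
  then obtain \<phi> where ph: "0 \<le> \<phi>" "\<phi> < 2*pi" "y n = P * cos \<phi>" "y (Suc n) = P * sin \<phi>"
    by auto
  have "sph_point n ix (\<theta>, \<phi>) = x"
  proof (rule vec_eq_iff[THEN iffD2], rule allI)
    fix i :: 'm
    define j where "j = inv_into {1..n+1} ix i"
    have j: "j \<in> {1..n+1}" "ix j = i"
      using inv_into_into[of i ix "{1..n+1}"] f_inv_into_f[of i ix "{1..n+1}"] ix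
      unfolding j_def bij_betw_def by blast+
    have "y j = (if j < n then (\<Prod>k=1..<j. sin (\<theta> k)) * cos (\<theta> j)
       else if j = n then P * cos \<phi> else P * sin \<phi>)"
    proof -
      consider "j \<in> {1..n-1}" "j < n" | "j = n" | "j = Suc n" using j n by fastforce
      thus ?thesis using yj[of j] ph by cases auto
    qed
    thus "sph_point n ix (\<theta>, \<phi>) $ i = x $ i"
      using j(2) unfolding sph_point_def Let_def case_prod_conv vec_lambda_beta
        j_def[symmetric] P_def y_def by simp
  qed
  moreover have "(\<theta>, \<phi>) \<in> sph_angles n"
    using th ph by (auto simp: sph_angles_def)
  ultimately have "\<exists>p. p \<in> sph_angles n \<and> sph_point n ix p = x" by blast
  from someI_ex[OF this]
  show "sph_coords n ix x \<in> sph_angles n" "sph_point n ix (sph_coords n ix x) = x"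
    by (simp_all add: sph_coords_def)
qed

section \<open>Hyperspherical harmonics\<close>

text \<open>The generating function \<open>(1 - 2 t r + r\<^sup>2)\<^sup>-\<^sup>\<mu>\<close>, as a formal power series in \<open>r\<close>.\<close>

definition gegenbauer :: "real \<Rightarrow> nat \<Rightarrow> real \<Rightarrow> real" where
  "gegenbauer \<mu> l t =
     fps_nth (fps_binomial (- \<mu>) oo (fps_X ^ 2 - fps_const (2 * t) * fps_X)) l"

definition sph_normalize :: "(real^'m \<Rightarrow> complex) \<Rightarrow> real^'m \<Rightarrow> complex" where
  "sph_normalize h x = complex_of_real (1 / sqrt (Re (sph_inner h h))) * h x"

text \<open>\<open>Y\<^sub>l\<^sup>(\<^sup>k\<^sup>,\<^sup>0\<^sup>,\<^sup>\<dots>\<^sup>,\<^sup>0\<^sup>)\<close> for \<open>n \<ge> 3\<close>.\<close>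

definition Y_ge3 :: "nat \<Rightarrow> (nat \<Rightarrow> 'm) \<Rightarrow> nat \<Rightarrow> nat \<Rightarrow> real^'m \<Rightarrow> complex" where
  "Y_ge3 n ix l k =
     (if k > l then (\<lambda>x. 0) else
      sph_normalize (\<lambda>x. complex_of_real
        (let lam = (real n - 1) / 2; \<theta>1 = sph_theta n ix 1 x; \<theta>2 = sph_theta n ix 2 x in
         gegenbauer (lam + real k) (l - k) (cos \<theta>1) * sin \<theta>1 ^ k *
         gegenbauer (lam - 1/2) k (cos \<theta>2))))"

text \<open>\<open>Y\<^sub>l\<^sup>k\<close> for \<open>n = 2\<close>, with \<open>k\<close> of either sign.\<close>

definition Y_2 :: "(nat \<Rightarrow> 'm) \<Rightarrow> nat \<Rightarrow> int \<Rightarrow> real^'m \<Rightarrow> complex" where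
  "Y_2 ix l k =
     (if nat \<bar>k\<bar> > l then (\<lambda>x. 0) else
      sph_normalize (\<lambda>x.
        let \<theta>1 = sph_theta 2 ix 1 x; \<phi> = sph_phi 2 ix x in
        complex_of_real (gegenbauer (real (nat \<bar>k\<bar>) + 1/2) (l - nat \<bar>k\<bar>) (cos \<theta>1) *
          sin \<theta>1 ^ nat \<bar>k\<bar>) * cis (of_int k * \<phi>)))"

definition Y :: "nat \<Rightarrow> (nat \<Rightarrow> 'm) \<Rightarrow> nat \<Rightarrow> nat \<Rightarrow> real^'m \<Rightarrow> complex" where
  "Y n ix l k = (if n = 2 then Y_2 ix l (int k) else Y_ge3 n ix l k)"

definition coeff_Y :: "nat \<Rightarrow> (nat \<Rightarrow> 'm) \<Rightarrow> nat \<Rightarrow> nat \<Rightarrow> (real^'m \<Rightarrow> complex) \<Rightarrow> complex" where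
  "coeff_Y n ix l k g = sph_inner (Y n ix l k) g"

text \<open>
  The harmonic that accompanies the coefficient \<open>a\<^sub>l\<^sup>k\<close> in the expansion.  For \<open>n = 2\<close> this is
  \<open>Y\<^sub>l\<^sup>k + Y\<^sub>l\<^sup>-\<^sup>k\<close>; the two summands coincide for \<open>k = 0\<close>, and \<open>Y\<^sub>l\<^sup>0\<close> is then counted only once.
\<close>

definition Y_sym :: "nat \<Rightarrow> (nat \<Rightarrow> 'm) \<Rightarrow> nat \<Rightarrow> nat \<Rightarrow> real^'m \<Rightarrow> complex" where
  "Y_sym n ix l k x =
     (if n = 2 \<and> k > 0 then Y_2 ix l (int k) x + Y_2 ix l (- int k) x else Y n ix l k x)"

definition beta :: "nat \<Rightarrow> nat \<Rightarrow> nat \<Rightarrow> real" where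
  "beta n l k =
     (if n = 2 then sqrt ((real l - real k) * (real l + real k + 1)) / 2
      else let lam = (real n - 1) / 2 in
        sqrt ((real k + 1) * (2 * lam + real k - 1) * (real l - real k) * (2 * lam + real l + real k) /
              ((2 * lam + 2 * real k - 1) * (2 * lam + 2 * real k + 1))))"

section \<open>Rotations and derivatives along them\<close>

definition rot :: "(nat \<Rightarrow> 'm) \<Rightarrow> real \<Rightarrow> real^'m \<Rightarrow> real^'m" where
  "rot ix \<Theta> x = (\<chi> i.
     if i = ix 1 then x $ ix 1 * cos \<Theta> - x $ ix 2 * sin \<Theta>
     else if i = ix 2 then x $ ix 1 * sin \<Theta> + x $ ix 2 * cos \<Theta>
     else x $ i)"

definition higher_vderiv :: "nat \<Rightarrow> (real \<Rightarrow> complex) \<Rightarrow> real \<Rightarrow> complex" where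
  "higher_vderiv d = (\<lambda>g t. vector_derivative g (at t)) ^^ d"

definition rot_deriv :: "(nat \<Rightarrow> 'm) \<Rightarrow> nat \<Rightarrow> (real^'m \<Rightarrow> complex) \<Rightarrow> real^'m \<Rightarrow> complex" where
  "rot_deriv ix d f x = higher_vderiv d (\<lambda>\<Theta>. f (rot ix \<Theta> x)) 0"

definition deriv_coeff ::
    "nat \<Rightarrow> (nat \<Rightarrow> 'm) \<Rightarrow> (real^'m \<Rightarrow> complex) \<Rightarrow> nat \<Rightarrow> nat \<Rightarrow> nat \<Rightarrow> complex" where
  "deriv_coeff n ix f l k d = coeff_Y n ix l k (rot_deriv ix d f)"

text \<open>
  The regularity under which \<open>f\<^sup>(\<^sup>0\<^sup>), \<dots>, f\<^sup>(\<^sup>d\<^sup>)\<close> and their Fourier coefficients make sense: the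
  classical derivatives exist at all points of the sphere and are square integrable.  Every
  function of class \<open>C\<^sup>d\<close> on the sphere qualifies.
\<close>

definition rot_differentiable :: "(nat \<Rightarrow> 'm) \<Rightarrow> nat \<Rightarrow> (real^'m \<Rightarrow> complex) \<Rightarrow> bool" where
  "rot_differentiable ix d f \<longleftrightarrow>
     (\<forall>x\<in>sphere 0 1. \<forall>i<d. \<forall>t. higher_vderiv i (\<lambda>\<Theta>. f (rot ix \<Theta> x)) differentiable at t) \<and>
     (\<forall>i\<le>d. sph_square_integrable (rot_deriv ix i f))"

end

theory Submission
  imports Defs
begin

text \<open>
  Let \<open>D\<close> be the derivative along the rotations of the \<open>x\<^sub>1x\<^sub>2\<close>-plane, so that \<open>f\<^sup>(\<^sup>d\<^sup>) = D\<^sup>d f\<close>. A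
  zonal function depends on \<open>x\<^sub>1\<close> only, hence \<open>f\<^sup>(\<^sup>d\<^sup>)\<close> depends on \<open>x\<^sub>1\<close> and \<open>x\<^sub>2\<close> only, and everything
  takes place among such functions.

  Up to normalization the harmonics are \<open>Z\<^sub>l\<^sup>k = C\<^sub>l\<^sub>-\<^sub>k\<^sup>\<lambda>\<^sup>+\<^sup>k(x\<^sub>1) Q\<^sub>k\<close>. Here \<open>Q\<^sub>k\<close> is a polynomial in \<open>x\<^sub>2\<close>
  and \<open>x\<^sub>2\<^sup>2 + \<dots> + x\<^sub>n\<^sub>+\<^sub>1\<^sup>2\<close>, homogeneous of degree \<open>k\<close> in the coordinates; for \<open>n = 2\<close> it is the real
  part of \<open>(x\<^sub>2 + i x\<^sub>3)\<^sup>k\<close>, and \<open>Z\<^sub>l\<^sup>k\<close> then stands for the symmetric combination of \<open>Y\<^sub>l\<^sup>k\<close> and \<open>Y\<^sub>l\<^sup>-\<^sup>k\<close>.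
  Identities for Gegenbauer polynomials give the ladder relation that \<open>D Z\<^sub>l\<^sup>k\<close> is a combination of
  \<open>Z\<^sub>l\<^sup>k\<^sup>+\<^sup>1\<close> and \<open>Z\<^sub>l\<^sup>k\<^sup>-\<^sup>1\<close> (\<open>harm_Z_rotate_deriv\<close>).

  The surface measure is invariant under rotations, so the integral of a derivative along
  rotations vanishes (\<open>surface_integral_rot_derivative\<close>). For this the derivative only has to
  exist everywhere and to be integrable, because the fundamental theorem of calculus is applied on
  each circle separately. In other words \<open>D\<close> is skew-symmetric, and this has three consequences.

  First, for rotations of the \<open>x\<^sub>2x\<^sub>3\<close>-plane it makes different \<open>Q\<^sub>k\<close> orthogonal with respect to
  every weight in \<open>x\<^sub>1\<close>. Together with the ladder relation it then makes the \<open>Z\<^sub>l\<^sup>k\<close> orthogonal in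
  \<open>l\<close> as well and expresses the ratio of the norms of \<open>Z\<^sub>l\<^sup>k\<^sup>+\<^sup>1\<close> and \<open>Z\<^sub>l\<^sup>k\<close> by the two ladder
  constants (\<open>ip_ladder\<close>).

  Second, moving \<open>D\<close> from \<open>f\<^sup>(\<^sup>d\<^sup>)\<close> to \<open>Z\<^sub>l\<^sup>k\<close> in the coefficient integral yields a two-term recursion
  (\<open>zcoef_deriv\<close>). After normalization both constants become \<open>\<beta>\<^sub>l\<^sub>,\<^sub>k\<close> (\<open>rho_ratio\<close>), since \<open>\<beta>\<^sub>l\<^sub>,\<^sub>k\<^sup>2\<close>
  is the product of the two ladder constants; the exception is \<open>n = 2\<close> and \<open>k = 0\<close>, where the
  different normalization of \<open>Y\<^sub>l\<^sup>0\<close> and \<open>Y\<^sub>l\<^sup>1 + Y\<^sub>l\<^sup>-\<^sup>1\<close> leads to the extra factor \<open>2\<close>. As the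
  coefficients of a zonal function vanish for \<open>k > 0\<close>, those of \<open>f\<^sup>(\<^sup>d\<^sup>)\<close> vanish unless \<open>k \<le> d\<close> and
  \<open>k + d\<close> is even.

  Third, every square integrable function of \<open>x\<^sub>1\<close> and \<open>x\<^sub>2\<close> is the limit in square mean of its
  expansion in the \<open>Z\<^sub>l\<^sup>k\<close> (\<open>plane_dep_expansion\<close>): polynomials are dense, and each polynomial in
  \<open>x\<^sub>1\<close> and \<open>x\<^sub>2\<close> is a combination of the \<open>Z\<^sub>l\<^sup>k\<close>. This is the convergence of the series in square
  mean.

  If \<open>f\<close> has derivatives of all orders, then Bessel's inequality for \<open>f\<^sup>(\<^sup>m\<^sup>)\<close> and the recursion show
  that \<open>a\<^sub>l\<^sup>0(f)\<close> decays faster than every power of \<open>l\<close>, whereas \<open>Z\<^sub>l\<^sup>k\<close> grows polynomially in \<open>l\<close>.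
  All the series therefore converge uniformly. The series of \<open>f\<close> agrees with \<open>f\<close> almost
  everywhere, hence everywhere by continuity, and the series of \<open>f\<^sup>(\<^sup>d\<^sup>)\<close> arises from it by termwise
  differentiation.
\<close>

section \<open>Gegenbauer polynomials\<close>

text \<open>
  The polynomial of the preceding degree, with \<open>C\<^sub>-\<^sub>1 = 0\<close>; this lets the contiguity relations hold
  at degree \<open>0\<close> too.
\<close>

definition gegenbauer_prev :: "real \<Rightarrow> nat \<Rightarrow> real \<Rightarrow> real" where
  "gegenbauer_prev \<mu> m t = (case m of 0 \<Rightarrow> 0 | Suc j \<Rightarrow> gegenbauer \<mu> j t)"

lemma gegenbauer_prev_simps [simp]:
  "gegenbauer_prev \<mu> 0 t = 0" "gegenbauer_prev \<mu> (Suc m) t = gegenbauer \<mu> m t"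
  by (simp_all add: gegenbauer_prev_def)

lemma gegenbauer_0 [simp]: "gegenbauer \<mu> 0 t = 1"
  by (simp add: gegenbauer_def)

text \<open>
  Coefficient form of \<open>(1 - 2 t r + r\<^sup>2)\<^sup>-\<^sup>\<mu> = (1 - 2 t r + r\<^sup>2) (1 - 2 t r + r\<^sup>2)\<^sup>-\<^sup>\<mu>\<^sup>-\<^sup>1\<close>. This relation
  and the next one imply all the others below.
\<close>

lemma gegenbauer_raise:
  "gegenbauer \<mu> (Suc m) t =
     gegenbauer (\<mu> + 1) (Suc m) t - 2 * t * gegenbauer (\<mu> + 1) m t + gegenbauer_prev (\<mu> + 1) m t"
proof -
  define c :: "real fps" where "c = fps_X ^ 2 - fps_const (2 * t) * fps_X"
  have c0: "fps_nth c 0 = 0" by (simp add: c_def power2_eq_square)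
  have "fps_binomial (- \<mu>) = fps_binomial 1 * fps_binomial (- (\<mu> + 1))"
    by (simp flip: fps_binomial_add_mult)
  hence "fps_binomial (- \<mu>) oo c = (1 + c) * (fps_binomial (- (\<mu> + 1)) oo c)"
    by (simp add: fps_compose_mult_distrib[OF c0] fps_binomial_1 fps_compose_add_distrib
        fps_X_fps_compose_startby0[OF c0] del: minus_add_distrib)
  hence "fps_nth (fps_binomial (- \<mu>) oo c) (Suc m) =
      fps_nth ((1 + c) * (fps_binomial (- (\<mu> + 1)) oo c)) (Suc m)"
    by simp
  thus ?thesis
    unfolding gegenbauer_def gegenbauer_prev_def c_def
    by (cases m) (simp_all add: algebra_simps power2_eq_square)
qed

text \<open>
  Coefficient form of the derivative of the generating function with respect to \<open>r\<close>.
\<close>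

lemma gegenbauer_generating_deriv:
  "real (Suc m) * gegenbauer \<mu> (Suc m) t =
     2 * \<mu> * (t * gegenbauer (\<mu> + 1) m t - gegenbauer_prev (\<mu> + 1) m t)"
proof -
  define c :: "real fps" where "c = fps_X ^ 2 - fps_const (2 * t) * fps_X"
  have c0: "fps_nth c 0 = 0" by (simp add: c_def power2_eq_square)
  have "fps_deriv (fps_binomial (- \<mu>)) = fps_const (- \<mu>) * fps_binomial (- (\<mu> + 1))"
  proof (rule fps_ext)
    fix k
    have "- (\<mu> + 1) = - \<mu> - 1" by simp
    hence e: "- (\<mu> + 1) gchoose k = - \<mu> - 1 gchoose k" by (simp only:)
    show "fps_nth (fps_deriv (fps_binomial (- \<mu>))) k
        = fps_nth (fps_const (- \<mu>) * fps_binomial (- (\<mu> + 1))) k"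
      using gbinomial_absorption[of k "- \<mu>"] e by (simp del: minus_add_distrib)
  qed
  hence "fps_deriv (fps_binomial (- \<mu>) oo c)
      = fps_const (- \<mu>) * (fps_binomial (- (\<mu> + 1)) oo c) * fps_deriv c"
    by (simp add: fps_compose_deriv[OF c0] fps_compose_mult_distrib[OF c0])
  also have "fps_deriv c = fps_const 2 * fps_X - fps_const (2 * t)"
    by (simp add: c_def power2_eq_square numeral_fps_const algebra_simps flip: mult_2)
  finally have "fps_nth (fps_deriv (fps_binomial (- \<mu>) oo c)) m
      = fps_nth (fps_const (- \<mu>) * (fps_binomial (- (\<mu> + 1)) oo c) *
          (fps_const 2 * fps_X - fps_const (2 * t))) m" by simp
  thus ?thesis
    unfolding gegenbauer_def gegenbauer_prev_def c_def
    by (cases m) (simp_all add: algebra_simps)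
qed

lemma gegenbauer_difference:
  "(real (Suc m) + \<mu>) * gegenbauer \<mu> (Suc m) t =
     \<mu> * (gegenbauer (\<mu> + 1) (Suc m) t - gegenbauer_prev (\<mu> + 1) m t)"
proof -
  have "\<mu> * gegenbauer \<mu> (Suc m) t = \<mu> * (gegenbauer (\<mu> + 1) (Suc m) t
      - 2 * t * gegenbauer (\<mu> + 1) m t + gegenbauer_prev (\<mu> + 1) m t)"
    by (simp only: gegenbauer_raise[of \<mu> m t])
  thus ?thesis using gegenbauer_generating_deriv[of m \<mu> t]
    by (simp add: algebra_simps)
qed

lemma gegenbauer_euler:
  "(real m + 2 * \<mu>) * gegenbauer \<mu> m t =
     2 * \<mu> * (gegenbauer (\<mu> + 1) m t - t * gegenbauer_prev (\<mu> + 1) m t)"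
proof (cases m)
  case (Suc j)
  have "2 * \<mu> * gegenbauer \<mu> (Suc j) t = 2 * \<mu> * (gegenbauer (\<mu> + 1) (Suc j) t
      - 2 * t * gegenbauer (\<mu> + 1) j t + gegenbauer_prev (\<mu> + 1) j t)"
    by (simp only: gegenbauer_raise[of \<mu> j t])
  thus ?thesis using gegenbauer_generating_deriv[of j \<mu> t]
    by (simp add: Suc algebra_simps)
qed simp

lemma gegenbauer_three_term:
  "real (Suc m) * gegenbauer \<mu> (Suc m) t =
     2 * (real m + \<mu>) * t * gegenbauer \<mu> m t - (real m + 2 * \<mu> - 1) * gegenbauer_prev \<mu> m t"
proof (cases m)
  case 0
  thus ?thesis using gegenbauer_generating_deriv[of 0 \<mu> t] by simp
next
  case (Suc j)
  let ?P = "gegenbauer (\<mu> + 1)"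
  let ?y = "gegenbauer \<mu> (Suc j) t"
  have 1: "real (Suc m) * gegenbauer \<mu> (Suc m) t = 2 * \<mu> * (t * ?P (Suc j) t - ?P j t)"
    using gegenbauer_generating_deriv[of m \<mu> t] by (simp add: Suc)
  have 2: "t * (real (Suc j) * ?y) = t * (2 * \<mu> * (t * ?P j t - gegenbauer_prev (\<mu> + 1) j t))"
    using gegenbauer_generating_deriv[of j \<mu> t] by simp
  have 3: "t * ((real (Suc j) + 2 * \<mu>) * ?y) = t * (2 * \<mu> * (?P (Suc j) t - t * ?P j t))"
    using gegenbauer_euler[of "Suc j" \<mu> t] by simp
  have 4: "(real j + 2 * \<mu>) * gegenbauer \<mu> j t =
      2 * \<mu> * (?P j t - t * gegenbauer_prev (\<mu> + 1) j t)"
    by (rule gegenbauer_euler)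
  show ?thesis
    using 1 2 3 4 by (simp add: Suc algebra_simps)
qed

text \<open>
  Differentiating the three-term recursion gives the derivative of each polynomial from those of
  the two preceding ones.
\<close>

lemma gegenbauer_deriv:
  "(gegenbauer \<mu> m has_real_derivative 2 * \<mu> * gegenbauer_prev (\<mu> + 1) m t) (at t)"
proof (induction m rule: less_induct)
  case (less m)
  show ?case
  proof (cases m)
    case 0
    have "gegenbauer \<mu> 0 = (\<lambda>t. 1)" by auto
    thus ?thesis using 0 by simp
  next
    case (Suc j)
    have fn: "gegenbauer \<mu> m = (\<lambda>s. (2 * (real j + \<mu>) * s * gegenbauer \<mu> j s
        - (real j + 2 * \<mu> - 1) * gegenbauer_prev \<mu> j s) / real (Suc j))"
      unfolding Suc gegenbauer_three_term[symmetric] by (intro ext nonzero_eq_divide_eq[THEN iffD2]) (simp_all add: mult.commute)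
    have d1: "(gegenbauer \<mu> j has_real_derivative 2 * \<mu> * gegenbauer_prev (\<mu> + 1) j t) (at t)"
      using less[of j] Suc by simp
    have d2: "(gegenbauer_prev \<mu> j has_real_derivative
        2 * \<mu> * gegenbauer_prev (\<mu> + 1) (j - 1) t) (at t)"
    proof (cases j)
      case 0
      have "gegenbauer_prev \<mu> 0 = (\<lambda>t. 0)" by auto
      thus ?thesis using 0 by simp
    next
      case (Suc i)
      have "gegenbauer_prev \<mu> j = gegenbauer \<mu> i" using Suc by auto
      thus ?thesis using less[of i] \<open>m = Suc j\<close> Suc by simp
    qed
    let ?D = "(2 * (real j + \<mu>) * (gegenbauer \<mu> j t + t * (2 * \<mu> * gegenbauer_prev (\<mu> + 1) j t))
        - (real j + 2 * \<mu> - 1) * (2 * \<mu> * gegenbauer_prev (\<mu> + 1) (j - 1) t)) / real (Suc j)"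
    have D: "(gegenbauer \<mu> m has_real_derivative ?D) (at t)"
      unfolding fn
      by (rule DERIV_cdivide derivative_eq_intros refl d1 d2)+ (simp add: algebra_simps)
    have "?D = 2 * \<mu> * gegenbauer (\<mu> + 1) j t"
    proof (cases j)
      case 0
      thus ?thesis by simp
    next
      case (Suc i)
      have t3: "real (Suc i) * gegenbauer (\<mu> + 1) (Suc i) t =
          2 * (real i + (\<mu> + 1)) * t * gegenbauer (\<mu> + 1) i t
          - (real i + 2 * (\<mu> + 1) - 1) * gegenbauer_prev (\<mu> + 1) i t"
        by (rule gegenbauer_three_term)
      have "2 * (real j + \<mu>) * gegenbauer \<mu> j t
          = 2 * \<mu> * (gegenbauer (\<mu> + 1) (Suc i) t - gegenbauer_prev (\<mu> + 1) i t)"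
        using gegenbauer_difference[of i \<mu> t] by (simp add: Suc algebra_simps)
      moreover have "2 * \<mu> * (real (Suc i) * gegenbauer (\<mu> + 1) (Suc i) t) =
          2 * \<mu> * (2 * (real i + (\<mu> + 1)) * t * gegenbauer (\<mu> + 1) i t
          - (real i + 2 * (\<mu> + 1) - 1) * gegenbauer_prev (\<mu> + 1) i t)"
        by (simp only: t3)
      ultimately have "2 * (real j + \<mu>) * (gegenbauer \<mu> j t + t * (2 * \<mu> * gegenbauer_prev (\<mu> + 1) j t))
        - (real j + 2 * \<mu> - 1) * (2 * \<mu> * gegenbauer_prev (\<mu> + 1) (j - 1) t)
        = real (Suc j) * (2 * \<mu> * gegenbauer (\<mu> + 1) j t)"
        by (simp add: Suc algebra_simps)
      thus ?thesis by simp
    qed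
    thus ?thesis using D by (simp add: Suc)
  qed
qed

lemma gegenbauer_first_order:
  "2 * \<mu> * (1 - t\<^sup>2) * gegenbauer_prev (\<mu> + 1) m t =
     (real m + 2 * \<mu> - 1) * gegenbauer_prev \<mu> m t - real m * t * gegenbauer \<mu> m t"
proof (cases m)
  case (Suc j)
  have 1: "t * (real (Suc j) * gegenbauer \<mu> (Suc j) t) =
     t * (2 * \<mu> * (t * gegenbauer (\<mu> + 1) j t - gegenbauer_prev (\<mu> + 1) j t))"
    by (simp only: gegenbauer_generating_deriv)
  show ?thesis using 1 gegenbauer_euler[of j \<mu> t]
    by (simp add: Suc algebra_simps power2_eq_square)
qed simp

text \<open>
  This is the combination in which differentiation lowers the parameter and raises the degree; it
  produces the downward part of the ladder relation.
\<close>

lemma gegenbauer_lower: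
  assumes "\<mu> \<noteq> 1"
  shows "2 * \<mu> * (1 - t\<^sup>2) * gegenbauer_prev (\<mu> + 1) m t - (2 * \<mu> - 1) * t * gegenbauer \<mu> m t =
     - (real m + 1) * (real m + 2 * \<mu> - 1) / (2 * (\<mu> - 1)) * gegenbauer (\<mu> - 1) (Suc m) t"
proof -
  have g: "(real m + 1) * gegenbauer (\<mu> - 1) (Suc m) t =
      2 * (\<mu> - 1) * (t * gegenbauer \<mu> m t - gegenbauer_prev \<mu> m t)"
    using gegenbauer_generating_deriv[of m "\<mu> - 1" t] by (simp add: algebra_simps)
  have "- (real m + 1) * (real m + 2 * \<mu> - 1) / (2 * (\<mu> - 1)) * gegenbauer (\<mu> - 1) (Suc m) t
      = - (real m + 2 * \<mu> - 1) * ((real m + 1) * gegenbauer (\<mu> - 1) (Suc m) t) / (2 * (\<mu> - 1))"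
    unfolding times_divide_eq_left by (simp only: mult_minus_left mult.assoc mult.left_commute)
  also have "\<dots> = - (real m + 2 * \<mu> - 1) * (t * gegenbauer \<mu> m t - gegenbauer_prev \<mu> m t)"
    unfolding g using assms by (simp add: field_simps)
  finally show ?thesis
    using gegenbauer_first_order[of \<mu> t m] by (simp add: algebra_simps)
qed

lemma gegenbauer_minus: "gegenbauer \<mu> m (- t) = (- 1) ^ m * gegenbauer \<mu> m t"
proof (induction m rule: less_induct)
  case (less m)
  show ?case
  proof (cases m)
    case (Suc j)
    have p: "gegenbauer_prev \<mu> j (- t) = (- 1) ^ Suc j * gegenbauer_prev \<mu> j t"
      using less[of "j - 1"] Suc by (cases j) auto
    have q: "gegenbauer \<mu> j (- t) = (- 1) ^ j * gegenbauer \<mu> j t"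
      using less[of j] Suc by auto
    have "real (Suc j) * gegenbauer \<mu> (Suc j) (- t)
        = (- 1) ^ Suc j * (real (Suc j) * gegenbauer \<mu> (Suc j) t)"
      unfolding gegenbauer_three_term p q by (simp add: algebra_simps)
    hence "real (Suc j) * gegenbauer \<mu> (Suc j) (- t)
        = real (Suc j) * ((- 1) ^ Suc j * gegenbauer \<mu> (Suc j) t)"
      by (simp only: mult.left_commute)
    thus ?thesis unfolding Suc by (simp only: mult_cancel_left of_nat_eq_0_iff) simp
  qed simp
qed

text \<open>
  The value at \<open>1\<close> is \<open>\<Prod>(j + 2 \<mu>) / (j + 1)\<close> over \<open>j < m\<close>; Bernoulli's inequality bounds each
  factor by \<open>((j + 2) / (j + 1))\<^sup>K\<close>, and the product telescopes.
\<close>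

lemma gegenbauer_at_1:
  assumes "\<mu> > 0" "2 * \<mu> \<le> real K"
  shows "0 \<le> gegenbauer \<mu> m 1 \<and> gegenbauer \<mu> m 1 \<le> real (Suc m) ^ K"
proof (induction m)
  case (Suc m)
  have eq: "gegenbauer \<mu> (Suc m) 1 = (real m + 2 * \<mu>) / real (Suc m) * gegenbauer \<mu> m 1"
    using gegenbauer_first_order[of \<mu> 1 "Suc m"] by (simp add: field_simps)
  have nz: "0 \<le> (real m + 2 * \<mu>) / real (Suc m)" using assms by auto
  have "(real m + 2 * \<mu>) / real (Suc m) \<le> (real (Suc m) + real K) / real (Suc m)"
    using assms by (intro divide_right_mono) auto
  also have "\<dots> = 1 + real K * (1 / real (Suc m))"
    by (simp add: add_divide_distrib)
  also have "\<dots> \<le> (1 + 1 / real (Suc m)) ^ K"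
    using Bernoulli_inequality[of "1 / real (Suc m)" K] by (simp add: field_simps)
  also have "1 + 1 / real (Suc m) = real (Suc (Suc m)) / real (Suc m)"
    by (simp add: field_simps)
  finally have "gegenbauer \<mu> (Suc m) 1 \<le> (real (Suc (Suc m)) / real (Suc m)) ^ K * real (Suc m) ^ K"
    unfolding eq using Suc nz by (intro mult_mono) auto
  also have "\<dots> = real (Suc (Suc m)) ^ K"
    by (simp add: power_divide del: of_nat_Suc)
  finally show ?case using mult_nonneg_nonneg[OF nz, of "gegenbauer \<mu> m 1"] Suc eq by auto
qed simp

text \<open>
  Sonine's argument: by the differential equation of \<open>y = C\<^sub>m\<^sup>\<mu>\<close> the function
  \<open>m (m + 2 \<mu>) y\<^sup>2 + (1 - t\<^sup>2) y'\<^sup>2\<close> has derivative \<open>4 \<mu> t y'\<^sup>2\<close>, so it increases on \<open>[0, 1]\<close> up to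
  \<open>m (m + 2 \<mu>) y(1)\<^sup>2\<close>.
\<close>

lemma gegenbauer_le_at_1:
  assumes "\<mu> > 0" "0 \<le> t" "t \<le> 1"
  shows "(gegenbauer \<mu> m t)\<^sup>2 \<le> (gegenbauer \<mu> m 1)\<^sup>2"
proof (cases m)
  case (Suc j)
  define M where "M = real m * (real m + 2 * \<mu>)"
  have M: "M > 0" using assms Suc by (simp add: M_def)
  define y where "y = gegenbauer \<mu> m"
  define z where "z = (\<lambda>t. 2 * \<mu> * gegenbauer (\<mu> + 1) j t)"
  define w where "w = (\<lambda>t. 2 * \<mu> * (2 * (\<mu> + 1) * gegenbauer_prev (\<mu> + 1 + 1) j t))"
  have dy: "(y has_real_derivative z s) (at s)" for s
    using gegenbauer_deriv[of \<mu> m s] by (simp add: y_def z_def Suc)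
  have dz: "(z has_real_derivative w s) (at s)" for s
    using DERIV_cmult[OF gegenbauer_deriv[of "\<mu> + 1" j s], of "2 * \<mu>"]
    by (simp add: z_def w_def)
  have ode: "(1 - s\<^sup>2) * w s = (2 * \<mu> + 1) * s * z s - M * y s" for s
  proof -
    have "(1 - s\<^sup>2) * w s
       = 2 * \<mu> * (2 * (\<mu> + 1) * (1 - s\<^sup>2) * gegenbauer_prev (\<mu> + 1 + 1) j s)"
      unfolding w_def by (simp only: mult_ac)
    also have "\<dots> = 2 * \<mu> * ((real j + 2 * (\<mu> + 1) - 1) * gegenbauer_prev (\<mu> + 1) j s
        - real j * s * gegenbauer (\<mu> + 1) j s)"
      by (simp only: gegenbauer_first_order)
    also have "\<dots> = (real m + 2 * \<mu>) * (2 * \<mu> * gegenbauer_prev (\<mu> + 1) j s) - real j * s * z s"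
      by (simp add: z_def Suc algebra_simps)
    also have "2 * \<mu> * gegenbauer_prev (\<mu> + 1) j s = s * z s - real m * y s"
      using gegenbauer_generating_deriv[of j \<mu> s] by (simp add: z_def y_def Suc algebra_simps)
    finally show ?thesis by (simp add: M_def Suc algebra_simps)
  qed
  define F where "F = (\<lambda>s. M * (y s)\<^sup>2 + (1 - s\<^sup>2) * (z s)\<^sup>2)"
  have "F t \<le> F 1"
  proof (rule DERIV_nonneg_imp_nondecreasing[OF assms(3)])
    fix s assume s: "t \<le> s" "s \<le> 1"
    have "(F has_real_derivative (2 * M * y s * z s - 2 * s * (z s)\<^sup>2 + 2 * z s * ((1 - s\<^sup>2) * w s))) (at s)"
      unfolding F_def power2_eq_square
      by (rule derivative_eq_intros refl dy dz)+ (simp add: algebra_simps)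
    also have "2 * M * y s * z s - 2 * s * (z s)\<^sup>2 + 2 * z s * ((1 - s\<^sup>2) * w s) = 4 * \<mu> * s * (z s)\<^sup>2"
      unfolding ode by (simp add: algebra_simps power2_eq_square)
    finally show "\<exists>D. (F has_real_derivative D) (at s) \<and> 0 \<le> D"
      using assms s by (intro exI[of _ "4 * \<mu> * s * (z s)\<^sup>2"] conjI) auto
  qed
  moreover have "M * (y t)\<^sup>2 \<le> F t" using assms by (simp add: F_def power_le_one)
  ultimately have "M * (y t)\<^sup>2 \<le> M * (y 1)\<^sup>2" by (simp add: F_def)
  thus ?thesis using M by (simp add: y_def)
qed simp

lemma gegenbauer_bound:
  assumes "\<mu> > 0" "2 * \<mu> \<le> real K" "\<bar>t\<bar> \<le> 1"
  shows "\<bar>gegenbauer \<mu> m t\<bar> \<le> real (Suc m) ^ K"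
proof -
  have "(gegenbauer \<mu> m t)\<^sup>2 = (gegenbauer \<mu> m \<bar>t\<bar>)\<^sup>2"
    using gegenbauer_minus[of \<mu> m t] by (simp add: abs_if power_mult_distrib flip: power_mult)
  also have "\<dots> \<le> (gegenbauer \<mu> m 1)\<^sup>2"
    using assms by (intro gegenbauer_le_at_1) auto
  finally have "\<bar>gegenbauer \<mu> m t\<bar> \<le> \<bar>gegenbauer \<mu> m 1\<bar>"
    by (simp add: abs_le_square_iff)
  thus ?thesis using gegenbauer_at_1[OF assms(1,2), of m] by linarith
qed

section \<open>The surface measure and rotations\<close>

lemma nn_integral_lborel_translate:
  fixes f :: "'a::euclidean_space \<Rightarrow> ennreal"
  assumes [measurable]: "f \<in> borel_measurable borel"
  shows "(\<integral>\<^sup>+ x. f (c + x) \<partial>lborel) = (\<integral>\<^sup>+ x. f x \<partial>lborel)"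
proof -
  have "(\<integral>\<^sup>+ x. f x \<partial>lborel) = (\<integral>\<^sup>+ x. f x \<partial>distr lborel borel ((+) c))"
    by (simp add: lborel_distr_plus)
  also have "\<dots> = (\<integral>\<^sup>+ x. f (c + x) \<partial>lborel)"
    by (subst nn_integral_distr) auto
  finally show ?thesis ..
qed

text \<open>
  Both \<open>A \<mapsto> vol (T\<^sup>-\<^sup>1 A)\<close> and \<open>vol\<close> are translation invariant. Evaluating
  \<open>\<integral>\<integral> 1\<^sub>A(T x + y) 1\<^sub>B(y) dx dy\<close> in both orders, with \<open>B\<close> the unit ball, shows that they are
  proportional, and they agree on \<open>B\<close>.
\<close>

lemma lborel_orthogonal_transformation:
  fixes T :: "'a::euclidean_space \<Rightarrow> 'a"
  assumes T: "orthogonal_transformation T" and [measurable]: "A \<in> sets borel"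
  shows "emeasure lborel (T -` A) = emeasure lborel A"
proof -
  define B where "B = ball (0::'a) 1"
  have [measurable]: "B \<in> sets borel" by (simp add: B_def)
  have lin: "linear T" using T by (rule orthogonal_transformation_linear)
  have [measurable]: "T \<in> borel_measurable borel"
    using lin by (simp add: linear_continuous_on linear_conv_bounded_linear borel_measurable_continuous_onI)
  have surj: "surj T" using T by (rule orthogonal_transformation_surj)
  have bT: "T -` B = B"
    using orthogonal_transformation_norm[OF T] by (auto simp: B_def)
  have meas: "emeasure lborel (T -` C) = (\<integral>\<^sup>+ x. indicator C (T x) \<partial>lborel)"
    if [measurable]: "C \<in> sets borel" for C
  proof -
    have "T -` C \<in> sets borel" using measurable_sets[of T borel borel C] by simp
    hence "emeasure lborel (T -` C) = (\<integral>\<^sup>+ x. indicator (T -` C) x \<partial>lborel)" by simp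
    thus ?thesis by (simp add: indicator_def vimage_def)
  qed
  have shift: "(\<integral>\<^sup>+ x. indicator C (T x + y) \<partial>lborel) = emeasure lborel (T -` C)"
    if [measurable]: "C \<in> sets borel" for C y
  proof -
    obtain z where z: "y = T z" using surj by (meson surjD)
    have "(\<integral>\<^sup>+ x. indicator C (T x + y) \<partial>lborel) = (\<integral>\<^sup>+ x. indicator C (T (z + x)) \<partial>lborel)"
      by (simp add: z linear_add[OF lin] add.commute)
    also have "\<dots> = (\<integral>\<^sup>+ x. indicator C (T x) \<partial>lborel)"
      by (rule nn_integral_lborel_translate) measurable
    finally show ?thesis using meas by simp
  qed
  have "(\<integral>\<^sup>+ x. \<integral>\<^sup>+ y. indicator A (T x + y) * indicator B y \<partial>lborel \<partial>lborel)
      = (\<integral>\<^sup>+ y. \<integral>\<^sup>+ x. indicator A (T x + y) * indicator B y \<partial>lborel \<partial>lborel)"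
    by (rule lborel_pair.Fubini') measurable
  also have "\<dots> = (\<integral>\<^sup>+ y. emeasure lborel (T -` A) * indicator B y \<partial>lborel)"
    by (simp add: nn_integral_multc shift)
  also have "\<dots> = emeasure lborel (T -` A) * emeasure lborel B"
    by (simp add: nn_integral_cmult)
  finally have 1: "(\<integral>\<^sup>+ x. \<integral>\<^sup>+ y. indicator A (T x + y) * indicator B y \<partial>lborel \<partial>lborel)
    = emeasure lborel (T -` A) * emeasure lborel B" .
  have "(\<integral>\<^sup>+ y. indicator A (T x + y) * indicator B y \<partial>lborel)
      = (\<integral>\<^sup>+ y. indicator A y * indicator B (T x - y) \<partial>lborel)" for x
  proof -
    have "(\<integral>\<^sup>+ y. indicator A y * indicator B (T x - y) \<partial>lborel)
        = (\<integral>\<^sup>+ y. indicator A (T x + y) * indicator B (T x - (T x + y)) \<partial>lborel)"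
      by (rule nn_integral_lborel_translate[symmetric]) measurable
    thus ?thesis by (simp add: indicator_def B_def)
  qed
  hence "(\<integral>\<^sup>+ x. \<integral>\<^sup>+ y. indicator A (T x + y) * indicator B y \<partial>lborel \<partial>lborel)
      = (\<integral>\<^sup>+ x. \<integral>\<^sup>+ y. indicator A y * indicator B (T x - y) \<partial>lborel \<partial>lborel)" by simp
  also have "\<dots> = (\<integral>\<^sup>+ y. \<integral>\<^sup>+ x. indicator A y * indicator B (T x - y) \<partial>lborel \<partial>lborel)"
    by (rule lborel_pair.Fubini') measurable
  also have "\<dots> = (\<integral>\<^sup>+ y. indicator A y * emeasure lborel (T -` B) \<partial>lborel)"
  proof (rule nn_integral_cong)
    fix y
    have m: "(\<lambda>x. indicator B (T x - y) :: ennreal) \<in> borel_measurable lborel"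
      by measurable
    have "(\<integral>\<^sup>+ x. indicator B (T x - y) \<partial>lborel) = emeasure lborel (T -` B)"
      using shift[of B "- y"] by simp
    thus "(\<integral>\<^sup>+ x. indicator A y * indicator B (T x - y) \<partial>lborel)
        = indicator A y * emeasure lborel (T -` B)"
      by (simp add: nn_integral_cmult[OF m])
  qed
  also have "\<dots> = emeasure lborel A * emeasure lborel B"
    unfolding bT by (simp add: nn_integral_multc)
  finally have eq: "emeasure lborel (T -` A) * emeasure lborel B = emeasure lborel A * emeasure lborel B"
    using 1 by simp
  have "emeasure lborel B \<noteq> 0" "emeasure lborel B \<noteq> \<infinity>"
    using content_ball_pos[of 1 "0::'a"] emeasure_lborel_ball_finite[of "0::'a" 1]
    by (auto simp: measure_def B_def)
  thus ?thesis
    using eq ennreal_mult_cancel_left[of "emeasure lborel B" "emeasure lborel (T -` A)" "emeasure lborel A"]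
    by (simp add: mult.commute)
qed

abbreviation surf :: "(real^'m::finite) measure" where "surf \<equiv> surface_measure"

lemma space_surface [simp]: "space surf = sphere 0 1"
  by (simp add: surface_measure_def space_restrict_space space_scale_measure)

lemma sets_surface [measurable_cong]: "sets surf = sets (restrict_space borel (sphere 0 1))"
  by (simp add: surface_measure_def)

lemma sgn_measurable_sphere:
  "(sgn :: real^'m::finite \<Rightarrow> _) \<in> measurable (restrict_space lborel (cball 0 1 - {0}))
       (restrict_space borel (sphere 0 1))"
proof (rule measurable_restrict_space2)
  show "sgn \<in> space (restrict_space lborel (cball 0 1 - {0})) \<rightarrow> sphere (0::real^'m) 1"
    by (auto simp: space_restrict_space norm_sgn)
  have "(\<lambda>x::real^'m. sgn x) \<in> borel_measurable borel"
    unfolding sgn_div_norm by measurable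
  thus "sgn \<in> restrict_space lborel (cball 0 1 - {0}) \<rightarrow>\<^sub>M (borel :: (real^'m) measure)"
    by (auto intro: measurable_restrict_space1)
qed

lemma emeasure_surface:
  fixes A :: "(real^'m::finite) set"
  assumes "A \<in> sets surf"
  shows "emeasure surf A = of_nat CARD('m) * emeasure lborel (sgn -` A \<inter> (cball 0 1 - {0}))"
proof -
  have A: "A \<in> sets (restrict_space borel (sphere 0 1))" using assms sets_surface by blast
  show ?thesis
    unfolding surface_measure_def emeasure_scale_measure
    by (subst emeasure_distr[OF sgn_measurable_sphere A])
       (simp add: emeasure_restrict_space space_restrict_space Int_assoc)
qed

lemma finite_measure_surface: "finite_measure (surf :: (real^'m::finite) measure)"
proof
  have "emeasure surf (space surf :: (real^'m) set)
      = of_nat CARD('m) * emeasure lborel (sgn -` space (surf::(real^'m) measure) \<inter> (cball 0 1 - {0}))"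
    by (rule emeasure_surface) (rule sets.top)
  also have "\<dots> \<le> of_nat CARD('m) * emeasure lborel (cball (0::real^'m) 1)"
    by (intro mult_left_mono emeasure_mono) auto
  also have "\<dots> < \<infinity>"
    using emeasure_lborel_cball_finite[of "0::real^'m" 1] by (simp add: ennreal_mult_less_top of_nat_less_top)
  finally show "emeasure surf (space surf :: (real^'m) set) \<noteq> \<infinity>" by simp
qed

text \<open>
  The cone over a nonempty relatively open set contains a ball.
\<close>

lemma surface_open_pos:
  fixes U :: "(real^'m::finite) set"
  assumes U: "open U" "x \<in> U" "x \<in> sphere 0 1"
  shows "emeasure surf (U \<inter> sphere 0 1) > 0"
proof -
  define W where "W = (sgn -` U \<inter> (- {0})) \<inter> ball (0::real^'m) 1"
  have cont: "continuous_on (- {0}) (sgn :: real^'m \<Rightarrow> _)"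
    unfolding sgn_div_norm by (intro continuous_intros) auto
  have "open W"
  proof -
    have "open ((- {0}) \<inter> sgn -` U)"
      by (rule continuous_open_preimage[OF cont _ U(1)]) (rule open_Compl, simp)
    thus ?thesis unfolding W_def by (metis Int_commute open_Int open_ball)
  qed
  moreover have "(1/2) *\<^sub>R x \<in> W"
  proof -
    have "norm x = 1" using U(3) by simp
    hence "x \<noteq> 0" by auto
    thus ?thesis using U(2) \<open>norm x = 1\<close> by (simp add: W_def sgn_div_norm)
  qed
  ultimately obtain e where e: "e > 0" "ball ((1/2) *\<^sub>R x) e \<subseteq> W"
    by (meson openE)
  have WS: "W \<subseteq> sgn -` (U \<inter> sphere 0 1) \<inter> (cball 0 1 - {0})"
    unfolding W_def by (auto simp: norm_sgn)
  have Us: "U \<inter> sphere 0 1 \<in> sets surf"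
    unfolding sets_surface sets_restrict_space using U(1) by (metis Int_commute imageI borel_open)
  have ms: "sgn -` (U \<inter> sphere 0 1) \<inter> (cball 0 1 - {0}) \<in> sets lborel"
  proof -
    have "sgn -` (U \<inter> sphere 0 1) \<inter> space (restrict_space lborel (cball 0 1 - {0}))
        \<in> sets (restrict_space lborel (cball (0::real^'m) 1 - {0}))"
      using Us by (intro measurable_sets[OF sgn_measurable_sphere]) (simp add: sets_surface)
    thus ?thesis by (simp add: space_restrict_space sets_restrict_space_iff)
  qed
  have "0 < emeasure lborel (ball ((1/2) *\<^sub>R x) e)"
    using content_ball_pos[OF e(1), of "(1/2) *\<^sub>R x"]
    by (simp add: measure_def enn2real_positive_iff)
  also have "\<dots> \<le> emeasure lborel (sgn -` (U \<inter> sphere 0 1) \<inter> (cball 0 1 - {0}))"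
    using order.trans[OF e(2) WS] ms by (rule emeasure_mono)
  finally show ?thesis
    unfolding emeasure_surface[OF Us] by (simp add: ennreal_zero_less_mult_iff)
qed

lemma surface_measure_pos: "measure (surf :: (real^'m::finite) measure) (sphere 0 1) > 0"
proof -
  obtain x :: "real^'m" where "norm x = 1" using vector_choose_size[of 1] by auto
  hence "emeasure (surf :: (real^'m) measure) (UNIV \<inter> sphere 0 1) > 0"
    by (intro surface_open_pos[of _ x]) auto
  thus ?thesis
    using finite_measure.emeasure_eq_measure[OF finite_measure_surface, of "sphere 0 1 :: (real^'m) set"]
    by (simp add: zero_less_measure_iff)
qed

lemma orthogonal_measurable_surface:
  assumes T: "orthogonal_transformation (T :: real^'m::finite \<Rightarrow> real^'m)"
  shows "T \<in> measurable surf surf"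
proof -
  have "linear T" using T by (rule orthogonal_transformation_linear)
  hence "T \<in> borel_measurable borel"
    by (simp add: linear_continuous_on linear_conv_bounded_linear borel_measurable_continuous_onI)
  hence "T \<in> measurable (restrict_space borel (sphere 0 1)) (restrict_space borel (sphere 0 1))"
    using orthogonal_transformation_norm[OF T]
    by (intro measurable_restrict_space2 measurable_restrict_space1) (auto simp: space_restrict_space)
  thus ?thesis by (simp add: measurable_cong_sets[OF sets_surface sets_surface])
qed

text \<open>
  Orthogonal maps commute with \<^const>\<open>sgn\<close> and preserve the volume of cones.
\<close>

lemma distr_surface_orthogonal:
  assumes T: "orthogonal_transformation (T :: real^'m::finite \<Rightarrow> real^'m)"
  shows "distr surf surf T = surf"
proof (rule measure_eqI)
  fix A assume "A \<in> sets (distr surf surf T)"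
  hence A: "A \<in> sets surf" by simp
  note Tm = orthogonal_measurable_surface[OF T]
  have lin: "linear T" using T by (rule orthogonal_transformation_linear)
  have nT: "norm (T x) = norm x" for x using orthogonal_transformation_norm[OF T] .
  have sT: "sgn (T y) = T (sgn y)" for y
    by (simp add: sgn_div_norm nT linear_cmul[OF lin])
  have "emeasure (distr surf surf T) A = emeasure surf (T -` A \<inter> sphere 0 1)"
    using A by (simp add: emeasure_distr[OF Tm])
  also have "\<dots> = of_nat CARD('m) *
      emeasure lborel (sgn -` (T -` A \<inter> sphere 0 1) \<inter> (cball 0 1 - {0}))"
    using measurable_sets[OF Tm A] by (intro emeasure_surface) simp
  also have "sgn -` (T -` A \<inter> sphere 0 1) \<inter> (cball 0 1 - {0})
      = T -` (sgn -` A \<inter> (cball 0 1 - {0}))"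
  proof (rule set_eqI)
    fix y
    have "norm (T y) = 0 \<longleftrightarrow> norm y = 0" by (simp only: nT)
    hence "T y = 0 \<longleftrightarrow> y = 0" by (simp only: norm_eq_zero)
    thus "y \<in> sgn -` (T -` A \<inter> sphere 0 1) \<inter> (cball 0 1 - {0})
        \<longleftrightarrow> y \<in> T -` (sgn -` A \<inter> (cball 0 1 - {0}))"
      by (simp add: sT nT norm_sgn)
  qed
  also have "emeasure lborel \<dots> = emeasure lborel (sgn -` A \<inter> (cball 0 1 - {0}))"
  proof (rule lborel_orthogonal_transformation[OF T])
    have "sgn -` A \<inter> space (restrict_space lborel (cball 0 1 - {0}))
        \<in> sets (restrict_space lborel (cball (0::real^'m) 1 - {0}))"
      using A by (intro measurable_sets[OF sgn_measurable_sphere]) (simp add: sets_surface)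
    thus "sgn -` A \<inter> (cball 0 1 - {0}) \<in> sets borel"
      by (simp add: space_restrict_space sets_restrict_space_iff)
  qed
  finally show "emeasure (distr surf surf T) A = emeasure surf A"
    unfolding emeasure_surface[OF A] .
qed simp

lemma surface_integral_orthogonal:
  fixes h :: "real^'m::finite \<Rightarrow> 'b::{banach, second_countable_topology}"
  assumes T: "orthogonal_transformation (T :: real^'m \<Rightarrow> real^'m)" and h: "h \<in> borel_measurable surf"
  shows "(LINT x|surf. h (T x)) = (LINT x|surf. h x)"
  using integral_distr[OF orthogonal_measurable_surface[OF T] h]
  by (simp add: distr_surface_orthogonal[OF T])

lemma surface_integrable_orthogonal:
  fixes h :: "real^'m::finite \<Rightarrow> 'b::{banach, second_countable_topology}"
  assumes T: "orthogonal_transformation (T :: real^'m \<Rightarrow> real^'m)" and h: "integrable surf h"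
  shows "integrable surf (\<lambda>x. h (T x))"
  using integrable_distr_eq[OF orthogonal_measurable_surface[OF T], of h] h
  by (simp add: distr_surface_orthogonal[OF T])

lemma rot_add: "ix 1 \<noteq> ix 2 \<Longrightarrow> rot ix s (rot ix t x) = rot ix (s + t) x"
  by (auto simp: rot_def vec_eq_iff cos_add sin_add algebra_simps)

lemma rot_0 [simp]: "rot ix 0 x = x"
  by (auto simp: rot_def vec_eq_iff)

lemma rot_2pi [simp]: "rot ix (2 * pi) x = x"
  by (auto simp: rot_def vec_eq_iff)

lemma orthogonal_rot:
  fixes ix :: "nat \<Rightarrow> 'm::finite"
  assumes ne: "ix 1 \<noteq> ix 2"
  shows "orthogonal_transformation (rot ix t)"
  unfolding orthogonal_transformation_def
proof safe
  show "linear (rot ix t)"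
    by (rule linearI) (auto simp: rot_def vec_eq_iff algebra_simps)
  fix v w :: "real^'m"
  have split: "(\<Sum>i\<in>UNIV. F i) = F (ix 1) + F (ix 2) + (\<Sum>i\<in>UNIV - {ix 1, ix 2}. F i)"
    for F :: "'m \<Rightarrow> real"
    using ne sum.subset_diff[of "{ix 1, ix 2}" UNIV F] by (simp add: add.commute)
  have "(v $ ix 1 * cos t - v $ ix 2 * sin t) * (w $ ix 1 * cos t - w $ ix 2 * sin t) +
      (v $ ix 1 * sin t + v $ ix 2 * cos t) * (w $ ix 1 * sin t + w $ ix 2 * cos t)
    = (v $ ix 1 * w $ ix 1 + v $ ix 2 * w $ ix 2) * ((sin t)\<^sup>2 + (cos t)\<^sup>2)"
    unfolding power2_eq_square by (simp only: algebra_simps)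
  thus "rot ix t v \<bullet> rot ix t w = v \<bullet> w"
    unfolding inner_vec_def split using ne by (simp add: rot_def)
qed

lemma rot_sphere: "ix 1 \<noteq> ix 2 \<Longrightarrow> x \<in> sphere 0 1 \<Longrightarrow> rot ix t x \<in> sphere 0 1"
  using orthogonal_transformation_norm[OF orthogonal_rot, of ix t x] by (simp del: One_nat_def)

lemma rot_joint_measurable:
  fixes ix :: "nat \<Rightarrow> 'a::finite"
  assumes ne: "ix 1 \<noteq> ix 2"
  shows "(\<lambda>p. rot ix (fst p) (snd p)) \<in> measurable (lborel \<Otimes>\<^sub>M surf) surf"
proof -
  have "(\<lambda>p. rot ix (fst p) (snd p)) \<in> measurable (lborel \<Otimes>\<^sub>M surf) (restrict_space borel (sphere 0 1))"
  proof (rule measurable_restrict_space2)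
    show "(\<lambda>p. rot ix (fst p) (snd p)) \<in> space (lborel \<Otimes>\<^sub>M surf) \<rightarrow> sphere 0 1"
      using rot_sphere[OF ne] by (auto simp: space_pair_measure)
    have c: "continuous_on UNIV (\<lambda>p. rot ix (fst p) (snd p))"
      unfolding rot_def
    proof (rule continuous_on_vec_lambda)
      fix i
      show "continuous_on UNIV (\<lambda>p::real \<times> (real^'a). if i = ix 1 then snd p $ ix 1 * cos (fst p) - snd p $ ix 2 * sin (fst p)
          else if i = ix 2 then snd p $ ix 1 * sin (fst p) + snd p $ ix 2 * cos (fst p) else snd p $ i)"
      proof -
        have c: "continuous_on UNIV (\<lambda>p::real \<times> (real^'a). snd p $ j)" for j
          by (intro continuous_intros)
        have "continuous_on UNIV (\<lambda>p::real \<times> (real^'a). snd p $ ix 1 * cos (fst p) - snd p $ ix 2 * sin (fst p))"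
          "continuous_on UNIV (\<lambda>p::real \<times> (real^'a). snd p $ ix 1 * sin (fst p) + snd p $ ix 2 * cos (fst p))"
          by (intro continuous_intros)+
        thus ?thesis using c[of i] by (cases "i = ix 1"; cases "i = ix 2") (simp_all del: One_nat_def)
      qed
    qed
    have "(\<lambda>x. x) \<in> measurable surf borel"
      by (simp add: measurable_cong_sets[OF sets_surface refl] measurable_restrict_space1)
    hence "(\<lambda>p. (fst p, snd p)) \<in> measurable (lborel \<Otimes>\<^sub>M surf) (borel \<Otimes>\<^sub>M borel)"
      by measurable
    hence "(\<lambda>p. (fst p, snd p)) \<in> measurable (lborel \<Otimes>\<^sub>M surf) borel" by (simp add: borel_prod)
    from measurable_compose[OF this borel_measurable_continuous_onI[OF c]]
    show "(\<lambda>p. rot ix (fst p) (snd p)) \<in> measurable (lborel \<Otimes>\<^sub>M surf) borel" by simp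
  qed
  thus ?thesis by (simp add: measurable_cong_sets[OF refl sets_surface])
qed

text \<open>
  By invariance the integral of \<open>H'\<close> equals its average over the rotations by angles in
  \<open>[0, 2 \<pi>]\<close>. After exchanging the integrations, the inner integral runs once around a circle and
  vanishes by the fundamental theorem of calculus. For the Henstock-Kurzweil integral this theorem
  covers every derivative that exists everywhere; on almost every circle \<open>H'\<close> is also Lebesgue
  integrable by Fubini, and then both integrals agree.
\<close>

lemma surface_integral_rot_derivative:
  fixes H H' :: "real^'m::finite \<Rightarrow> complex"
  assumes ne: "ix 1 \<noteq> ix 2"
    and der: "\<And>x t. x \<in> sphere 0 1 \<Longrightarrow>
      ((\<lambda>t. H (rot ix t x)) has_vector_derivative H' (rot ix t x)) (at t)"
    and int: "integrable surf H'"
  shows "(LINT x|surf. H' x) = 0"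
proof -
  interpret S: finite_measure "surf :: (real^'m) measure" by (rule finite_measure_surface)
  interpret P: pair_sigma_finite lborel "surf :: (real^'m) measure" ..
  define I :: "real \<Rightarrow> real" where "I = indicator {0..2*pi}"
  define F where "F = (\<lambda>t x. I t *\<^sub>R H' (rot ix t x))"
  have [measurable]: "I \<in> borel_measurable lborel" by (simp add: I_def)
  have H'm: "H' \<in> borel_measurable surf" using int by auto
  have Fm: "case_prod F \<in> borel_measurable (lborel \<Otimes>\<^sub>M surf)"
  proof -
    have "(\<lambda>p. H' (rot ix (fst p) (snd p))) \<in> borel_measurable (lborel \<Otimes>\<^sub>M surf)"
      by (rule measurable_compose[OF rot_joint_measurable[OF ne] H'm])
    thus ?thesis unfolding F_def case_prod_beta by measurable
  qed
  have iI: "integrable lborel I" unfolding I_def by simp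
  have It: "(LINT t|lborel. I t) = 2 * pi" unfolding I_def by simp
  have it: "integrable surf (\<lambda>x. H' (rot ix t x))" for t
    by (rule surface_integrable_orthogonal[OF orthogonal_rot[OF ne] int])
  have Fi: "integrable (lborel \<Otimes>\<^sub>M surf) (case_prod F)"
  proof (rule P.Fubini_integrable[OF Fm])
    have "(LINT x|surf. norm (case_prod F (t, x))) = I t * (LINT x|surf. norm (H' x))" for t
      using surface_integral_orthogonal[OF orthogonal_rot[OF ne, of t], of "\<lambda>x. norm (H' x)"] H'm
      by (simp add: F_def I_def)
    thus "integrable lborel (\<lambda>t. LINT x|surf. norm (case_prod F (t, x)))"
      using iI by simp
    show "AE t in lborel. integrable surf (\<lambda>x. case_prod F (t, x))"
      using it by (auto simp: F_def)
  qed
  have "(LINT x|surf. LINT t|lborel. F t x) = (LINT t|lborel. LINT x|surf. F t x)"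
    by (rule P.Fubini_integral[OF Fi])
  also have "\<dots> = (LINT t|lborel. I t *\<^sub>R (LINT x|surf. H' x))"
    using surface_integral_orthogonal[OF orthogonal_rot[OF ne] H'm] by (simp add: F_def)
  also have "\<dots> = (2 * pi) *\<^sub>R (LINT x|surf. H' x)"
    using iI It by simp
  finally have eq: "(2 * pi) *\<^sub>R (LINT x|surf. H' x) = (LINT x|surf. LINT t|lborel. F t x)" ..
  have "AE x in surf. (LINT t|lborel. F t x) = 0"
    using P.AE_integrable_snd[OF Fi]
  proof (rule AE_mp, intro AE_I2 impI)
    fix x :: "real^'m" assume x: "x \<in> space surf" and i: "integrable lborel (\<lambda>t. F t x)"
    have "((\<lambda>t. H' (rot ix t x)) has_integral (H (rot ix (2*pi) x) - H (rot ix 0 x))) {0..2*pi}"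
      using x by (intro fundamental_theorem_of_calculus)
        (auto intro!: has_vector_derivative_at_within[OF der])
    hence h0: "((\<lambda>t. H' (rot ix t x)) has_integral 0) {0..2*pi}" by simp
    have "set_integrable lborel {0..2*pi} (\<lambda>t. H' (rot ix t x))"
      using i by (simp add: set_integrable_def F_def I_def)
    from set_borel_integral_eq_integral(2)[OF this]
    have "(LINT t|lborel. F t x) = integral {0..2*pi} (\<lambda>t. H' (rot ix t x))"
      by (simp add: set_lebesgue_integral_def F_def I_def)
    thus "(LINT t|lborel. F t x) = 0" using h0 by (simp add: integral_unique)
  qed
  hence "(LINT x|surf. LINT t|lborel. F t x) = 0"
    by (rule integral_eq_zero_AE)
  thus ?thesis using eq by simp
qed

lemma surface_continuous_measurable:
  fixes p :: "real^'m::finite \<Rightarrow> 'b::{second_countable_topology,topological_space}"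
  assumes "continuous_on UNIV p"
  shows "p \<in> borel_measurable surf"
  using borel_measurable_continuous_onI[OF assms]
  by (simp add: measurable_cong_sets[OF sets_surface refl] measurable_restrict_space1)

lemma surface_integrable_continuous_mult:
  fixes p h :: "real^'m::finite \<Rightarrow> complex"
  assumes p: "continuous_on UNIV p" and h: "integrable surf h"
  shows "integrable surf (\<lambda>x. p x * h x)"
proof -
  have "bounded (p ` sphere 0 1)"
    using p by (intro compact_imp_bounded compact_continuous_image) (auto intro: continuous_on_subset)
  then obtain B where "\<forall>y\<in>p ` sphere 0 1. norm y \<le> B" by (auto simp only: bounded_iff)
  hence B: "norm (p x) \<le> B" if "x \<in> sphere 0 1" for x using that by blast
  have [measurable]: "p \<in> borel_measurable surf" by (rule surface_continuous_measurable[OF p])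
  have [measurable]: "h \<in> borel_measurable surf" using h by auto
  show ?thesis
  proof (rule Bochner_Integration.integrable_bound)
    show "integrable surf (\<lambda>x. B * norm (h x))" using h by simp
    show "AE x in surf. norm (p x * h x) \<le> norm (B * norm (h x))"
    proof (rule AE_I2)
      fix x :: "real^'m" assume x: "x \<in> space surf"
      have "norm (p x * h x) \<le> B * norm (h x)"
        using B[of x] x by (simp add: norm_mult mult_right_mono)
      thus "norm (p x * h x) \<le> norm (B * norm (h x))" by (simp add: abs_if)
    qed
  qed measurable
qed

lemma surface_integrable_continuous:
  fixes p :: "real^'m::finite \<Rightarrow> complex"
  assumes p: "continuous_on UNIV p"
  shows "integrable surf p"
proof -
  interpret S: finite_measure "surf :: (real^'m) measure" by (rule finite_measure_surface)
  show ?thesis using surface_integrable_continuous_mult[OF p, of "\<lambda>_. 1"] by simp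
qed

section \<open>Ladder functions\<close>

text \<open>
  The constants of the recursion \<open>y Q\<^sub>k = u\<^sub>k Q\<^sub>k\<^sub>+\<^sub>1 + v\<^sub>k b Q\<^sub>k\<^sub>-\<^sub>1\<close> for the Gegenbauer polynomials of
  parameter \<open>\<lambda> - 1/2\<close> scaled to the value \<open>1\<close> at \<open>1\<close>. This scaling makes sense for \<open>\<lambda> = 1/2\<close> too,
  where it gives the Chebyshev polynomials; the quotient for \<open>u\<^sub>0\<close> is \<open>0/0\<close> then, and \<open>1\<close> is its
  value for all other \<open>\<lambda>\<close>.
\<close>

definition harm_u :: "real \<Rightarrow> nat \<Rightarrow> real" where
  "harm_u lam k = (if k = 0 then 1 else (real k + 2 * lam - 1) / (2 * real k + 2 * lam - 1))"

definition harm_v :: "real \<Rightarrow> nat \<Rightarrow> real" where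
  "harm_v lam k = real k / (2 * real k + 2 * lam - 1)"

text \<open>
  With \<open>y = s cos \<theta>\<close> and \<open>b = s\<^sup>2\<close> this is \<open>s\<^sup>k\<close> times the scaled Gegenbauer polynomial at \<open>cos \<theta>\<close>.
  Written as a polynomial in \<open>y\<close> and \<open>b\<close> it needs no angles and no division by \<open>s\<close>.
\<close>

fun harm_Q :: "real \<Rightarrow> nat \<Rightarrow> real \<Rightarrow> real \<Rightarrow> real" where
  "harm_Q lam 0 y b = 1"
| "harm_Q lam (Suc 0) y b = y"
| "harm_Q lam (Suc (Suc k)) y b =
     (y * harm_Q lam (Suc k) y b - harm_v lam (Suc k) * b * harm_Q lam k y b) / harm_u lam (Suc k)"

text \<open>
  The partial derivative with respect to \<open>y\<close>, defined by recursion so that its continuity follows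
  like that of \<^const>\<open>harm_Q\<close>.
\<close>

fun harm_Q' :: "real \<Rightarrow> nat \<Rightarrow> real \<Rightarrow> real \<Rightarrow> real" where
  "harm_Q' lam 0 y b = 0"
| "harm_Q' lam (Suc 0) y b = 1"
| "harm_Q' lam (Suc (Suc k)) y b =
     (harm_Q lam (Suc k) y b + y * harm_Q' lam (Suc k) y b
       - harm_v lam (Suc k) * b * harm_Q' lam k y b) / harm_u lam (Suc k)"

definition harm_Z :: "real \<Rightarrow> nat \<Rightarrow> nat \<Rightarrow> real \<Rightarrow> real \<Rightarrow> real" where
  "harm_Z lam l k x y =
     (if k \<le> l then gegenbauer (lam + real k) (l - k) x * harm_Q lam k y (1 - x\<^sup>2) else 0)"

text \<open>
  In these terms the ladder relation reads \<open>D Z\<^sub>l\<^sup>k = ladder_down l k Z\<^sub>l\<^sup>k\<^sup>-\<^sup>1 - ladder_up k Z\<^sub>l\<^sup>k\<^sup>+\<^sup>1\<close>;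
  only the downward constant depends on \<open>l\<close>.
\<close>

definition ladder_up :: "real \<Rightarrow> nat \<Rightarrow> real" where
  "ladder_up lam k = 2 * (lam + real k) * harm_u lam k"

definition ladder_down :: "real \<Rightarrow> nat \<Rightarrow> nat \<Rightarrow> real" where
  "ladder_down lam l k = harm_v lam k * ((real l - real k + 1) * (real l + real k + 2 * lam - 1)) /
     (2 * (lam + real k - 1))"

lemma harm_v_0 [simp]: "harm_v lam 0 = 0" by (simp add: harm_v_def)

lemma continuous_gegenbauer [continuous_intros]:
  "continuous_on S f \<Longrightarrow> continuous_on S (\<lambda>x. gegenbauer \<mu> m (f x))"
proof -
  assume f: "continuous_on S f"
  have "continuous_on UNIV (gegenbauer \<mu> m)"
    using gegenbauer_deriv by (intro DERIV_continuous_on) (auto intro: has_field_derivative_at_within)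
  thus ?thesis by (rule continuous_on_compose2[OF _ f]) simp
qed

context
  fixes lam :: real
  assumes lam: "lam \<ge> 1/2"
begin

lemma harm_u_pos: "harm_u lam k > 0"
  using lam by (auto simp: harm_u_def)

lemma harm_u_le_1: "harm_u lam k \<le> 1"
  using lam by (auto simp: harm_u_def)

lemma harm_v_pos: "k > 0 \<Longrightarrow> harm_v lam k > 0"
  using lam by (auto simp: harm_v_def)

lemma harm_v_le_1: "harm_v lam k \<le> 1"
  using lam by (cases "k = 0") (auto simp: harm_v_def divide_le_eq_1)

lemma harm_v_mult: "harm_v lam k * (2 * (lam + real k) - 1) = real k"
proof (cases "k = 0")
  case False
  hence "2 * real k + 2 * lam - 1 \<noteq> 0" using lam by auto
  thus ?thesis by (simp add: harm_v_def field_simps)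
qed simp

text \<open>
  This identity and the next one are what the induction steps of \<open>harm_Q_first_order\<close> and
  \<open>harm_Q_rotate_deriv\<close> come down to when coefficients are compared.
\<close>

lemma harm_uv_shift1: "1 + (real (Suc k) - 2 * harm_v lam (Suc k)) * harm_u lam k
    = harm_u lam (Suc k) * real (Suc (Suc k))"
proof (cases "k = 0")
  case True
  have "2 * lam + 1 > 0" using lam by simp
  thus ?thesis by (simp add: True harm_u_def harm_v_def field_simps)
next
  case False
  hence "2 * real k + 2 * lam - 1 \<noteq> 0" "2 * real k + 2 * lam + 1 \<noteq> 0" using lam by auto
  thus ?thesis using False by (simp add: harm_u_def harm_v_def divide_simps) algebra
qed

lemma harm_uv_shift2: "(real (Suc k) - 2 * harm_v lam (Suc k)) * harm_v lam k
    = harm_v lam (Suc k) * real k"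
proof (cases "k = 0")
  case False
  hence "2 * real k + 2 * lam - 1 \<noteq> 0" "2 * real k + 2 * lam + 1 \<noteq> 0" using lam by auto
  thus ?thesis by (simp add: harm_v_def divide_simps) (simp add: algebra_simps)
qed simp

lemma harm_Q_mult:
  "y * harm_Q lam k y b = harm_u lam k * harm_Q lam (Suc k) y b + harm_v lam k * b * harm_Q lam (k - 1) y b"
proof (cases k)
  case 0
  thus ?thesis by (simp add: harm_u_def)
next
  case (Suc j)
  thus ?thesis using harm_u_pos[of k] by simp
qed

lemma harm_Q'_mult:
  "harm_Q lam k y b + y * harm_Q' lam k y b
     = harm_u lam k * harm_Q' lam (Suc k) y b + harm_v lam k * b * harm_Q' lam (k - 1) y b"
proof (cases k)
  case 0
  thus ?thesis by (simp add: harm_u_def)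
next
  case (Suc j)
  thus ?thesis using harm_u_pos[of k] by simp
qed

text \<open>
  The analogue of \<open>(1 - c\<^sup>2) P\<^sub>k' = k P\<^sub>k\<^sub>-\<^sub>1 - k c P\<^sub>k\<close>. It removes the partial derivative after
  integration by parts in the \<open>x\<^sub>2x\<^sub>3\<close>-plane.
\<close>

lemma harm_Q_first_order:
  "(b - y\<^sup>2) * harm_Q' lam k y b = real k * b * harm_Q lam (k - 1) y b - real k * y * harm_Q lam k y b"
proof (induction k rule: less_induct)
  case (less k)
  consider "k = 0" | "k = 1" | k' where "k = Suc (Suc k')" by (metis One_nat_def not0_implies_Suc)
  thus ?case
  proof cases
    case 2 then show ?thesis by (simp add: power2_eq_square)
  next
    case 3
    let ?k = "Suc k'"
    let ?Q = "\<lambda>k. harm_Q lam k y b" and ?R = "\<lambda>k. harm_Q' lam k y b"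
    let ?u = "harm_u lam" and ?v = "harm_v lam"
    have m: "?u ?k * ?Q (Suc ?k) = y * ?Q ?k - ?v ?k * b * ?Q k'"
      using harm_Q_mult[of y ?k b] by simp
    have m0: "y * ?Q k' = ?u k' * ?Q ?k + ?v k' * b * ?Q (k' - 1)"
      by (rule harm_Q_mult)
    have "?u ?k * ((b - y\<^sup>2) * ?R (Suc ?k)) = (b - y\<^sup>2) * (?Q ?k + y * ?R ?k - ?v ?k * b * ?R k')"
      using harm_Q'_mult[of ?k y b] harm_u_pos[of ?k] by (simp del: harm_Q'.simps)
    also have "\<dots> = (b - y\<^sup>2) * ?Q ?k + y * ((b - y\<^sup>2) * ?R ?k) - ?v ?k * b * ((b - y\<^sup>2) * ?R k')"
      by (simp add: algebra_simps)
    also have "\<dots> = (b - y\<^sup>2) * ?Q ?k + y * (real ?k * b * ?Q k' - real ?k * y * ?Q ?k)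
        - ?v ?k * b * (real k' * b * ?Q (k' - 1) - real k' * y * ?Q k')"
      using less[of ?k] less[of k'] 3 by simp
    also have "\<dots> = b * ?Q ?k + (real ?k - 2 * ?v ?k) * b * (y * ?Q k')
        - ?v ?k * real k' * b * b * ?Q (k' - 1)
        - real (Suc ?k) * y * (y * ?Q ?k - ?v ?k * b * ?Q k')"
      by (simp add: algebra_simps power2_eq_square)
    also have "\<dots> = b * ?Q ?k * (1 + (real ?k - 2 * ?v ?k) * ?u k')
        + ((real ?k - 2 * ?v ?k) * ?v k' - ?v ?k * real k') * b * b * ?Q (k' - 1)
        - real (Suc ?k) * y * (?u ?k * ?Q (Suc ?k))"
      unfolding m0 m by (simp add: algebra_simps)
    also have "\<dots> = ?u ?k * (real (Suc ?k) * b * ?Q ?k - real (Suc ?k) * y * ?Q (Suc ?k))"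
      unfolding harm_uv_shift1 harm_uv_shift2 by (simp add: algebra_simps)
    finally show ?thesis using harm_u_pos[of ?k] 3 by simp
  qed simp
qed

lemma harm_Q_partial: "((\<lambda>y. harm_Q lam k y b) has_real_derivative harm_Q' lam k y b) (at y)"
proof (induction k rule: less_induct)
  case (less k)
  show ?case
  proof (cases k)
    case (Suc j)
    show ?thesis
    proof (cases j)
      case (Suc i)
      have "((\<lambda>y. harm_Q lam (Suc i) y b) has_real_derivative harm_Q' lam (Suc i) y b) (at y)"
        "((\<lambda>y. harm_Q lam i y b) has_real_derivative harm_Q' lam i y b) (at y)"
        using less \<open>k = Suc j\<close> Suc by auto
      thus ?thesis unfolding \<open>k = Suc j\<close> Suc harm_Q.simps harm_Q'.simps
        using harm_u_pos[of "Suc i"] by (auto intro!: derivative_eq_intros)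
    qed (simp add: Suc)
  qed simp
qed

text \<open>
  Along the sphere \<open>b = 1 - x\<^sub>1\<^sup>2\<close> changes together with \<open>y = x\<^sub>2\<close>. As a polynomial in \<open>x\<^sub>2, \<dots>, x\<^sub>n\<^sub>+\<^sub>1\<close>
  the function \<open>Q\<^sub>k\<close> has \<open>k Q\<^sub>k\<^sub>-\<^sub>1\<close> as its derivative in \<open>x\<^sub>2\<close>.
\<close>

lemma harm_Q_rotate_deriv:
  assumes X: "(X has_real_derivative - W t) (at t)" and W: "(W has_real_derivative X t) (at t)"
  shows "((\<lambda>t. harm_Q lam k (W t) (1 - (X t)\<^sup>2)) has_real_derivative
           real k * X t * harm_Q lam (k - 1) (W t) (1 - (X t)\<^sup>2)) (at t)"
proof (induction k rule: less_induct)
  case (less k)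
  show ?case
  proof (cases k)
    case (Suc j)
    show ?thesis
    proof (cases j)
      case 0
      thus ?thesis using W by (simp add: Suc)
    next
      case (Suc i)
      let ?b = "1 - (X t)\<^sup>2"
      let ?Q = "\<lambda>k. harm_Q lam k (W t) ?b"
      let ?u = "harm_u lam" and ?v = "harm_v lam"
      have 1: "((\<lambda>t. harm_Q lam (Suc i) (W t) (1 - (X t)\<^sup>2)) has_real_derivative
           real (Suc i) * X t * ?Q i) (at t)"
        using less[of "Suc i"] \<open>k = Suc j\<close> Suc by simp
      have 2: "((\<lambda>t. harm_Q lam i (W t) (1 - (X t)\<^sup>2)) has_real_derivative
           real i * X t * ?Q (i - 1)) (at t)"
        using less[of i] \<open>k = Suc j\<close> Suc by simp
      have 3: "((\<lambda>t. 1 - (X t)\<^sup>2) has_real_derivative 2 * X t * W t) (at t)"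
        using X by (auto intro!: derivative_eq_intros)
      have m0: "W t * ?Q i = ?u i * ?Q (Suc i) + ?v i * ?b * ?Q (i - 1)"
        by (rule harm_Q_mult)
      have "((\<lambda>t. harm_Q lam k (W t) (1 - (X t)\<^sup>2)) has_real_derivative
          ((W t * (real (Suc i) * X t * ?Q i) + X t * ?Q (Suc i))
           - ?v (Suc i) * (?b * (real i * X t * ?Q (i - 1)) + 2 * X t * W t * ?Q i)) / ?u (Suc i)) (at t)"
        unfolding \<open>k = Suc j\<close> Suc harm_Q.simps mult.assoc[of "harm_v lam (Suc i)"]
        by (intro DERIV_cdivide DERIV_diff DERIV_cmult)
           (auto intro!: derivative_eq_intros 1 2 X W simp: algebra_simps)
      also have "((W t * (real (Suc i) * X t * ?Q i) + X t * ?Q (Suc i))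
           - ?v (Suc i) * (?b * (real i * X t * ?Q (i - 1)) + 2 * X t * W t * ?Q i))
         = X t * (?Q (Suc i) + (real (Suc i) - 2 * ?v (Suc i)) * (W t * ?Q i)
            - ?v (Suc i) * real i * ?b * ?Q (i - 1))"
        by (simp add: algebra_simps)
      also have "\<dots> = X t * (?Q (Suc i) * (1 + (real (Suc i) - 2 * ?v (Suc i)) * ?u i)
          + ((real (Suc i) - 2 * ?v (Suc i)) * ?v i - ?v (Suc i) * real i) * ?b * ?Q (i - 1))"
        unfolding m0 by (simp add: algebra_simps)
      also have "\<dots> = ?u (Suc i) * (real k * X t * ?Q (Suc i))"
        unfolding harm_uv_shift1 harm_uv_shift2 \<open>k = Suc j\<close> Suc by (simp add: algebra_simps)
      finally show ?thesis using harm_u_pos[of "Suc i"] \<open>k = Suc j\<close> Suc by simp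
    qed
  qed simp
qed

text \<open>
  In the product rule, \<open>harm_Q_mult\<close> splits \<open>y Q\<^sub>k\<close>. The terms with \<open>Q\<^sub>k\<^sub>+\<^sub>1\<close> contain the derivative
  of the Gegenbauer polynomial, those with \<open>Q\<^sub>k\<^sub>-\<^sub>1\<close> the combination in \<open>gegenbauer_lower\<close>.
\<close>

lemma harm_Z_rotate_deriv:
  assumes X: "(X has_real_derivative - W t) (at t)" and W: "(W has_real_derivative X t) (at t)"
  shows "((\<lambda>t. harm_Z lam l k (X t) (W t)) has_real_derivative
     ladder_down lam l k * harm_Z lam l (k - 1) (X t) (W t) - ladder_up lam k * harm_Z lam l (Suc k) (X t) (W t)) (at t)"
proof (cases "k \<le> l")
  case False
  thus ?thesis
    by (cases "k = Suc l") (auto simp: harm_Z_def[abs_def] ladder_down_def)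
next
  case True
  define m where "m = l - k"
  define \<mu> where "\<mu> = lam + real k"
  let ?b = "1 - (X t)\<^sup>2"
  let ?Q = "\<lambda>k. harm_Q lam k (W t) ?b"
  let ?p = "gegenbauer \<mu> m (X t)" and ?P = "gegenbauer_prev (\<mu> + 1) m (X t)"
  let ?u = "harm_u lam k" and ?v = "harm_v lam k"
  have kl: "real l = real m + real k" using True by (simp add: m_def)
  have "((\<lambda>t. gegenbauer \<mu> m (X t)) has_real_derivative 2 * \<mu> * ?P * (- W t)) (at t)"
    by (rule DERIV_chain2[OF gegenbauer_deriv X])
  from DERIV_mult[OF this harm_Q_rotate_deriv[OF X W, of k]]
  have "((\<lambda>t. harm_Z lam l k (X t) (W t)) has_real_derivative
      2 * \<mu> * ?P * (- W t) * ?Q k + real k * X t * ?Q (k - 1) * ?p) (at t)"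
    using True by (simp add: harm_Z_def[abs_def] \<mu>_def m_def)
  also have "2 * \<mu> * ?P * (- W t) * ?Q k = - (2 * \<mu> * ?P) * (W t * ?Q k)" by simp
  also have "\<dots> = - (2 * \<mu> * ?P) * (?u * ?Q (Suc k) + ?v * ?b * ?Q (k - 1))"
    by (simp only: harm_Q_mult)
  also have "\<dots> + real k * X t * ?Q (k - 1) * ?p = - (2 * \<mu> * ?u) * (?P * ?Q (Suc k))
      - ?Q (k - 1) * ?v * (2 * \<mu> * ?b * ?P - (2 * \<mu> - 1) * X t * ?p)"
    by (subst harm_v_mult[of k, symmetric]) (simp add: \<mu>_def algebra_simps)
  also have "?P * ?Q (Suc k) = harm_Z lam l (Suc k) (X t) (W t)"
  proof (cases m)
    case 0
    thus ?thesis using True by (simp add: harm_Z_def m_def)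
  next
    case (Suc j)
    hence "Suc k \<le> l" "l - Suc k = j" using m_def by auto
    thus ?thesis by (simp add: Suc harm_Z_def \<mu>_def add.commute add.left_commute)
  qed
  also have "?Q (k - 1) * ?v * (2 * \<mu> * ?b * ?P - (2 * \<mu> - 1) * X t * ?p)
      = - ladder_down lam l k * harm_Z lam l (k - 1) (X t) (W t)"
  proof (cases k)
    case (Suc j)
    have "\<mu> \<noteq> 1" using lam by (simp add: \<mu>_def Suc)
    note low = gegenbauer_lower[OF this, of "X t" m]
    have j: "j \<le> l" "l - j = Suc m" using True Suc m_def by auto
    have "harm_Z lam l (k - 1) (X t) (W t) = gegenbauer (\<mu> - 1) (Suc m) (X t) * ?Q (k - 1)"
      using j by (simp add: harm_Z_def Suc \<mu>_def)
    moreover have "q * v * (- a * c / d * g) = - (v * (a * c) / d) * (g * q)" for q v a c d g :: real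
      by simp
    moreover have "real l - real k + 1 = real m + 1"
      "real l + real k + 2 * lam - 1 = real m + 2 * \<mu> - 1" "lam + real k - 1 = \<mu> - 1"
      by (simp_all add: kl \<mu>_def)
    ultimately show ?thesis unfolding low ladder_down_def by (simp only:)
  qed (simp add: ladder_down_def)
  finally show ?thesis by (simp add: ladder_up_def \<mu>_def)
qed

lemma ladder_up_pos: "ladder_up lam k > 0"
  using harm_u_pos[of k] lam by (simp add: ladder_up_def)

lemma ladder_down_Suc:
  "ladder_down lam l (Suc k) =
     harm_v lam (Suc k) * ((real l - real k) * (real l + real k + 2 * lam)) / (2 * (lam + real k))"
  by (simp add: ladder_down_def)

lemma ladder_down_strict:
  assumes "k \<le> l" "l < l'"
  shows "ladder_down lam l (Suc k) < ladder_down lam l' (Suc k)"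
proof -
  have "(real l - real k) * (real l + real k + 2 * lam) < (real l' - real k) * (real l' + real k + 2 * lam)"
    using assms lam by (intro mult_strict_mono') auto
  thus ?thesis unfolding ladder_down_Suc
    using harm_v_pos[of "Suc k"] lam by (intro divide_strict_right_mono mult_strict_left_mono) auto
qed

lemma ladder_down_pos: "k < l \<Longrightarrow> ladder_down lam l (Suc k) > 0"
  using lam harm_v_pos[of "Suc k"] by (simp add: ladder_down_Suc)

lemma continuous_harm_Q [continuous_intros]:
  assumes "continuous_on S f" "continuous_on S g"
  shows "continuous_on S (\<lambda>x. harm_Q lam k (f x) (g x))"
proof (induction k rule: less_induct)
  case (less k)
  show ?case
  proof (cases k)
    case (Suc j)
    show ?thesis
    proof (cases j)
      case (Suc i)
      thus ?thesis using less[of i] less[of "Suc i"] \<open>k = Suc j\<close> assms harm_u_pos[of "Suc i"]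
        by (auto intro!: continuous_intros)
    qed (simp add: Suc assms)
  qed simp
qed

lemma continuous_harm_Q' [continuous_intros]:
  assumes "continuous_on S f" "continuous_on S g"
  shows "continuous_on S (\<lambda>x. harm_Q' lam k (f x) (g x))"
proof (induction k rule: less_induct)
  case (less k)
  show ?case
  proof (cases k)
    case (Suc j)
    show ?thesis
    proof (cases j)
      case (Suc i)
      thus ?thesis using less[of i] less[of "Suc i"] \<open>k = Suc j\<close> assms harm_u_pos[of "Suc i"]
        by (auto intro!: continuous_intros)
    qed (simp add: Suc assms)
  qed simp
qed

lemma continuous_harm_Z [continuous_intros]:
  assumes "continuous_on S f" "continuous_on S g"
  shows "continuous_on S (\<lambda>x. harm_Z lam l k (f x) (g x))"
  unfolding harm_Z_def using assms by (cases "k \<le> l") (auto intro!: continuous_intros)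

end

section \<open>Orthogonality on the sphere\<close>

text \<open>
  Keeps the index \<open>ix 1\<close> in the form in which it enters the definition of a rotation.
\<close>

declare One_nat_def [simp del]

lemma rot_coord_deriv:
  assumes "ix 1 \<noteq> ix 2"
  shows "((\<lambda>t. rot ix t x $ ix 1) has_real_derivative - (rot ix t x $ ix 2)) (at t)"
    and "((\<lambda>t. rot ix t x $ ix 2) has_real_derivative rot ix t x $ ix 1) (at t)"
  using assms by (auto simp: rot_def intro!: derivative_eq_intros)

lemma rot_coord_other: "i \<noteq> ix 1 \<Longrightarrow> i \<noteq> ix 2 \<Longrightarrow> rot ix t x $ i = x $ i"
  by (auto simp: rot_def)

locale sphere_coords =
  fixes n :: nat and ix :: "nat \<Rightarrow> 'm::finite"
  assumes n2: "n \<ge> 2" and bij: "bij_betw ix {1..n+1} (UNIV :: 'm set)"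
begin

definition lam :: real where "lam = (real n - 1) / 2"

lemma lam_ge: "lam \<ge> 1/2"
  using n2 by (simp add: lam_def)

lemma ix_eq_iff: "i \<in> {1..n+1} \<Longrightarrow> j \<in> {1..n+1} \<Longrightarrow> ix i = ix j \<longleftrightarrow> i = j"
  using bij by (meson bij_betw_imp_inj_on inj_on_eq_iff)

lemma ix12: "ix 1 \<noteq> ix 2" and ix13: "ix 1 \<noteq> ix 3" and ix23: "ix 2 \<noteq> ix 3"
  using n2 by (subst ix_eq_iff; simp)+

abbreviation x1 :: "real^'m \<Rightarrow> real" where "x1 x \<equiv> x $ ix 1"
abbreviation x2 :: "real^'m \<Rightarrow> real" where "x2 x \<equiv> x $ ix 2"
abbreviation x3 :: "real^'m \<Rightarrow> real" where "x3 x \<equiv> x $ ix 3"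

lemma sphere_sum:
  assumes "x \<in> sphere 0 1"
  shows "(\<Sum>j=3..n+1. (x $ ix j)\<^sup>2) = 1 - (x1 x)\<^sup>2 - (x2 x)\<^sup>2"
proof -
  have "{1..n+1} = insert 1 (insert 2 {3..n+1})" using n2 by auto
  hence "(\<Sum>j=1..n+1. (x $ ix j)\<^sup>2) = (x1 x)\<^sup>2 + ((x2 x)\<^sup>2 + (\<Sum>j=3..n+1. (x $ ix j)\<^sup>2))"
    by (simp only:) simp
  thus ?thesis using sum_coords[OF bij, of x] assms by simp
qed

lemma sphere_le_1: "x \<in> sphere 0 1 \<Longrightarrow> (x1 x)\<^sup>2 + (x2 x)\<^sup>2 \<le> 1"
  using sphere_sum[of x] sum_nonneg[of "{3..n+1}" "\<lambda>j. (x $ ix j)\<^sup>2"] by simp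

lemma abs_x1_le: "x \<in> sphere 0 1 \<Longrightarrow> \<bar>x1 x\<bar> \<le> 1"
  using sphere_le_1[of x] zero_le_power2[of "x2 x"] by (subst abs_square_le_1[symmetric]) linarith

text \<open>
  For \<open>j \<ge> 3\<close> a quarter turn in the plane of \<open>x\<^sub>3\<close> and \<open>x\<^sub>j\<close> exchanges \<open>x\<^sub>3\<^sup>2\<close> and \<open>x\<^sub>j\<^sup>2\<close> and fixes
  \<open>x\<^sub>1\<close> and \<open>x\<^sub>2\<close>, and these \<open>n - 1\<close> squares add up to \<open>1 - x\<^sub>1\<^sup>2 - x\<^sub>2\<^sup>2\<close>.
\<close>

lemma surface_integral_x3_sq:
  fixes V :: "real \<Rightarrow> real \<Rightarrow> complex"
  assumes V: "integrable surf (\<lambda>x. V (x1 x) (x2 x))"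
  shows "of_nat (n - 1) * (LINT x|surf. of_real ((x3 x)\<^sup>2) * V (x1 x) (x2 x))
       = (LINT x|surf. of_real (1 - (x1 x)\<^sup>2 - (x2 x)\<^sup>2) * V (x1 x) (x2 x))"
proof -
  have eq: "(LINT x|surf. of_real ((x $ ix j)\<^sup>2) * V (x1 x) (x2 x))
      = (LINT x|surf. of_real ((x3 x)\<^sup>2) * V (x1 x) (x2 x))" if j: "j \<in> {3..n+1}" for j
  proof (cases "j = 3")
    case False
    \<comment> \<open>With this numbering \<^const>\<open>rot\<close> turns the plane of \<open>x\<^sub>3\<close> and \<open>x\<^sub>j\<close>.\<close>
    define iy where "iy = (\<lambda>i::nat. if i = 1 then ix 3 else ix j)"
    have ne: "iy 1 \<noteq> iy 2" using j False n2 by (simp add: iy_def ix_eq_iff)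
    have other: "ix 1 \<noteq> iy 1" "ix 2 \<noteq> iy 1" "ix 1 \<noteq> iy 2" "ix 2 \<noteq> iy 2"
      using j n2 by (simp_all add: iy_def ix_eq_iff)
    have m: "(\<lambda>x. of_real ((x3 x)\<^sup>2) * V (x1 x) (x2 x)) \<in> borel_measurable surf"
      using borel_measurable_integrable[OF V]
      by (rule borel_measurable_times[rotated])
         (intro surface_continuous_measurable continuous_intros)
    have c: "rot iy (pi/2) x $ ix 1 = x1 x" "rot iy (pi/2) x $ ix 2 = x2 x" for x
      using other by (simp_all add: rot_coord_other)
    have c3: "rot iy (pi/2) x $ ix 3 = - (x $ ix j)" for x
      by (simp add: rot_def iy_def)
    show ?thesis
      using surface_integral_orthogonal[OF orthogonal_rot[where ix=iy and t="pi/2", OF ne] m]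
      by (simp add: c c3)
  qed simp
  have int: "integrable surf (\<lambda>x. of_real ((x $ ix j)\<^sup>2) * V (x1 x) (x2 x))" for j
    by (intro surface_integrable_continuous_mult continuous_intros V)
  have "(LINT x|surf. of_real (1 - (x1 x)\<^sup>2 - (x2 x)\<^sup>2) * V (x1 x) (x2 x))
      = (LINT x|surf. (\<Sum>j=3..n+1. of_real ((x $ ix j)\<^sup>2) * V (x1 x) (x2 x)))"
    by (intro Bochner_Integration.integral_cong refl)
       (simp add: sphere_sum[symmetric] sum_distrib_right)
  also have "\<dots> = (\<Sum>j=3..n+1. LINT x|surf. of_real ((x $ ix j)\<^sup>2) * V (x1 x) (x2 x))"
    using int by (intro Bochner_Integration.integral_sum)
  also have "\<dots> = (\<Sum>j=3..n+1. LINT x|surf. of_real ((x3 x)\<^sup>2) * V (x1 x) (x2 x))"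
    by (intro sum.cong refl eq)
  also have "\<dots> = of_nat (n - 1) * (LINT x|surf. of_real ((x3 x)\<^sup>2) * V (x1 x) (x2 x))"
    by (simp, simp only: One_nat_def simp_thms)
  finally show ?thesis ..
qed

abbreviation Q :: "nat \<Rightarrow> real^'m \<Rightarrow> real" where
  "Q k x \<equiv> harm_Q lam k (x2 x) (1 - (x1 x)\<^sup>2)"
abbreviation Q' :: "nat \<Rightarrow> real^'m \<Rightarrow> real" where
  "Q' k x \<equiv> harm_Q' lam k (x2 x) (1 - (x1 x)\<^sup>2)"

lemmas cont_intros = continuous_intros continuous_harm_Q[OF lam_ge] continuous_harm_Q'[OF lam_ge]
  continuous_harm_Z[OF lam_ge] continuous_gegenbauer

text \<open>
  The weight \<open>g\<close> is arbitrary because the orthogonality of the \<open>Q\<^sub>k\<close> is used both for Gegenbauer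
  polynomials in \<open>x\<^sub>1\<close> and for the given zonal function.
\<close>

definition QQ :: "nat \<Rightarrow> nat \<Rightarrow> (real \<Rightarrow> complex) \<Rightarrow> complex" where
  "QQ k j g = (LINT x|surf. of_real (Q k x * Q j x) * g (x1 x))"

lemma integrable_weight:
  "integrable surf (\<lambda>x. g (x1 x)) \<Longrightarrow> integrable surf (\<lambda>x. of_real (1 - (x1 x)\<^sup>2) * g (x1 x) :: complex)"
  by (intro surface_integrable_continuous_mult continuous_intros)

text \<open>
  Integration by parts in the \<open>x\<^sub>2x\<^sub>3\<close>-plane, applied to \<open>x\<^sub>3 Q\<^sub>k Q\<^sub>j g(x\<^sub>1)\<close>: the factor \<open>x\<^sub>3\<close> turns the
  derivative into \<open>x\<^sub>2 Q\<^sub>k Q\<^sub>j - x\<^sub>3\<^sup>2 (Q\<^sub>k Q\<^sub>j)'\<close>, where \<open>x\<^sub>3\<^sup>2\<close> can be replaced by its average, so that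
  only functions of \<open>x\<^sub>1\<close> and \<open>x\<^sub>2\<close> remain.
\<close>

lemma QQ_parts:
  assumes g: "integrable surf (\<lambda>x. g (x1 x))"
  shows "(2 * of_real lam + of_nat k + of_nat j) * (LINT x|surf. of_real (x2 x * Q k x * Q j x) * g (x1 x))
     = of_nat k * QQ (k - 1) j (\<lambda>s. of_real (1 - s\<^sup>2) * g s)
       + of_nat j * QQ k (j - 1) (\<lambda>s. of_real (1 - s\<^sup>2) * g s)"
proof -
  \<comment> \<open>Shifting the numbering of the coordinates turns the rotation of \<open>x\<^sub>1, x\<^sub>2\<close> into that of \<open>x\<^sub>2, x\<^sub>3\<close>.\<close>
  define iy where "iy = (\<lambda>i. ix (Suc i))"
  have iy: "iy 1 = ix 2" "iy 2 = ix 3" by (simp_all add: iy_def numeral_2_eq_2 numeral_3_eq_3)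
  have ne: "iy 1 \<noteq> iy 2" using ix23 by (simp add: iy del: One_nat_def)
  define D where "D = (\<lambda>x. Q' k x * Q j x + Q k x * Q' j x)"
  define H where "H = (\<lambda>x. of_real (x3 x * (Q k x * Q j x)) * g (x1 x))"
  define H' where "H' = (\<lambda>x. of_real (x2 x * (Q k x * Q j x) - (x3 x)\<^sup>2 * D x) * g (x1 x))"
  note int = surface_integrable_continuous_mult[OF _ g]
  have "(LINT x|surf. H' x) = 0"
  proof (rule surface_integral_rot_derivative[OF ne, where H=H])
    fix x :: "real^'m" and t assume "x \<in> sphere 0 1"
    define b where "b = 1 - (x1 x)\<^sup>2"
    have c1: "x1 (rot iy t x) = x1 x" for t
      using ix12 ix13 by (intro rot_coord_other) (simp_all add: iy del: One_nat_def)
    have d2: "((\<lambda>t. x2 (rot iy t x)) has_real_derivative - x3 (rot iy t x)) (at t)"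
      using rot_coord_deriv(1)[OF ne, of x t] by (simp only: iy)
    have d3: "((\<lambda>t. x3 (rot iy t x)) has_real_derivative x2 (rot iy t x)) (at t)"
      using rot_coord_deriv(2)[OF ne, of x t] by (simp only: iy)
    have dQ: "((\<lambda>t. harm_Q lam i (x2 (rot iy t x)) b) has_real_derivative
        harm_Q' lam i (x2 (rot iy t x)) b * (- x3 (rot iy t x))) (at t)" for i
      by (rule DERIV_chain2[OF harm_Q_partial[OF lam_ge] d2])
    have "((\<lambda>t. x3 (rot iy t x) * (Q k (rot iy t x) * Q j (rot iy t x))) has_real_derivative
        x2 (rot iy t x) * (Q k (rot iy t x) * Q j (rot iy t x)) - (x3 (rot iy t x))\<^sup>2 * D (rot iy t x)) (at t)"
      unfolding D_def c1 b_def[symmetric]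
      by (rule DERIV_cong[OF DERIV_mult[OF d3 DERIV_mult[OF dQ dQ]]])
         (simp add: algebra_simps power2_eq_square)
    hence "((\<lambda>t. of_real (x3 (rot iy t x) * (Q k (rot iy t x) * Q j (rot iy t x))) * g (x1 x)) has_vector_derivative
        of_real (x2 (rot iy t x) * (Q k (rot iy t x) * Q j (rot iy t x)) - (x3 (rot iy t x))\<^sup>2 * D (rot iy t x)) * g (x1 x)) (at t)"
      by (intro has_vector_derivative_mult_left has_vector_derivative_of_real)
    thus "((\<lambda>t. H (rot iy t x)) has_vector_derivative H' (rot iy t x)) (at t)"
      by (simp only: H_def H'_def c1)
  next
    show "integrable surf H'" unfolding H'_def D_def by (intro int cont_intros)
  qed
  moreover have "H' x = of_real (x2 x * Q k x * Q j x) * g (x1 x) - of_real ((x3 x)\<^sup>2) * (of_real (D x) * g (x1 x))" for x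
    by (simp add: H'_def algebra_simps)
  moreover have i1: "integrable surf (\<lambda>x. of_real (x2 x * Q k x * Q j x) * g (x1 x))"
    by (intro int cont_intros)
  moreover have iD: "integrable surf (\<lambda>x. of_real (D x) * g (x1 x))"
    unfolding D_def by (intro int cont_intros)
  moreover have "integrable surf (\<lambda>x. of_real ((x3 x)\<^sup>2) * (of_real (D x) * g (x1 x)))"
    by (rule surface_integrable_continuous_mult[OF _ iD]) (intro continuous_intros)
  ultimately have eq: "(LINT x|surf. of_real (x2 x * Q k x * Q j x) * g (x1 x))
      = (LINT x|surf. of_real ((x3 x)\<^sup>2) * (of_real (D x) * g (x1 x)))"
    by simp
  have "of_nat (n - 1) * (LINT x|surf. of_real (x2 x * Q k x * Q j x) * g (x1 x))
      = (LINT x|surf. of_real (1 - (x1 x)\<^sup>2 - (x2 x)\<^sup>2) * (of_real (D x) * g (x1 x)))"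
    unfolding eq using surface_integral_x3_sq[of "\<lambda>a c. of_real (harm_Q' lam k c (1 - a\<^sup>2) * harm_Q lam j c (1 - a\<^sup>2)
        + harm_Q lam k c (1 - a\<^sup>2) * harm_Q' lam j c (1 - a\<^sup>2)) * g a"] iD
    by (simp add: D_def)
  also have "\<dots> = (LINT x|surf. of_nat k * (of_real (Q (k - 1) x * Q j x) * (of_real (1 - (x1 x)\<^sup>2) * g (x1 x)))
      + of_nat j * (of_real (Q k x * Q (j - 1) x) * (of_real (1 - (x1 x)\<^sup>2) * g (x1 x)))
      - of_nat (k + j) * (of_real (x2 x * Q k x * Q j x) * g (x1 x)))"
  proof (rule Bochner_Integration.integral_cong[OF refl])
    fix x :: "real^'m"
    have "(1 - (x1 x)\<^sup>2 - (x2 x)\<^sup>2) * D x = (((1 - (x1 x)\<^sup>2) - (x2 x)\<^sup>2) * Q' k x) * Q j x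
        + Q k x * (((1 - (x1 x)\<^sup>2) - (x2 x)\<^sup>2) * Q' j x)"
      by (simp add: D_def algebra_simps)
    also have "\<dots> = real k * (Q (k - 1) x * Q j x) * (1 - (x1 x)\<^sup>2) + real j * (Q k x * Q (j - 1) x) * (1 - (x1 x)\<^sup>2)
      - real (k + j) * (x2 x * Q k x * Q j x)"
      unfolding harm_Q_first_order[OF lam_ge] by (simp add: algebra_simps)
    finally have "of_real (1 - (x1 x)\<^sup>2 - (x2 x)\<^sup>2) * (of_real (D x) * g (x1 x))
      = of_real (real k * (Q (k - 1) x * Q j x) * (1 - (x1 x)\<^sup>2) + real j * (Q k x * Q (j - 1) x) * (1 - (x1 x)\<^sup>2)
      - real (k + j) * (x2 x * Q k x * Q j x)) * g (x1 x)"
      by (metis mult.assoc of_real_mult)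
    thus "of_real (1 - (x1 x)\<^sup>2 - (x2 x)\<^sup>2) * (of_real (D x) * g (x1 x))
      = of_nat k * (of_real (Q (k - 1) x * Q j x) * (of_real (1 - (x1 x)\<^sup>2) * g (x1 x)))
      + of_nat j * (of_real (Q k x * Q (j - 1) x) * (of_real (1 - (x1 x)\<^sup>2) * g (x1 x)))
      - of_nat (k + j) * (of_real (x2 x * Q k x * Q j x) * g (x1 x))"
      by (simp add: algebra_simps)
  qed
  also have "\<dots> = of_nat k * QQ (k - 1) j (\<lambda>s. of_real (1 - s\<^sup>2) * g s)
       + of_nat j * QQ k (j - 1) (\<lambda>s. of_real (1 - s\<^sup>2) * g s)
       - of_nat (k + j) * (LINT x|surf. of_real (x2 x * Q k x * Q j x) * g (x1 x))"
  proof -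
    have "integrable surf (\<lambda>x. of_real (Q i x * Q i' x) * (of_real (1 - (x1 x)\<^sup>2) * g (x1 x)))" for i i'
      by (rule surface_integrable_continuous_mult[OF _ integrable_weight[OF g]]) (intro cont_intros)
    thus ?thesis using i1 unfolding QQ_def by simp
  qed
  finally have "(of_nat (n - 1) + of_nat (k + j)) * (LINT x|surf. of_real (x2 x * Q k x * Q j x) * g (x1 x))
      = of_nat k * QQ (k - 1) j (\<lambda>s. of_real (1 - s\<^sup>2) * g s)
       + of_nat j * QQ k (j - 1) (\<lambda>s. of_real (1 - s\<^sup>2) * g s)"
    by (simp add: algebra_simps)
  moreover have "of_nat (n - 1) = 2 * complex_of_real lam"
    using n2 by (simp add: lam_def of_nat_diff)
  ultimately show ?thesis by (simp add: add.assoc)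
qed

lemma QQ_mult_x2:
  assumes g: "integrable surf (\<lambda>x. g (x1 x))"
  shows "(LINT x|surf. of_real (x2 x * Q k x * Q j x) * g (x1 x))
    = of_real (harm_u lam k) * QQ (Suc k) j g + of_real (harm_v lam k) * QQ (k - 1) j (\<lambda>s. of_real (1 - s\<^sup>2) * g s)"
proof -
  have "(LINT x|surf. of_real (x2 x * Q k x * Q j x) * g (x1 x))
     = (LINT x|surf. of_real (harm_u lam k) * (of_real (Q (Suc k) x * Q j x) * g (x1 x))
        + of_real (harm_v lam k) * (of_real (Q (k - 1) x * Q j x) * (of_real (1 - (x1 x)\<^sup>2) * g (x1 x))))"
    unfolding harm_Q_mult[OF lam_ge]
    by (intro Bochner_Integration.integral_cong refl) (simp add: algebra_simps)
  also have "\<dots> = of_real (harm_u lam k) * QQ (Suc k) j g + of_real (harm_v lam k) * QQ (k - 1) j (\<lambda>s. of_real (1 - s\<^sup>2) * g s)"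
  proof -
    have "integrable surf (\<lambda>x. of_real (Q i x * Q i' x) * (of_real (1 - (x1 x)\<^sup>2) * g (x1 x)))"
      "integrable surf (\<lambda>x. of_real (Q i x * Q i' x) * g (x1 x))" for i i'
      by (rule surface_integrable_continuous_mult[OF _ integrable_weight[OF g]]
          surface_integrable_continuous_mult[OF _ g], intro cont_intros)+
    thus ?thesis unfolding QQ_def by simp
  qed
  finally show ?thesis .
qed

lemma QQ_commute: "QQ k j g = QQ j k g"
  unfolding QQ_def by (intro Bochner_Integration.integral_cong refl) (simp add: mult.commute)

text \<open>
  Comparing the two evaluations of \<open>\<integral> x\<^sub>2 Q\<^sub>k Q\<^sub>j g\<close> expresses the integral for \<open>(k + 1, j)\<close> by those
  for \<open>(k - 1, j)\<close> and \<open>(k, j - 1)\<close> with a modified weight. The only diagonal terms that can occur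
  are for \<open>j = k - 1\<close>, and there the coefficient is \<open>0\<close>.
\<close>

lemma QQ_orthogonal_less:
  "integrable surf (\<lambda>x. g (x1 x)) \<Longrightarrow> j < k \<Longrightarrow> QQ k j g = 0"
proof (induction k arbitrary: j g rule: less_induct)
  case (less k')
  then obtain k where k: "k' = Suc k" by (cases k') auto
  define h where "h = (\<lambda>s. of_real (1 - s\<^sup>2) * g s)"
  have h: "integrable surf (\<lambda>x. h (x1 x))"
    unfolding h_def using less.prems(1) by (rule integrable_weight)
  let ?u = "complex_of_real (harm_u lam k)" and ?v = "complex_of_real (harm_v lam k)"
  let ?c = "2 * complex_of_real lam + of_nat k + of_nat j"
  have IH: "QQ a b h = 0" if "b < a" "a \<le> k" for a b
    using less.IH[of a h b] that h k by simp
  have eq: "?c * (?u * QQ (Suc k) j g + ?v * QQ (k - 1) j h)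
      = of_nat k * QQ (k - 1) j h + of_nat j * QQ k (j - 1) h"
    using QQ_parts[OF less.prems(1), of k j] QQ_mult_x2[OF less.prems(1), of k j]
    by (simp add: h_def)
  have vk: "?v * (2 * of_real lam + 2 * of_nat k - 1) = of_nat k"
    using arg_cong[OF harm_v_mult[OF lam_ge, of k], of complex_of_real] by (simp add: algebra_simps)
  have "?c * (?u * QQ (Suc k) j g) = 0"
  proof -
    consider "j + 1 < k" | "j + 1 = k" | "j = k" using less.prems(2) k by linarith
    thus ?thesis
    proof cases
      case 1
      have "of_nat j * QQ k (j - 1) h = 0" using 1 IH[of "j - 1" k] by (cases j) auto
      thus ?thesis using eq IH[of j "k - 1"] 1 by simp
    next
      case 2
      have a: "of_nat j * QQ k (j - 1) h = 0" using 2 IH[of "j - 1" k] by (cases j) auto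
      have "of_nat k = of_nat j + (1::complex)" using 2 by auto
      hence "?c = 2 * of_real lam + 2 * of_nat k - 1" by simp
      hence "?c * ?v = of_nat k" using vk by (simp only: mult.commute)
      moreover have "?c * (?u * QQ (Suc k) j g) = (of_nat k - ?c * ?v) * QQ (k - 1) j h"
        using eq a by (simp only: algebra_simps) simp
      ultimately show ?thesis by simp
    next
      case 3
      show ?thesis
      proof (cases "k = 0")
        case True thus ?thesis using 3 eq by simp
      next
        case False
        have "QQ k (k - 1) h = 0" using IH[of "k - 1" k] False by simp
        thus ?thesis using eq 3 QQ_commute[of "k - 1" k h] by simp
      qed
    qed
  qed
  moreover have "?c \<noteq> 0"
  proof
    assume "?c = 0"
    hence "Re ?c = 0" by (simp only: zero_complex.simps)
    thus False using lam_ge by simp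
  qed
  ultimately show ?case using harm_u_pos[OF lam_ge, of k] k by simp
qed

lemma QQ_orthogonal:
  assumes "integrable surf (\<lambda>x. g (x1 x))" "k \<noteq> j"
  shows "QQ k j g = 0"
  using QQ_orthogonal_less[OF assms(1)] QQ_commute assms(2) by (metis linorder_neqE_nat)

abbreviation Z :: "nat \<Rightarrow> nat \<Rightarrow> real^'m \<Rightarrow> real" where
  "Z l k x \<equiv> harm_Z lam l k (x1 x) (x2 x)"

definition ip :: "nat \<Rightarrow> nat \<Rightarrow> nat \<Rightarrow> nat \<Rightarrow> real" where
  "ip l k l' k' = (LINT x|surf. Z l k x * Z l' k' x)"

lemma integrable_cont_real:
  fixes p :: "real^'m \<Rightarrow> real"
  assumes "continuous_on UNIV p" shows "integrable surf p"
  using surface_integrable_continuous[of "\<lambda>x. complex_of_real (p x)"] assms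
  by (simp add: complex_of_real_integrable_eq continuous_on_of_real)

lemma integrable_ZZ: "integrable surf (\<lambda>x. Z l k x * Z l' k' x)"
  by (intro integrable_cont_real cont_intros)

lemma ip_commute: "ip l k l' k' = ip l' k' l k"
  by (simp add: ip_def mult.commute)

lemma ip_orthogonal_k:
  assumes "k \<noteq> k'"
  shows "ip l k l' k' = 0"
proof (cases "k \<le> l \<and> k' \<le> l'")
  case True
  define g where "g = (\<lambda>s. complex_of_real (gegenbauer (lam + real k) (l - k) s * gegenbauer (lam + real k') (l' - k') s))"
  have g: "integrable surf (\<lambda>x. g (x1 x))"
    unfolding g_def by (intro surface_integrable_continuous cont_intros)
  have "complex_of_real (ip l k l' k') = (LINT x|surf. complex_of_real (Z l k x * Z l' k' x))"
    unfolding ip_def by (rule integral_complex_of_real[symmetric])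
  also have "\<dots> = QQ k k' g"
    unfolding QQ_def g_def using True by (simp add: harm_Z_def mult_ac)
  also have "\<dots> = 0" by (rule QQ_orthogonal[OF g assms])
  finally show ?thesis by simp
qed (auto simp: ip_def harm_Z_def)

lemma Z_rot_deriv:
  "((\<lambda>t. Z l k (rot ix t x)) has_real_derivative
     ladder_down lam l k * Z l (k - 1) (rot ix t x) - ladder_up lam k * Z l (Suc k) (rot ix t x)) (at t)"
  by (rule harm_Z_rotate_deriv[OF lam_ge]) (rule rot_coord_deriv[OF ix12])+

text \<open>
  Skew-symmetry of the rotation derivative for the pair \<open>Z\<^sub>l\<^sup>k\<close>, \<open>Z\<^sub>l\<^sub>'\<^sup>k\<^sup>+\<^sup>1\<close>; of the four terms two
  vanish by orthogonality in \<open>k\<close>.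
\<close>

lemma ip_ladder: "ladder_up lam k * ip l (Suc k) l' (Suc k) = ladder_down lam l' (Suc k) * ip l k l' k"
proof -
  define H where "H = (\<lambda>x. Z l k x * Z l' (Suc k) x)"
  define H' where "H' = (\<lambda>x. (ladder_down lam l k * Z l (k - 1) x - ladder_up lam k * Z l (Suc k) x) * Z l' (Suc k) x
      + Z l k x * (ladder_down lam l' (Suc k) * Z l' k x - ladder_up lam (Suc k) * Z l' (Suc (Suc k)) x))"
  have "(LINT x|surf. complex_of_real (H' x)) = 0"
  proof (rule surface_integral_rot_derivative[OF ix12, where H = "\<lambda>x. complex_of_real (H x)"])
    fix x :: "real^'m" and t
    have "((\<lambda>t. H (rot ix t x)) has_real_derivative H' (rot ix t x)) (at t)"
      unfolding H_def H'_def
      using DERIV_mult[OF Z_rot_deriv[of l k x t] Z_rot_deriv[of l' "Suc k" x t]]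
      by (simp add: add.commute mult.commute)
    thus "((\<lambda>t. complex_of_real (H (rot ix t x))) has_vector_derivative complex_of_real (H' (rot ix t x))) (at t)"
      by (rule has_vector_derivative_of_real)
  next
    show "integrable surf (\<lambda>x. complex_of_real (H' x))"
      unfolding H'_def by (intro surface_integrable_continuous cont_intros)
  qed
  hence "(LINT x|surf. H' x) = 0" by simp
  moreover have "(LINT x|surf. H' x) = ladder_down lam l k * ip l (k - 1) l' (Suc k)
      - ladder_up lam k * ip l (Suc k) l' (Suc k) + (ladder_down lam l' (Suc k) * ip l k l' k
      - ladder_up lam (Suc k) * ip l k l' (Suc (Suc k)))"
  proof -
    have "H' x = ladder_down lam l k * (Z l (k - 1) x * Z l' (Suc k) x)
      - ladder_up lam k * (Z l (Suc k) x * Z l' (Suc k) x) + (ladder_down lam l' (Suc k) * (Z l k x * Z l' k x)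
      - ladder_up lam (Suc k) * (Z l k x * Z l' (Suc (Suc k)) x))" for x
      by (simp add: H'_def algebra_simps)
    thus ?thesis unfolding ip_def using integrable_ZZ by simp
  qed
  ultimately show ?thesis by (simp add: ip_orthogonal_k)
qed

text \<open>
  The inner product of \<open>Z\<^sub>l\<^sup>k\<^sup>+\<^sup>1\<close> and \<open>Z\<^sub>l\<^sub>'\<^sup>k\<^sup>+\<^sup>1\<close> is symmetric, but \<open>ip_ladder\<close> computes it with the
  downward constant of \<open>l'\<close> or of \<open>l\<close>, and these constants differ.
\<close>

lemma ip_orthogonal_l:
  assumes "k \<le> l" "l < l'"
  shows "ip l k l' k = 0"
proof -
  have "ladder_down lam l' (Suc k) * ip l k l' k = ladder_down lam l (Suc k) * ip l k l' k"
    using ip_ladder[of k l l'] ip_ladder[of k l' l] by (simp add: ip_commute)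
  thus ?thesis using ladder_down_strict[OF lam_ge assms] by simp
qed

lemma ip_orthogonal:
  assumes "k \<le> l" "k' \<le> l'" "(l, k) \<noteq> (l', k')"
  shows "ip l k l' k' = 0"
proof (cases "k = k'")
  case True
  hence "l < l' \<or> l' < l" using assms by auto
  thus ?thesis using True assms ip_orthogonal_l[of k l l'] ip_orthogonal_l[of k l' l]
    by (auto simp: ip_commute)
qed (rule ip_orthogonal_k)

definition nrm :: "nat \<Rightarrow> nat \<Rightarrow> real" where "nrm l k = ip l k l k"

lemma nrm_nonneg: "nrm l k \<ge> 0"
  unfolding nrm_def ip_def by (rule Bochner_Integration.integral_nonneg) (rule zero_le_square)

lemma nrm_Suc_k: "nrm l (Suc k) = ladder_down lam l (Suc k) / ladder_up lam k * nrm l k"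
  using ip_ladder[of k l l] ladder_up_pos[OF lam_ge, of k] by (simp add: nrm_def field_simps)

text \<open>
  Multiplication by \<open>x\<^sub>1\<close> is symmetric: \<open>\<integral> x\<^sub>1 C\<^sub>l C\<^sub>l\<^sub>+\<^sub>1\<close> is computed from the three-term recursion at
  \<open>l\<close> and at \<open>l + 1\<close>.
\<close>

lemma nrm_Suc_l: "nrm (Suc l) 0 = nrm l 0 * ((real l + 2 * lam) * (real l + lam)) / ((real l + 1) * (real l + 1 + lam))"
proof -
  define T where "T = (LINT x|surf. x1 x * Z l 0 x * Z (Suc l) 0 x)"
  let ?C = "\<lambda>m x. gegenbauer lam m (x1 x)"
  have Z0: "Z m 0 x = ?C m x" for m x by (simp add: harm_Z_def)
  have t1: "(real l + 1) * ?C (Suc l) x = 2 * (real l + lam) * x1 x * ?C l x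
      - (real l + 2 * lam - 1) * gegenbauer_prev lam l (x1 x)" for x
    using gegenbauer_three_term[of l lam "x1 x"] by (simp add: add.commute)
  have t2: "(real l + 2) * ?C (Suc (Suc l)) x = 2 * (real l + 1 + lam) * x1 x * ?C (Suc l) x
      - (real l + 2 * lam) * ?C l x" for x
    using gegenbauer_three_term[of "Suc l" lam "x1 x"] by (simp add: algebra_simps)
  have i: "integrable surf (\<lambda>x. x1 x * ?C l x * ?C (Suc l) x)"
    by (intro integrable_cont_real cont_intros)
  have ii: "integrable surf (\<lambda>x. ?C a x * ?C b x)" for a b
    by (intro integrable_cont_real cont_intros)
  have "(real l + 1) * nrm (Suc l) 0 = (LINT x|surf. ((real l + 1) * ?C (Suc l) x) * ?C (Suc l) x)"
    unfolding nrm_def ip_def Z0 by (simp add: mult.assoc)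
  also have "\<dots> = (LINT x|surf. 2 * (real l + lam) * (x1 x * ?C l x * ?C (Suc l) x)
      - (real l + 2 * lam - 1) * (gegenbauer_prev lam l (x1 x) * ?C (Suc l) x))"
    unfolding t1 by (intro Bochner_Integration.integral_cong refl) (simp add: algebra_simps)
  also have "\<dots> = 2 * (real l + lam) * T
      - (real l + 2 * lam - 1) * (LINT x|surf. gegenbauer_prev lam l (x1 x) * ?C (Suc l) x)"
    unfolding T_def Z0 using i ii by (cases l) simp_all
  also have "(LINT x|surf. gegenbauer_prev lam l (x1 x) * ?C (Suc l) x) = 0"
    using ip_orthogonal[of 0 "l - 1" 0 "Suc l"] by (cases l) (simp_all add: ip_def Z0)
  finally have 1: "(real l + 1) * nrm (Suc l) 0 = 2 * (real l + lam) * T" by simp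
  have "0 = (real l + 2) * (LINT x|surf. ?C (Suc (Suc l)) x * ?C l x)"
    using ip_orthogonal[of 0 "Suc (Suc l)" 0 l] by (simp add: ip_def Z0)
  also have "\<dots> = (LINT x|surf. ((real l + 2) * ?C (Suc (Suc l)) x) * ?C l x)"
    by (simp add: mult.assoc)
  also have "\<dots> = (LINT x|surf. 2 * (real l + 1 + lam) * (x1 x * ?C l x * ?C (Suc l) x)
      - (real l + 2 * lam) * (?C l x * ?C l x))"
    unfolding t2 by (intro Bochner_Integration.integral_cong refl) (simp add: algebra_simps)
  also have "\<dots> = 2 * (real l + 1 + lam) * T - (real l + 2 * lam) * nrm l 0"
    unfolding T_def Z0 nrm_def ip_def using i ii by simp
  finally have 2: "2 * T * (real l + 1 + lam) = (real l + 2 * lam) * nrm l 0" by (simp add: algebra_simps)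
  have "(real l + 1) * (real l + 1 + lam) * nrm (Suc l) 0 = (real l + lam) * ((real l + 2 * lam) * nrm l 0)"
  proof -
    have "(real l + 1) * (real l + 1 + lam) * nrm (Suc l) 0 = (real l + 1 + lam) * (2 * (real l + lam) * T)"
      unfolding 1[symmetric] by (simp only: mult_ac)
    thus ?thesis unfolding 2[symmetric] by (simp only: mult_ac)
  qed
  moreover have "(real l + 1) * (real l + 1 + lam) \<noteq> 0" using lam_ge by simp
  ultimately show ?thesis by (simp add: nonzero_eq_divide_eq mult_ac)
qed

lemma nrm_0_0: "nrm 0 0 = measure (surf :: (real^'m) measure) (sphere 0 1)"
  by (simp add: nrm_def ip_def harm_Z_def)

text \<open>
  The recursion shows that \<open>(l + \<lambda>)\<close> times the squared norm does not decrease in \<open>l\<close>, because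
  \<open>l + 2 \<lambda> \<ge> l + 1\<close>.
\<close>

lemma nrm_0_lower: "nrm l 0 \<ge> nrm 0 0 * (lam / (real l + lam))"
proof (induction l)
  case 0
  thus ?case using lam_ge by simp
next
  case (Suc l)
  have "nrm 0 0 * (lam / (real l + 1 + lam)) = nrm 0 0 * (lam / (real l + lam)) * (real l + lam) / (real l + 1 + lam)"
  proof -
    have "lam / (real l + lam) * (real l + lam) = lam" using lam_ge by simp
    hence "nrm 0 0 * lam = nrm 0 0 * (lam / (real l + lam)) * (real l + lam)"
      by (simp only: mult.assoc)
    thus ?thesis by (simp only: times_divide_eq_right)
  qed
  also have "\<dots> \<le> nrm l 0 * (real l + lam) / (real l + 1 + lam)"
    using Suc lam_ge by (intro divide_right_mono mult_right_mono) auto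
  also have "\<dots> \<le> nrm l 0 * (real l + lam) / (real l + 1 + lam) * ((real l + 2 * lam) / (real l + 1))"
  proof -
    have "0 \<le> nrm l 0 * (real l + lam) / (real l + 1 + lam)"
      using lam_ge by (intro divide_nonneg_nonneg mult_nonneg_nonneg nrm_nonneg) simp_all
    moreover have "1 \<le> (real l + 2 * lam) / (real l + 1)" using lam_ge by (simp add: field_simps)
    ultimately have "nrm l 0 * (real l + lam) / (real l + 1 + lam) * 1
        \<le> nrm l 0 * (real l + lam) / (real l + 1 + lam) * ((real l + 2 * lam) / (real l + 1))"
      by (intro mult_left_mono)
    thus ?thesis by (simp only: mult_1_right)
  qed
  also have "\<dots> = nrm (Suc l) 0" unfolding nrm_Suc_l by (simp add: mult_ac)
  finally show ?case by (simp add: add.commute)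
qed

lemma nrm_pos: "k \<le> l \<Longrightarrow> nrm l k > 0"
proof (induction k)
  case 0
  have "nrm 0 0 * (lam / (real l + lam)) > 0"
    unfolding nrm_0_0 using lam_ge surface_measure_pos
    by (intro mult_pos_pos divide_pos_pos) auto
  thus ?case using nrm_0_lower[of l] by linarith
next
  case (Suc k)
  thus ?case unfolding nrm_Suc_k
    using ladder_up_pos[OF lam_ge, of k] ladder_down_pos[OF lam_ge, of k l] by simp
qed

end

section \<open>Density of polynomials in square mean\<close>

text \<open>
  The squared distance as an extended integral, so that no integrability has to be assumed.
\<close>

definition dist2 :: "'a measure \<Rightarrow> ('a \<Rightarrow> real) \<Rightarrow> ('a \<Rightarrow> real) \<Rightarrow> ennreal" where
  "dist2 M f g = (\<integral>\<^sup>+ x. ennreal ((f x - g x)\<^sup>2) \<partial>M)"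

definition poly_approx :: "'a::real_normed_vector measure \<Rightarrow> ('a \<Rightarrow> real) \<Rightarrow> bool" where
  "poly_approx M f \<longleftrightarrow> (\<forall>e>0. \<exists>p. real_polynomial_function p \<and> dist2 M f p < ennreal e)"

lemma dist2_triangle:
  assumes [measurable]: "f \<in> borel_measurable M" "g \<in> borel_measurable M" "h \<in> borel_measurable M"
  shows "dist2 M f h \<le> 2 * dist2 M f g + 2 * dist2 M g h"
proof -
  have sq: "(f x - h x)\<^sup>2 \<le> 2 * (f x - g x)\<^sup>2 + 2 * (g x - h x)\<^sup>2" for x
    using zero_le_power2[of "(f x - g x) - (g x - h x)"] by (simp add: power2_eq_square algebra_simps)
  have "ennreal ((f x - h x)\<^sup>2) \<le> 2 * ennreal ((f x - g x)\<^sup>2) + 2 * ennreal ((g x - h x)\<^sup>2)"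
    for x
  proof -
    have "ennreal ((f x - h x)\<^sup>2) \<le> ennreal (2 * (f x - g x)\<^sup>2 + 2 * (g x - h x)\<^sup>2)"
      by (rule ennreal_leI) (rule sq)
    thus ?thesis by (simp add: ennreal_mult)
  qed
  hence "dist2 M f h \<le> (\<integral>\<^sup>+ x. 2 * ennreal ((f x - g x)\<^sup>2) + 2 * ennreal ((g x - h x)\<^sup>2) \<partial>M)"
    unfolding dist2_def by (rule nn_integral_mono)
  also have "\<dots> = 2 * dist2 M f g + 2 * dist2 M g h"
    unfolding dist2_def by (subst nn_integral_add) (simp_all add: nn_integral_cmult)
  finally show ?thesis .
qed

lemma ennreal_quarters_add_less: "a < ennreal (e / 4) \<Longrightarrow> b < ennreal (e / 4) \<Longrightarrow> e > 0 \<Longrightarrow> 2 * a + 2 * b < ennreal e"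
proof -
  assume a: "a < ennreal (e / 4)" "b < ennreal (e / 4)" "e > 0"
  obtain a' b' where ab: "a = ennreal a'" "b = ennreal b'" "a' \<ge> 0" "b' \<ge> 0"
    using a by (cases a; cases b) auto
  have "a' < e / 4" "b' < e / 4" using a ab by (auto simp: ennreal_less_iff)
  thus ?thesis using ab by (simp add: ennreal_less_iff flip: ennreal_plus ennreal_numeral ennreal_mult)
qed

lemma real_polynomial_measurable:
  fixes p :: "'a::euclidean_space \<Rightarrow> real"
  shows "real_polynomial_function p \<Longrightarrow> p \<in> borel_measurable borel"
  by (intro borel_measurable_continuous_onI continuous_on_polymonial_function)
     (simp add: real_polynomial_function_eq)

text \<open>
  The setting of the density theorem; here the measure will be the image of the surface measure in
  the unit disc of the \<open>x\<^sub>1x\<^sub>2\<close>-plane.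
\<close>

locale compact_finite_measure =
  fixes M :: "'a::euclidean_space measure" and K :: "'a set"
  assumes sets_M [measurable_cong]: "sets M = sets borel"
    and fin: "emeasure M (space M) \<noteq> \<infinity>"
    and K: "compact K" "AE x in M. x \<in> K"
begin

lemma space_M: "space M = UNIV"
  using sets_eq_imp_space_eq[OF sets_M] by simp

lemma poly_approx_near:
  assumes [measurable]: "f \<in> borel_measurable M"
    and g: "\<And>e. e > 0 \<Longrightarrow> \<exists>g. g \<in> borel_measurable M \<and> dist2 M f g < ennreal e \<and> poly_approx M g"
  shows "poly_approx M f"
  unfolding poly_approx_def
proof (intro allI impI)
  fix e :: real assume e: "e > 0"
  obtain g where g [measurable]: "g \<in> borel_measurable M" and d: "dist2 M f g < ennreal (e / 4)" "poly_approx M g"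
    using g[of "e / 4"] e by auto
  obtain p where p: "real_polynomial_function p" "dist2 M g p < ennreal (e / 4)"
    using d(2) e unfolding poly_approx_def by (metis divide_pos_pos zero_less_numeral)
  have [measurable]: "p \<in> borel_measurable M"
    using real_polynomial_measurable[OF p(1)] by (simp add: measurable_cong_sets[OF sets_M refl])
  have "dist2 M f p \<le> 2 * dist2 M f g + 2 * dist2 M g p" by (rule dist2_triangle) measurable
  also have "\<dots> < ennreal e" using d(1) p(2) e by (rule ennreal_quarters_add_less)
  finally show "\<exists>p. real_polynomial_function p \<and> dist2 M f p < ennreal e" using p(1) by blast
qed

lemma poly_approx_limit:
  assumes [measurable]: "f \<in> borel_measurable M" "\<And>i. g i \<in> borel_measurable M"
    and w [measurable]: "w \<in> borel_measurable M" "(\<integral>\<^sup>+ x. w x \<partial>M) < \<infinity>"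
    and bound: "\<And>i x. ennreal ((f x - g i x)\<^sup>2) \<le> w x"
    and lim: "\<And>x. (\<lambda>i. g i x) \<longlonglongrightarrow> f x"
    and g: "\<And>i. poly_approx M (g i)"
  shows "poly_approx M f"
proof (rule poly_approx_near)
  fix e :: real assume e: "e > 0"
  have "(\<lambda>i. \<integral>\<^sup>+ x. ennreal ((f x - g i x)\<^sup>2) \<partial>M) \<longlonglongrightarrow> (\<integral>\<^sup>+ x. 0 \<partial>M)"
  proof (rule nn_integral_dominated_convergence[where w = w])
    show "AE x in M. (\<lambda>i. ennreal ((f x - g i x)\<^sup>2)) \<longlonglongrightarrow> 0"
    proof (rule AE_I2)
      fix x
      have "(\<lambda>i. (f x - g i x)\<^sup>2) \<longlonglongrightarrow> (f x - f x)\<^sup>2" by (intro tendsto_intros lim)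
      thus "(\<lambda>i. ennreal ((f x - g i x)\<^sup>2)) \<longlonglongrightarrow> 0"
        using tendsto_ennrealI by fastforce
    qed
  qed (use bound w in auto)
  hence "\<forall>\<^sub>F i in sequentially. dist2 M f (g i) < ennreal e"
    unfolding dist2_def using e by (intro order_tendstoD(2)) auto
  then obtain i where "dist2 M f (g i) < ennreal e" by (auto dest: eventually_happens)
  thus "\<exists>g. g \<in> borel_measurable M \<and> dist2 M f g < ennreal e \<and> poly_approx M g"
    using g assms(2) by blast
qed (rule assms)

lemma poly_approx_continuous:
  assumes f: "continuous_on UNIV f"
  shows "poly_approx M f"
  unfolding poly_approx_def
proof (intro allI impI)
  fix e :: real assume e: "e > 0"
  obtain B where B: "emeasure M (space M) = ennreal B" "B \<ge> 0" using fin by (cases "emeasure M (space M)") auto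
  \<comment> \<open>Any \<open>d\<close> with \<open>d\<^sup>2 B < e\<close> would do; the summand \<open>1\<close> covers \<open>B = 0\<close>.\<close>
  define d where "d = sqrt (e / (B + 1))"
  have d: "d > 0" "d\<^sup>2 = e / (B + 1)" using e B by (auto simp: d_def)
  obtain p where p: "real_polynomial_function p" "\<And>x. x \<in> K \<Longrightarrow> \<bar>f x - p x\<bar> < d"
    using Stone_Weierstrass_real_polynomial_function[OF K(1) continuous_on_subset[OF f], of d] d by auto
  have "dist2 M f p \<le> (\<integral>\<^sup>+ x. ennreal (d\<^sup>2) \<partial>M)"
    unfolding dist2_def using K(2)
  proof (intro nn_integral_mono_AE, eventually_elim)
    fix x assume "x \<in> K"
    hence "\<bar>f x - p x\<bar> \<le> \<bar>d\<bar>" using p(2)[of x] d by simp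
    thus "ennreal ((f x - p x)\<^sup>2) \<le> ennreal (d\<^sup>2)" by (intro ennreal_leI) (simp add: abs_le_square_iff)
  qed
  also have "\<dots> = ennreal (d\<^sup>2 * B)" using B by (simp add: ennreal_mult)
  also have "\<dots> < ennreal e"
    using e B by (intro ennreal_lessI) (auto simp: d(2) field_simps)
  finally show "\<exists>p. real_polynomial_function p \<and> dist2 M f p < ennreal e" using p(1) by blast
qed

lemma nn_integral_1_finite: "(\<integral>\<^sup>+ x. 1 \<partial>M) < \<infinity>"
  using fin by (simp add: top.not_eq_extremum)

text \<open>
  The indicator of a compact set \<open>C\<close> is the pointwise limit of \<open>max 0 (1 - i dist(x, C))\<close>.
\<close>

lemma poly_approx_compact:
  assumes C: "compact C"
  shows "poly_approx M (indicator C)"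
proof (cases "C = {}")
  case True
  have "poly_approx M (\<lambda>x. 0)" by (rule poly_approx_continuous) simp
  moreover have "indicator C = (\<lambda>x::'a. 0::real)" using True by auto
  ultimately show ?thesis by simp
next
  case False
  have [measurable]: "C \<in> sets borel" using C by (simp add: borel_compact)
  define g where "g = (\<lambda>(i::nat) x. max 0 (1 - real i * infdist x C))"
  have cont: "continuous_on UNIV (g i)" for i
    unfolding g_def by (intro continuous_intros)
  have gb: "0 \<le> g i x" "g i x \<le> 1" for i x
    using infdist_nonneg[of x C] by (auto simp: g_def)
  show ?thesis
  proof (rule poly_approx_limit[where g = g and w = "\<lambda>_. 1"])
    show "g i \<in> borel_measurable M" for i
      using borel_measurable_continuous_onI[OF cont] by (simp add: measurable_cong_sets[OF sets_M refl])
    show "poly_approx M (g i)" for i by (rule poly_approx_continuous[OF cont])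
    fix x
    show "ennreal ((indicator C x - g i x)\<^sup>2) \<le> 1" for i
    proof -
      have "\<bar>indicator C x - g i x\<bar> \<le> 1" using gb[of i x] by (auto simp: indicator_def)
      thus ?thesis by (metis abs_square_le_1 ennreal_1 ennreal_leI)
    qed
    show "(\<lambda>i. g i x) \<longlonglongrightarrow> indicator C x"
    proof (cases "x \<in> C")
      case True thus ?thesis by (simp add: g_def)
    next
      case False
      hence pos: "infdist x C > 0"
        using C \<open>C \<noteq> {}\<close> by (metis compact_imp_closed in_closed_iff_infdist_zero infdist_nonneg order_le_less)
      obtain N where N: "1 / infdist x C < real N" using reals_Archimedean2 by blast
      have "g i x = 0" if "i \<ge> N" for i
      proof -
        have "1 < real N * infdist x C" using N pos by (simp add: field_simps)
        also have "\<dots> \<le> real i * infdist x C" using that pos by (intro mult_right_mono) auto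
        finally show ?thesis by (simp add: g_def)
      qed
      hence "\<forall>\<^sub>F i in sequentially. g i x = 0" by (auto simp: eventually_sequentially)
      thus ?thesis using False by (simp add: tendsto_eventually)
    qed
  qed (use nn_integral_1_finite in auto)
qed

text \<open>
  By inner regularity a Borel set exceeds a compact subset by arbitrarily little measure.
\<close>

lemma poly_approx_borel:
  assumes [measurable]: "A \<in> sets M"
  shows "poly_approx M (indicator A)"
proof (rule poly_approx_near)
  fix e :: real assume e: "e > 0"
  have A: "A \<in> sets borel" using assms sets_M by simp
  have "\<exists>C. C \<subseteq> A \<and> compact C \<and> emeasure M (A - C) < ennreal e"
  proof (cases "emeasure M A = 0")
    case True
    thus ?thesis using e by (intro exI[of _ "{}"]) auto
  next
    case False
    have finA: "emeasure M A \<noteq> \<infinity>"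
      using fin emeasure_space[of M A] by (auto simp: top_unique)
    have "emeasure M A - ennreal e < emeasure M A"
      using False finA e by (intro ennreal_between) (auto simp: zero_less_iff_neq_zero less_top)
    hence "emeasure M A - ennreal e < (SUP C \<in> {C. C \<subseteq> A \<and> compact C}. emeasure M C)"
      using inner_regular[OF sets_M fin A] by simp
    then obtain C where C: "C \<subseteq> A" "compact C" "emeasure M A - ennreal e < emeasure M C"
      by (auto simp: less_SUP_iff)
    have "C \<in> sets M" using C(2) sets_M by (simp add: borel_compact)
    hence "emeasure M (A - C) = emeasure M A - emeasure M C"
      using C(1) finA assms emeasure_mono[OF C(1) assms] by (intro emeasure_Diff) (auto simp: top_unique)
    also have "\<dots> < ennreal e"
    proof -
      obtain a where a: "emeasure M A = ennreal a" "a \<ge> 0" using finA by (cases "emeasure M A") auto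
      obtain c where c: "emeasure M C = ennreal c" "c \<ge> 0"
        using emeasure_mono[OF C(1) assms] finA by (cases "emeasure M C") (auto simp: top_unique)
      have "ennreal (a - e) < ennreal c" using C(3) a c e by (simp add: ennreal_minus)
      hence "a - e < c" by (metis ennreal_leI not_le)
      thus ?thesis using a c e by (simp add: ennreal_minus ennreal_lessI)
    qed
    finally show ?thesis using C by blast
  qed
  then obtain C where C: "C \<subseteq> A" "compact C" "emeasure M (A - C) < ennreal e" by blast
  have [measurable]: "C \<in> sets M" using C(2) sets_M by (simp add: borel_compact)
  have "dist2 M (indicator A) (indicator C) = (\<integral>\<^sup>+ x. indicator (A - C) x \<partial>M)"
    unfolding dist2_def using C(1) by (intro nn_integral_cong) (auto simp: indicator_def)
  also have "\<dots> = emeasure M (A - C)" by simp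
  finally show "\<exists>g. g \<in> borel_measurable M \<and> dist2 M (indicator A) g < ennreal e \<and> poly_approx M g"
    using C poly_approx_compact[OF C(2)] by (intro exI[of _ "indicator C"]) auto
qed (use assms in measurable)

lemma poly_approx_cmult:
  assumes [measurable]: "f \<in> borel_measurable M" and f: "poly_approx M f"
  shows "poly_approx M (\<lambda>x. c * f x)"
  unfolding poly_approx_def
proof (intro allI impI)
  fix e :: real assume e: "e > 0"
  have pos: "e / (c\<^sup>2 + 1) > 0" using e by (simp add: add_nonneg_pos)
  then obtain p where p: "real_polynomial_function p" "dist2 M f p < ennreal (e / (c\<^sup>2 + 1))"
    using f unfolding poly_approx_def by blast
  have [measurable]: "p \<in> borel_measurable M"
    using real_polynomial_measurable[OF p(1)] by (simp add: measurable_cong_sets[OF sets_M refl])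
  have "dist2 M (\<lambda>x. c * f x) (\<lambda>x. c * p x) = (\<integral>\<^sup>+ x. ennreal (c\<^sup>2) * ennreal ((f x - p x)\<^sup>2) \<partial>M)"
    unfolding dist2_def by (intro nn_integral_cong)
      (simp add: ennreal_mult[symmetric] power_mult_distrib[symmetric] algebra_simps)
  also have "\<dots> = ennreal (c\<^sup>2) * dist2 M f p" unfolding dist2_def by (simp add: nn_integral_cmult)
  also have "\<dots> \<le> ennreal (c\<^sup>2) * ennreal (e / (c\<^sup>2 + 1))" using p(2) by (intro mult_left_mono) auto
  also have "\<dots> = ennreal (c\<^sup>2 * (e / (c\<^sup>2 + 1)))"
    by (rule ennreal_mult[symmetric]) (use pos in auto)
  also have "\<dots> < ennreal e"
  proof (rule ennreal_lessI[OF e])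
    have "c\<^sup>2 + 1 > 0" by (simp add: add_nonneg_pos)
    thus "c\<^sup>2 * (e / (c\<^sup>2 + 1)) < e" using e by (simp add: field_simps)
  qed
  finally show "\<exists>p. real_polynomial_function p \<and> dist2 M (\<lambda>x. c * f x) p < ennreal e"
    using real_polynomial_function.intros(4)[OF real_polynomial_function.intros(2) p(1)] by blast
qed

lemma poly_approx_add:
  assumes [measurable]: "f \<in> borel_measurable M" "g \<in> borel_measurable M"
    and f: "poly_approx M f" and g: "poly_approx M g"
  shows "poly_approx M (\<lambda>x. f x + g x)"
  unfolding poly_approx_def
proof (intro allI impI)
  fix e :: real assume e: "e > 0"
  obtain p where p: "real_polynomial_function p" "dist2 M f p < ennreal (e / 4)"
    using f e unfolding poly_approx_def by (metis divide_pos_pos zero_less_numeral)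
  obtain q where q: "real_polynomial_function q" "dist2 M g q < ennreal (e / 4)"
    using g e unfolding poly_approx_def by (metis divide_pos_pos zero_less_numeral)
  have [measurable]: "p \<in> borel_measurable M" "q \<in> borel_measurable M"
    using real_polynomial_measurable[OF p(1)] real_polynomial_measurable[OF q(1)]
    by (simp_all add: measurable_cong_sets[OF sets_M refl])
  have "dist2 M (\<lambda>x. f x + g x) (\<lambda>x. p x + q x)
      \<le> 2 * dist2 M (\<lambda>x. f x + g x) (\<lambda>x. p x + g x) + 2 * dist2 M (\<lambda>x. p x + g x) (\<lambda>x. p x + q x)"
    by (rule dist2_triangle) measurable
  also have "dist2 M (\<lambda>x. f x + g x) (\<lambda>x. p x + g x) = dist2 M f p" by (simp add: dist2_def)
  also have "dist2 M (\<lambda>x. p x + g x) (\<lambda>x. p x + q x) = dist2 M g q" by (simp add: dist2_def)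
  also have "2 * dist2 M f p + 2 * dist2 M g q < ennreal e" using p(2) q(2) e by (rule ennreal_quarters_add_less)
  finally show "\<exists>p. real_polynomial_function p \<and> dist2 M (\<lambda>x. f x + g x) p < ennreal e"
    using real_polynomial_function.intros(3)[OF p(1) q(1)] by blast
qed

lemma poly_approx_nonneg:
  assumes f: "f \<in> borel_measurable M" "\<And>x. 0 \<le> f x" and fin2: "(\<integral>\<^sup>+ x. ennreal ((f x)\<^sup>2) \<partial>M) < \<infinity>"
  shows "poly_approx M f"
  using f fin2
proof (induction rule: borel_measurable_induct_real)
  case (set A)
  thus ?case by (intro poly_approx_borel)
next
  case (mult u c)
  show ?case
  proof (cases "c = 0")
    case True
    thus ?thesis by (simp add: poly_approx_continuous)
  next
    case False
    note [measurable] = mult(2)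
    have "(\<integral>\<^sup>+ x. ennreal ((c * u x)\<^sup>2) \<partial>M) = ennreal (c\<^sup>2) * (\<integral>\<^sup>+ x. ennreal ((u x)\<^sup>2) \<partial>M)"
      by (simp add: power_mult_distrib ennreal_mult nn_integral_cmult)
    hence "(\<integral>\<^sup>+ x. ennreal ((u x)\<^sup>2) \<partial>M) < \<infinity>"
      using mult.prems False by (auto simp: ennreal_mult_less_top)
    thus ?thesis using mult by (intro poly_approx_cmult) auto
  qed
next
  case (add u v)
  have "(\<integral>\<^sup>+ x. ennreal ((u x)\<^sup>2) \<partial>M) \<le> (\<integral>\<^sup>+ x. ennreal ((v x + u x)\<^sup>2) \<partial>M)"
    "(\<integral>\<^sup>+ x. ennreal ((v x)\<^sup>2) \<partial>M) \<le> (\<integral>\<^sup>+ x. ennreal ((v x + u x)\<^sup>2) \<partial>M)"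
    using add by (auto intro!: nn_integral_mono ennreal_leI power_mono)
  hence "poly_approx M u" "poly_approx M v" using add by (auto intro: le_less_trans)
  thus ?case using add by (intro poly_approx_add) auto
next
  case (seq U)
  have le: "U i x \<le> f x" for i x
    using seq by (intro incseq_le[of "\<lambda>i. U i x"]) (auto simp: incseq_def le_fun_def space_M)
  have "poly_approx M (U i)" for i
  proof (rule seq.IH)
    have "(\<integral>\<^sup>+ x. ennreal ((U i x)\<^sup>2) \<partial>M) \<le> (\<integral>\<^sup>+ x. ennreal ((f x)\<^sup>2) \<partial>M)"
      using le seq by (auto intro!: nn_integral_mono ennreal_leI power_mono)
    thus "(\<integral>\<^sup>+ x. ennreal ((U i x)\<^sup>2) \<partial>M) < \<infinity>" using seq.prems by (rule le_less_trans)
  qed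
  note [measurable] = f(1) seq(1)
  show ?case
  proof (rule poly_approx_limit[where g = U and w = "\<lambda>x. ennreal ((f x)\<^sup>2)"])
    fix i x
    have "0 \<le> U i x" using seq by auto
    thus "ennreal ((f x - U i x)\<^sup>2) \<le> ennreal ((f x)\<^sup>2)"
      using le[of i x] by (intro ennreal_leI power_mono) auto
  qed (use seq \<open>\<And>i. poly_approx M (U i)\<close> space_M in auto)
qed

theorem poly_dense_L2:
  assumes [measurable]: "f \<in> borel_measurable M" and fin2: "(\<integral>\<^sup>+ x. ennreal ((f x)\<^sup>2) \<partial>M) < \<infinity>"
  shows "poly_approx M f"
proof -
  have "(\<integral>\<^sup>+ x. ennreal ((max 0 (f x))\<^sup>2) \<partial>M) \<le> (\<integral>\<^sup>+ x. ennreal ((f x)\<^sup>2) \<partial>M)"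
    "(\<integral>\<^sup>+ x. ennreal ((max 0 (- f x))\<^sup>2) \<partial>M) \<le> (\<integral>\<^sup>+ x. ennreal ((f x)\<^sup>2) \<partial>M)"
    by (auto intro!: nn_integral_mono ennreal_leI simp: max_def)
  hence "poly_approx M (\<lambda>x. max 0 (f x))" "poly_approx M (\<lambda>x. max 0 (- f x))"
    using fin2 by (auto intro!: poly_approx_nonneg elim: le_less_trans)
  hence "poly_approx M (\<lambda>x. max 0 (f x) + (-1) * max 0 (- f x))"
    by (intro poly_approx_add poly_approx_cmult) auto
  moreover have "(\<lambda>x. max 0 (f x) + (-1) * max 0 (- f x)) = f" by (auto simp: max_def)
  ultimately show ?thesis by simp
qed

end

section \<open>Completeness among functions of two coordinates\<close>

context sphere_coords begin

text \<open>
  Stated on the sphere only, since functions on the sphere are represented by functions on the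
  whole space with arbitrary values elsewhere.
\<close>

definition plane_dep :: "(real^'m \<Rightarrow> 'b) \<Rightarrow> bool" where
  "plane_dep u \<longleftrightarrow> (\<forall>x\<in>sphere 0 1. \<forall>y\<in>sphere 0 1. x1 x = x1 y \<longrightarrow> x2 x = x2 y \<longrightarrow> u x = u y)"

text \<open>
  A Borel section of the projection to \<open>(x\<^sub>1, x\<^sub>2)\<close>, used to write a function of \<open>x\<^sub>1\<close> and \<open>x\<^sub>2\<close> on
  the sphere as a Borel function on the disc.
\<close>

definition lift :: "real \<times> real \<Rightarrow> real^'m" where
  "lift p = fst p *\<^sub>R axis (ix 1) 1 + snd p *\<^sub>R axis (ix 2) 1
     + sqrt (1 - (fst p)\<^sup>2 - (snd p)\<^sup>2) *\<^sub>R axis (ix 3) 1"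

lemma lift_coords: "x1 (lift p) = fst p" "x2 (lift p) = snd p"
  using ix12 ix13 ix23 by (simp_all add: lift_def axis_def)

lemma lift_sphere:
  assumes "(fst p)\<^sup>2 + (snd p)\<^sup>2 \<le> 1"
  shows "lift p \<in> sphere 0 1"
proof -
  have "lift p \<bullet> lift p = (fst p)\<^sup>2 + (snd p)\<^sup>2 + (sqrt (1 - (fst p)\<^sup>2 - (snd p)\<^sup>2))\<^sup>2"
    using ix12 ix13 ix23 unfolding lift_def
    by (simp add: inner_add_left inner_add_right inner_axis_axis power2_eq_square)
  also have "\<dots> = 1" using assms by simp
  finally show ?thesis by (simp add: norm_eq_1)
qed

lemma plane_dep_poly_approx:
  fixes u :: "real^'m \<Rightarrow> real"
  assumes u: "u \<in> borel_measurable surf" "(\<integral>\<^sup>+ x. ennreal ((u x)\<^sup>2) \<partial>surf) < \<infinity>"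
    and dep: "plane_dep u" and e: "e > 0"
  shows "\<exists>p. real_polynomial_function p \<and>
    (\<integral>\<^sup>+ x. ennreal ((u x - p (x1 x, x2 x))\<^sup>2) \<partial>surf) < ennreal e"
proof -
  define \<pi> where "\<pi> = (\<lambda>x. (x1 x, x2 x))"
  have \<pi> [measurable]: "\<pi> \<in> measurable surf borel"
    unfolding \<pi>_def by (intro surface_continuous_measurable continuous_intros)
  define \<nu> where "\<nu> = distr surf borel \<pi>"
  define D where "D = {p::real \<times> real. (fst p)\<^sup>2 + (snd p)\<^sup>2 \<le> 1}"
  have D: "D = cball 0 1" by (auto simp: D_def norm_Pair)
  interpret S: finite_measure "surf :: (real^'m) measure" by (rule finite_measure_surface)
  have \<pi>D: "\<pi> x \<in> D" if "x \<in> sphere 0 1" for x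
    using sphere_le_1[OF that] by (simp add: \<pi>_def D_def)
  interpret compact_finite_measure \<nu> D
  proof
    show "sets \<nu> = sets borel" by (simp add: \<nu>_def)
    show "emeasure \<nu> (space \<nu>) \<noteq> \<infinity>"
      unfolding \<nu>_def using S.emeasure_finite by (simp add: emeasure_distr)
    show "compact D" unfolding D by simp
    show "AE x in \<nu>. x \<in> D"
    proof -
      have "{x \<in> space borel. x \<in> D} \<in> sets borel" by (simp add: D)
      moreover have "AE x in surf. \<pi> x \<in> D" using \<pi>D by (intro AE_I2) simp
      ultimately show ?thesis
        unfolding \<nu>_def using AE_distr_iff[OF \<pi>, of "\<lambda>x. x \<in> D"] by simp
    qed
  qed
  define U where "U = (\<lambda>p. if p \<in> D then u (lift p) else 0)"
  have U: "U (\<pi> x) = u x" if x: "x \<in> sphere 0 1" for x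
  proof -
    have "lift (\<pi> x) \<in> sphere 0 1" using \<pi>D[OF x] by (intro lift_sphere) (simp add: D_def)
    thus ?thesis
      using dep x \<pi>D[OF x] lift_coords[of "\<pi> x"]
      unfolding plane_dep_def U_def by (metis \<pi>_def fst_conv snd_conv)
  qed
  have Um: "U \<in> borel_measurable borel"
  proof -
    have c: "continuous_on UNIV lift"
      unfolding lift_def by (intro continuous_intros)
    have "lift \<in> measurable (restrict_space borel D) (restrict_space borel (sphere 0 1))"
      using lift_sphere
      by (intro measurable_restrict_space2 measurable_restrict_space1 borel_measurable_continuous_onI[OF c])
         (auto simp: space_restrict_space D_def)
    hence "lift \<in> measurable (restrict_space borel D) surf"
      by (simp add: measurable_cong_sets[OF refl sets_surface])
    from measurable_compose[OF this u(1)]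
    have m: "(\<lambda>p. u (lift p)) \<in> borel_measurable (restrict_space borel D)" .
    have "{x \<in> space borel. x \<in> D} \<in> sets borel" by (simp add: D)
    moreover have "{x. x \<in> D} = D" by simp
    ultimately show ?thesis unfolding U_def
      using m by (subst measurable_If_restrict_space_iff) simp_all
  qed
  have Um': "U \<in> borel_measurable \<nu>" using Um by (simp add: \<nu>_def)
  have "(\<integral>\<^sup>+ p. ennreal ((U p)\<^sup>2) \<partial>\<nu>) = (\<integral>\<^sup>+ x. ennreal ((U (\<pi> x))\<^sup>2) \<partial>surf)"
    unfolding \<nu>_def using Um by (subst nn_integral_distr) auto
  also have "\<dots> = (\<integral>\<^sup>+ x. ennreal ((u x)\<^sup>2) \<partial>surf)"
    using U by (intro nn_integral_cong) simp
  finally have "poly_approx \<nu> U" using u(2) by (intro poly_dense_L2[OF Um']) simp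
  then obtain p where p: "real_polynomial_function p" "dist2 \<nu> U p < ennreal e"
    using e unfolding poly_approx_def by blast
  have pm: "p \<in> borel_measurable borel" by (rule real_polynomial_measurable[OF p(1)])
  have "dist2 \<nu> U p = (\<integral>\<^sup>+ x. ennreal ((U (\<pi> x) - p (\<pi> x))\<^sup>2) \<partial>surf)"
    unfolding dist2_def \<nu>_def using Um pm by (subst nn_integral_distr) auto
  also have "\<dots> = (\<integral>\<^sup>+ x. ennreal ((u x - p (x1 x, x2 x))\<^sup>2) \<partial>surf)"
    using U by (intro nn_integral_cong) (simp add: \<pi>_def)
  finally show ?thesis using p by auto
qed

text \<open>
  The linear span of the \<open>Z\<^sub>l\<^sup>k\<close> as functions of \<open>(x\<^sub>1, x\<^sub>2)\<close>. It contains all polynomials because it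
  contains \<open>1\<close> and is closed under multiplication by both coordinates.
\<close>

inductive zspan :: "(real \<times> real \<Rightarrow> real) \<Rightarrow> bool" where
  base: "k \<le> l \<Longrightarrow> zspan (\<lambda>z. harm_Z lam l k (fst z) (snd z))"
| zero: "zspan (\<lambda>z. 0)"
| add: "zspan p \<Longrightarrow> zspan q \<Longrightarrow> zspan (\<lambda>z. p z + q z)"
| scale: "zspan p \<Longrightarrow> zspan (\<lambda>z. c * p z)"

lemma zspan_x1: "zspan p \<Longrightarrow> zspan (\<lambda>z. fst z * p z)"
proof (induction rule: zspan.induct)
  case (base k l)
  define m where "m = l - k"
  define \<mu> where "\<mu> = lam + real k"
  let ?c = "2 * (real m + \<mu>)"
  have c: "?c \<noteq> 0" using lam_ge by (simp add: \<mu>_def)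
  have t: "fst z * gegenbauer \<mu> m (fst z) = real (Suc m) / ?c * gegenbauer \<mu> (Suc m) (fst z)
      + (real m + 2 * \<mu> - 1) / ?c * gegenbauer_prev \<mu> m (fst z)" for z :: "real \<times> real"
  proof -
    have h: "a = p / ?c * q + r / ?c * s" if "a * ?c = p * q + r * s" for a p q r s
    proof -
      have "a = a * ?c / ?c" using c by simp
      thus ?thesis unfolding that by (simp add: add_divide_distrib)
    qed
    show ?thesis by (rule h) (use gegenbauer_three_term[of m \<mu> "fst z"] in \<open>simp add: algebra_simps\<close>)
  qed
  have Zl: "harm_Z lam l k (fst z) (snd z) = gegenbauer \<mu> m (fst z) * harm_Q lam k (snd z) (1 - (fst z)\<^sup>2)" for z
    using base by (simp add: harm_Z_def \<mu>_def m_def)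
  have Zs: "harm_Z lam (Suc l) k (fst z) (snd z) = gegenbauer \<mu> (Suc m) (fst z) * harm_Q lam k (snd z) (1 - (fst z)\<^sup>2)" for z
    using base by (simp add: harm_Z_def \<mu>_def m_def Suc_diff_le)
  have a: "zspan (\<lambda>z. real (Suc m) / ?c * harm_Z lam (Suc l) k (fst z) (snd z))"
    using base by (intro zspan.scale zspan.base) simp
  show ?case
  proof (cases m)
    case 0
    have "(\<lambda>z. fst z * harm_Z lam l k (fst z) (snd z)) = (\<lambda>z. real (Suc m) / ?c * harm_Z lam (Suc l) k (fst z) (snd z))"
      unfolding Zl Zs mult.assoc[symmetric] t by (simp add: 0)
    thus ?thesis using a by simp
  next
    case (Suc j)
    hence kl: "k \<le> l - 1" "l - 1 - k = j" using m_def by auto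
    have Zm: "harm_Z lam (l - 1) k (fst z) (snd z) = gegenbauer \<mu> j (fst z) * harm_Q lam k (snd z) (1 - (fst z)\<^sup>2)" for z
      using kl by (simp add: harm_Z_def \<mu>_def)
    have "(\<lambda>z. fst z * harm_Z lam l k (fst z) (snd z)) = (\<lambda>z. real (Suc m) / ?c * harm_Z lam (Suc l) k (fst z) (snd z)
        + (real m + 2 * \<mu> - 1) / ?c * harm_Z lam (l - 1) k (fst z) (snd z))"
      unfolding Zl Zs mult.assoc[symmetric] t Zm
      by (simp only: Suc gegenbauer_prev_simps ring_distribs mult.assoc)
    moreover have "zspan \<dots>" using kl by (intro zspan.add a zspan.scale zspan.base)
    ultimately show ?thesis by simp
  qed
next
  case zero thus ?case using zspan.zero by simp
next
  case (add p q) thus ?case using zspan.add[of "\<lambda>z. fst z * p z" "\<lambda>z. fst z * q z"] by (simp add: ring_distribs)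
next
  case (scale p c) thus ?case using zspan.scale[of "\<lambda>z. fst z * p z" c] by (simp add: mult.left_commute)
qed

lemma zspan_gegenbauer: "zspan p \<Longrightarrow> zspan (\<lambda>z. gegenbauer \<mu> m (fst z) * p z)"
proof (induction m rule: less_induct)
  case (less m)
  show ?case
  proof (cases m)
    case 0 thus ?thesis using less.prems by simp
  next
    case (Suc j)
    have a: "zspan (\<lambda>z. fst z * (gegenbauer \<mu> j (fst z) * p z))"
      using less Suc by (intro zspan_x1) simp
    have b: "zspan (\<lambda>z. gegenbauer_prev \<mu> j (fst z) * p z)"
      using less Suc zspan.zero by (cases j) simp_all
    have "gegenbauer \<mu> m (fst z) * p z = 2 * (real j + \<mu>) / real (Suc j) * (fst z * (gegenbauer \<mu> j (fst z) * p z))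
       + (- (real j + 2 * \<mu> - 1) / real (Suc j)) * (gegenbauer_prev \<mu> j (fst z) * p z)" for z :: "real \<times> real"
    proof -
      have "gegenbauer \<mu> m (fst z) = (2 * (real j + \<mu>) * fst z * gegenbauer \<mu> j (fst z)
          - (real j + 2 * \<mu> - 1) * gegenbauer_prev \<mu> j (fst z)) / real (Suc j)"
        unfolding Suc gegenbauer_three_term[symmetric] by simp
      thus ?thesis by (simp add: diff_divide_distrib ring_distribs mult_ac)
    qed
    thus ?thesis using zspan.add[OF zspan.scale[OF a] zspan.scale[OF b]] by (simp only:)
  qed
qed

text \<open>
  The factor \<open>C\<^sub>l\<^sub>-\<^sub>k\<close> is a polynomial in \<open>x\<^sub>1\<close>, so it suffices to treat
  \<open>x\<^sub>2 Q\<^sub>k = u\<^sub>k Q\<^sub>k\<^sub>+\<^sub>1 + v\<^sub>k (1 - x\<^sub>1\<^sup>2) Q\<^sub>k\<^sub>-\<^sub>1\<close>, where each \<open>Q\<^sub>j\<close> is \<open>Z\<^sub>j\<^sup>j\<close>.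
\<close>

lemma zspan_x2: "zspan p \<Longrightarrow> zspan (\<lambda>z. snd z * p z)"
proof (induction rule: zspan.induct)
  case (base k l)
  let ?Q = "\<lambda>k (z::real \<times> real). harm_Q lam k (snd z) (1 - (fst z)\<^sup>2)"
  have Q: "zspan (?Q k)" for k
    using zspan.base[of k k] by (simp add: harm_Z_def)
  have "zspan (\<lambda>z. ?Q (k - 1) z + (-1) * (fst z * (fst z * ?Q (k - 1) z)))"
    by (intro zspan.add zspan.scale zspan_x1 Q)
  from zspan.add[OF zspan.scale[OF Q[of "Suc k"], of "harm_u lam k"] zspan.scale[OF this, of "harm_v lam k"]]
  have "zspan (\<lambda>z. harm_u lam k * ?Q (Suc k) z
      + harm_v lam k * (?Q (k - 1) z + (-1) * (fst z * (fst z * ?Q (k - 1) z))))" .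
  hence "zspan (\<lambda>z. gegenbauer (lam + real k) (l - k) (fst z) * (harm_u lam k * ?Q (Suc k) z
      + harm_v lam k * (?Q (k - 1) z + (-1) * (fst z * (fst z * ?Q (k - 1) z)))))"
    by (rule zspan_gegenbauer)
  moreover have "snd z * harm_Z lam l k (fst z) (snd z)
     = gegenbauer (lam + real k) (l - k) (fst z) * (harm_u lam k * ?Q (Suc k) z
      + harm_v lam k * (?Q (k - 1) z + (-1) * (fst z * (fst z * ?Q (k - 1) z))))" for z
  proof -
    have "snd z * harm_Z lam l k (fst z) (snd z)
      = gegenbauer (lam + real k) (l - k) (fst z) * (snd z * ?Q k z)"
      using base by (simp add: harm_Z_def)
    also have "snd z * ?Q k z = harm_u lam k * ?Q (Suc k) z + harm_v lam k * (1 - (fst z)\<^sup>2) * ?Q (k - 1) z"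
      by (rule harm_Q_mult[OF lam_ge])
    finally show ?thesis by (simp add: algebra_simps power2_eq_square)
  qed
  ultimately show ?case by simp
next
  case zero thus ?case using zspan.zero by simp
next
  case (add p q) thus ?case using zspan.add[of "\<lambda>z. snd z * p z" "\<lambda>z. snd z * q z"] by (simp add: ring_distribs)
next
  case (scale p c) thus ?case using zspan.scale[of "\<lambda>z. snd z * p z" c] by (simp add: mult.left_commute)
qed

lemma zspan_polynomial_mult:
  assumes "real_polynomial_function P"
  shows "zspan q \<Longrightarrow> zspan (\<lambda>z. P z * q z)"
  using assms
proof (induction P arbitrary: q rule: real_polynomial_function.induct)
  case (linear P)
  have P: "P z = P (1, 0) * fst z + P (0, 1) * snd z" for z
  proof -
    have lP: "linear P" using linear(1) by (rule bounded_linear.linear)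
    have "P (fst z *\<^sub>R (1, 0) + snd z *\<^sub>R (0, 1)) = fst z *\<^sub>R P (1, 0) + snd z *\<^sub>R P (0, 1)"
      by (simp only: linear_add[OF lP] linear_cmul[OF lP])
    moreover have "fst z *\<^sub>R (1, 0) + snd z *\<^sub>R (0, 1) = z" by (cases z) simp
    ultimately show ?thesis unfolding real_scaleR_def by (metis mult.commute)
  qed
  have "zspan (\<lambda>z. P (1, 0) * (fst z * q z) + P (0, 1) * (snd z * q z))"
    by (rule zspan.add[OF zspan.scale[OF zspan_x1[OF linear(2)]] zspan.scale[OF zspan_x2[OF linear(2)]]])
  moreover have "P z * q z = P (1, 0) * (fst z * q z) + P (0, 1) * (snd z * q z)" for z
    by (subst P) (simp only: ring_distribs mult.assoc)
  ultimately show ?case by (simp only:)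
next
  case (const c) thus ?case by (rule zspan.scale)
next
  case (add f g)
  have "zspan (\<lambda>z. f z * q z + g z * q z)"
    by (rule zspan.add[OF add.IH(1)[OF add.prems] add.IH(2)[OF add.prems]])
  thus ?case by (simp only: ring_distribs)
next
  case (mult f g)
  have "zspan (\<lambda>z. f z * (g z * q z))"
    by (rule mult.IH(1)[OF mult.IH(2)[OF mult.prems]])
  thus ?case by (simp only: mult.assoc)
qed

definition idx :: "nat \<Rightarrow> (nat \<times> nat) set" where
  "idx N = (SIGMA l:{..<N}. {..l})"

lemma finite_idx [simp]: "finite (idx N)" by (simp add: idx_def)

lemma idx_mono: "N \<le> M \<Longrightarrow> idx N \<subseteq> idx M" by (auto simp: idx_def)

lemma sum_idx: "(\<Sum>p\<in>idx N. F (fst p) (snd p)) = (\<Sum>l<N. \<Sum>k\<le>l. F l k)"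
  unfolding idx_def by (subst sum.Sigma) (auto simp: case_prod_beta)

abbreviation Zp :: "nat \<times> nat \<Rightarrow> real^'m \<Rightarrow> real" where
  "Zp p \<equiv> Z (fst p) (snd p)"

lemma zspan_expand:
  "zspan q \<Longrightarrow> \<exists>N d. \<forall>z. q z = (\<Sum>p\<in>idx N. d p * harm_Z lam (fst p) (snd p) (fst z) (snd z))"
proof (induction rule: zspan.induct)
  case (base k l)
  have "(l, k) \<in> idx (Suc l)" using base by (simp add: idx_def)
  hence "\<forall>z. harm_Z lam l k (fst z) (snd z)
     = (\<Sum>p\<in>idx (Suc l). (if p = (l, k) then 1 else 0) * harm_Z lam (fst p) (snd p) (fst z) (snd z))"
    by (simp add: if_distrib[of "\<lambda>c. c * _"] cong: if_cong)
  thus ?case by (intro exI)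
next
  case zero
  show ?case by (intro exI[of _ 0] exI[of _ "\<lambda>_. 0"]) simp
next
  case (add q r)
  then obtain N d M e where q: "\<And>z. q z = (\<Sum>p\<in>idx N. d p * harm_Z lam (fst p) (snd p) (fst z) (snd z))"
    and r: "\<And>z. r z = (\<Sum>p\<in>idx M. e p * harm_Z lam (fst p) (snd p) (fst z) (snd z))" by blast
  have ext: "(\<Sum>p\<in>idx N. d p * G p) = (\<Sum>p\<in>idx (max N M). (if p \<in> idx N then d p else 0) * G p)"
    "(\<Sum>p\<in>idx M. e p * G p) = (\<Sum>p\<in>idx (max N M). (if p \<in> idx M then e p else 0) * G p)" for G :: "nat \<times> nat \<Rightarrow> real"
    using idx_mono[of N "max N M"] idx_mono[of M "max N M"]
    by (auto intro!: sum.mono_neutral_cong_left)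
  have "\<forall>z. q z + r z = (\<Sum>p\<in>idx (max N M). ((if p \<in> idx N then d p else 0) + (if p \<in> idx M then e p else 0))
      * harm_Z lam (fst p) (snd p) (fst z) (snd z))"
    unfolding q r ext by (simp only: sum.distrib[symmetric] ring_distribs) simp
  thus ?case by (intro exI)
next
  case (scale q c)
  then obtain N d where q: "\<And>z. q z = (\<Sum>p\<in>idx N. d p * harm_Z lam (fst p) (snd p) (fst z) (snd z))" by blast
  have "\<forall>z. c * q z = (\<Sum>p\<in>idx N. (c * d p) * harm_Z lam (fst p) (snd p) (fst z) (snd z))"
    unfolding q by (simp add: sum_distrib_left mult.assoc)
  thus ?case by (intro exI)
qed

lemma plane_dep_span_approx:
  fixes u :: "real^'m \<Rightarrow> real"
  assumes u: "u \<in> borel_measurable surf" "(\<integral>\<^sup>+ x. ennreal ((u x)\<^sup>2) \<partial>surf) < \<infinity>"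
    and dep: "plane_dep u" and e: "e > 0"
  shows "\<exists>N d. (\<integral>\<^sup>+ x. ennreal ((u x - (\<Sum>p\<in>idx N. d p * Zp p x))\<^sup>2) \<partial>surf) < ennreal e"
proof -
  obtain P where P: "real_polynomial_function P"
    "(\<integral>\<^sup>+ x. ennreal ((u x - P (x1 x, x2 x))\<^sup>2) \<partial>surf) < ennreal e"
    using plane_dep_poly_approx[OF assms] by blast
  have "zspan (\<lambda>z. 1)" using zspan.base[of 0 0] by (simp add: harm_Z_def)
  from zspan_expand[OF zspan_polynomial_mult[OF P(1) this]]
  obtain N d where Nd: "\<forall>z. P z * 1 = (\<Sum>p\<in>idx N. d p * harm_Z lam (fst p) (snd p) (fst z) (snd z))"
    by blast
  have "P (x1 x, x2 x) = (\<Sum>p\<in>idx N. d p * Zp p x)" for x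
    using spec[OF Nd, of "(x1 x, x2 x)"] by simp
  thus ?thesis using P(2) by (simp only:) (intro exI)
qed

lemma integrable_cont_mult:
  fixes h p :: "real^'m \<Rightarrow> real"
  assumes "continuous_on UNIV p" "integrable surf h"
  shows "integrable surf (\<lambda>x. p x * h x)"
  using surface_integrable_continuous_mult[of "\<lambda>x. complex_of_real (p x)" "\<lambda>x. complex_of_real (h x)"] assms
  by (simp add: complex_of_real_integrable_eq continuous_on_of_real flip: of_real_mult)

lemma square_integrable_imp_integrable:
  fixes u :: "real^'m \<Rightarrow> real"
  assumes [measurable]: "u \<in> borel_measurable surf" and sq: "integrable surf (\<lambda>x. (u x)\<^sup>2)"
  shows "integrable surf u"
proof (rule Bochner_Integration.integrable_bound)
  interpret S: finite_measure "surf :: (real^'m) measure" by (rule finite_measure_surface)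
  show "integrable surf (\<lambda>x. 1 + (u x)\<^sup>2)" using sq by simp
  show "AE x in surf. norm (u x) \<le> norm (1 + (u x)\<^sup>2)"
  proof (rule AE_I2)
    fix x :: "real^'m"
    have "0 \<le> (\<bar>u x\<bar> - 1)\<^sup>2" by simp
    also have "(\<bar>u x\<bar> - 1)\<^sup>2 = (u x)\<^sup>2 + 1 - 2 * \<bar>u x\<bar>" by (simp add: power2_diff)
    finally show "norm (u x) \<le> norm (1 + (u x)\<^sup>2)" by simp
  qed
qed measurable

lemma integrable_square_diff:
  fixes u h :: "real^'m \<Rightarrow> real"
  assumes [measurable]: "u \<in> borel_measurable surf" and sq: "integrable surf (\<lambda>x. (u x)\<^sup>2)"
    and h: "continuous_on UNIV h"
  shows "integrable surf (\<lambda>x. (u x - h x)\<^sup>2)"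
proof -
  have "integrable surf u" by (rule square_integrable_imp_integrable[OF assms(1) sq])
  hence hu: "integrable surf (\<lambda>x. h x * u x)" by (rule integrable_cont_mult[OF h])
  have hh: "integrable surf (\<lambda>x. (h x)\<^sup>2)"
    using h by (intro integrable_cont_real continuous_intros)
  have "integrable surf (\<lambda>x. (u x)\<^sup>2 - 2 * (h x * u x) + (h x)\<^sup>2)"
    using sq hu hh by simp
  thus ?thesis by (simp add: power2_diff algebra_simps)
qed

text \<open>
  The remainder \<open>r\<close> of the orthogonal projection is orthogonal to every \<open>Z\<close> involved, hence to the
  difference \<open>s\<close> of the two combinations, and \<open>\<integral> (r + s)\<^sup>2 = \<integral> r\<^sup>2 + \<integral> s\<^sup>2\<close>.
\<close>

lemma projection_minimal:
  fixes u :: "real^'m \<Rightarrow> real"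
  assumes um: "u \<in> borel_measurable surf" and sq: "integrable surf (\<lambda>x. (u x)\<^sup>2)"
  defines "c \<equiv> (\<lambda>p. (LINT x|surf. Zp p x * u x) / nrm (fst p) (snd p))"
  shows "(LINT x|surf. (u x - (\<Sum>p\<in>idx N. c p * Zp p x))\<^sup>2)
     \<le> (LINT x|surf. (u x - (\<Sum>p\<in>idx N. d p * Zp p x))\<^sup>2)"
proof -
  define r where "r = (\<lambda>x. u x - (\<Sum>p\<in>idx N. c p * Zp p x))"
  define s where "s = (\<lambda>x. \<Sum>p\<in>idx N. (c p - d p) * Zp p x)"
  have iu: "integrable surf u" by (rule square_integrable_imp_integrable[OF um sq])
  have iZu: "integrable surf (\<lambda>x. Zp p x * u x)" for p
    by (rule integrable_cont_mult[OF _ iu]) (intro cont_intros)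
  have r: "integrable surf (\<lambda>x. (r x)\<^sup>2)"
    unfolding r_def by (rule integrable_square_diff[OF um sq]) (intro cont_intros)
  have iZr: "integrable surf (\<lambda>x. Zp p x * r x)" for p
    unfolding r_def right_diff_distrib
    by (intro Bochner_Integration.integrable_diff iZu integrable_cont_real cont_intros)
  have orth: "(LINT x|surf. Zp p x * r x) = 0" if p: "p \<in> idx N" for p
  proof -
    have "Zp p x * r x = Zp p x * u x - (\<Sum>q\<in>idx N. c q * (Zp p x * Zp q x))" for x
      by (simp add: r_def right_diff_distrib sum_distrib_left mult.left_commute)
    hence "(LINT x|surf. Zp p x * r x) = (LINT x|surf. Zp p x * u x)
        - (\<Sum>q\<in>idx N. c q * ip (fst p) (snd p) (fst q) (snd q))"
      unfolding ip_def using iZu integrable_ZZ by simp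
    also have "(\<Sum>q\<in>idx N. c q * ip (fst p) (snd p) (fst q) (snd q))
        = (\<Sum>q\<in>idx N. if q = p then c p * nrm (fst p) (snd p) else 0)"
    proof (intro sum.cong refl)
      fix q assume q: "q \<in> idx N"
      show "c q * ip (fst p) (snd p) (fst q) (snd q) = (if q = p then c p * nrm (fst p) (snd p) else 0)"
      proof (cases "q = p")
        case False
        have "ip (fst p) (snd p) (fst q) (snd q) = 0"
          using p q False by (intro ip_orthogonal) (auto simp: idx_def prod_eq_iff)
        thus ?thesis using False by simp
      qed (simp add: nrm_def)
    qed
    also have "\<dots> = c p * nrm (fst p) (snd p)" using p by simp
    also have "\<dots> = (LINT x|surf. Zp p x * u x)"
      using nrm_pos[of "snd p" "fst p"] p by (auto simp: c_def idx_def)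
    finally show ?thesis by simp
  qed
  have rs: "r x * s x = (\<Sum>p\<in>idx N. (c p - d p) * (Zp p x * r x))" for x
    by (simp add: s_def sum_distrib_left mult_ac)
  have irs: "integrable surf (\<lambda>x. r x * s x)"
    unfolding rs using iZr by (intro Bochner_Integration.integrable_sum integrable_mult_right)
  have "(LINT x|surf. r x * s x) = 0"
    unfolding rs using iZr orth by simp
  have is2: "integrable surf (\<lambda>x. (s x)\<^sup>2)"
    unfolding s_def by (intro integrable_cont_real cont_intros)
  have "(u x - (\<Sum>p\<in>idx N. d p * Zp p x))\<^sup>2 = (r x)\<^sup>2 + 2 * (r x * s x) + (s x)\<^sup>2" for x
  proof -
    have "u x - (\<Sum>p\<in>idx N. d p * Zp p x) = r x + s x"
      by (simp add: r_def s_def left_diff_distrib sum_subtractf)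
    thus ?thesis by (simp add: power2_sum)
  qed
  hence "(LINT x|surf. (u x - (\<Sum>p\<in>idx N. d p * Zp p x))\<^sup>2)
      = (LINT x|surf. (r x)\<^sup>2) + 2 * (LINT x|surf. r x * s x) + (LINT x|surf. (s x)\<^sup>2)"
    using r irs is2 by simp
  also have "\<dots> \<ge> (LINT x|surf. (r x)\<^sup>2)"
    using \<open>(LINT x|surf. r x * s x) = 0\<close> by simp
  finally show ?thesis unfolding r_def .
qed

text \<open>
  Any single approximation by a combination of finitely many \<open>Z\<^sub>l\<^sup>k\<close> is beaten by all later partial
  sums.
\<close>

lemma projection_converges_real:
  fixes u :: "real^'m \<Rightarrow> real"
  assumes um: "u \<in> borel_measurable surf" and sq: "integrable surf (\<lambda>x. (u x)\<^sup>2)"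
    and dep: "plane_dep u"
  defines "c \<equiv> (\<lambda>p. (LINT x|surf. Zp p x * u x) / nrm (fst p) (snd p))"
  shows "(\<lambda>N. LINT x|surf. (u x - (\<Sum>p\<in>idx N. c p * Zp p x))\<^sup>2) \<longlonglongrightarrow> 0"
proof (rule LIMSEQ_I)
  fix e :: real assume e: "e > 0"
  have nn: "(\<integral>\<^sup>+ x. ennreal ((u x - (\<Sum>p\<in>idx N. d p * Zp p x))\<^sup>2) \<partial>surf)
      = ennreal (LINT x|surf. (u x - (\<Sum>p\<in>idx N. d p * Zp p x))\<^sup>2)" for N d
    by (rule nn_integral_eq_integral[OF integrable_square_diff[OF um sq]]) (intro cont_intros, simp)
  have "(\<integral>\<^sup>+ x. ennreal ((u x)\<^sup>2) \<partial>surf) < \<infinity>"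
    using sq by (simp add: nn_integral_eq_integral)
  from plane_dep_span_approx[OF um this dep e] obtain N d where
    "(\<integral>\<^sup>+ x. ennreal ((u x - (\<Sum>p\<in>idx N. d p * Zp p x))\<^sup>2) \<partial>surf) < ennreal e" by blast
  hence Nd: "(LINT x|surf. (u x - (\<Sum>p\<in>idx N. d p * Zp p x))\<^sup>2) < e"
    using e by (simp add: nn ennreal_less_iff)
  have "norm ((LINT x|surf. (u x - (\<Sum>p\<in>idx M. c p * Zp p x))\<^sup>2) - 0) < e" if "M \<ge> N" for M
  proof -
    have "(\<Sum>p\<in>idx N. d p * G p) = (\<Sum>p\<in>idx M. (if p \<in> idx N then d p else 0) * G p)" for G :: "nat \<times> nat \<Rightarrow> real"
      using idx_mono[OF that] by (auto intro!: sum.mono_neutral_cong_left)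
    hence "(LINT x|surf. (u x - (\<Sum>p\<in>idx M. c p * Zp p x))\<^sup>2) < e"
      using projection_minimal[OF um sq, of M "\<lambda>p. if p \<in> idx N then d p else 0"] Nd
      unfolding c_def by simp
    thus ?thesis by (simp add: Bochner_Integration.integral_nonneg)
  qed
  thus "\<exists>no. \<forall>n\<ge>no. norm ((LINT x|surf. (u x - (\<Sum>p\<in>idx n. c p * Zp p x))\<^sup>2) - 0) < e" by blast
qed

definition zcoef :: "nat \<Rightarrow> nat \<Rightarrow> (real^'m \<Rightarrow> complex) \<Rightarrow> complex" where
  "zcoef l k u = (LINT x|surf. of_real (Z l k x) * u x)"

lemma sph_square_integrable_integrable:
  fixes u :: "real^'m \<Rightarrow> complex"
  assumes "sph_square_integrable u" shows "integrable surf u"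
proof -
  have [measurable]: "u \<in> borel_measurable surf" and sq: "integrable surf (\<lambda>x. (cmod (u x))\<^sup>2)"
    using assms by (auto simp: sph_square_integrable_def)
  have "integrable surf (\<lambda>x. cmod (u x))"
    by (rule square_integrable_imp_integrable[OF _ sq]) measurable
  thus ?thesis by (rule integrable_norm_cancel) measurable
qed

lemma integrable_Zu:
  fixes u :: "real^'m \<Rightarrow> complex"
  assumes "sph_square_integrable u" shows "integrable surf (\<lambda>x. of_real (Z l k x) * u x)"
  by (rule surface_integrable_continuous_mult[OF _ sph_square_integrable_integrable[OF assms]])
     (intro cont_intros)

text \<open>
  Completeness of the \<open>Z\<^sub>l\<^sup>k\<close> among the square integrable functions of \<open>x\<^sub>1\<close> and \<open>x\<^sub>2\<close>; the real and
  the imaginary part are treated separately.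
\<close>

theorem plane_dep_expansion:
  fixes u :: "real^'m \<Rightarrow> complex"
  assumes u: "sph_square_integrable u" and dep: "plane_dep u"
  shows "sph_L2_sums (\<lambda>l x. \<Sum>k\<le>l. zcoef l k u / of_real (nrm l k) * of_real (Z l k x)) u"
proof -
  have [measurable]: "u \<in> borel_measurable surf" and sq: "integrable surf (\<lambda>x. (cmod (u x))\<^sup>2)"
    using u by (auto simp: sph_square_integrable_def)
  have sqR: "integrable surf (\<lambda>x. (Re (u x))\<^sup>2)" and sqI: "integrable surf (\<lambda>x. (Im (u x))\<^sup>2)"
    by (rule Bochner_Integration.integrable_bound[OF sq]; simp add: cmod_power2)+
  have depR: "plane_dep (\<lambda>x. Re (u x))" and depI: "plane_dep (\<lambda>x. Im (u x))"
    using dep unfolding plane_dep_def by metis+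
  define cR where "cR = (\<lambda>p. (LINT x|surf. Zp p x * Re (u x)) / nrm (fst p) (snd p))"
  define cI where "cI = (\<lambda>p. (LINT x|surf. Zp p x * Im (u x)) / nrm (fst p) (snd p))"
  have mR: "(\<lambda>x. Re (u x)) \<in> borel_measurable surf" and mI: "(\<lambda>x. Im (u x)) \<in> borel_measurable surf"
    by measurable
  have limR: "(\<lambda>N. LINT x|surf. (Re (u x) - (\<Sum>p\<in>idx N. cR p * Zp p x))\<^sup>2) \<longlonglongrightarrow> 0"
    unfolding cR_def by (rule projection_converges_real[OF mR sqR depR])
  have limI: "(\<lambda>N. LINT x|surf. (Im (u x) - (\<Sum>p\<in>idx N. cI p * Zp p x))\<^sup>2) \<longlonglongrightarrow> 0"
    unfolding cI_def by (rule projection_converges_real[OF mI sqI depI])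
  define S where "S = (\<lambda>N x. \<Sum>l<N. \<Sum>k\<le>l. zcoef l k u / of_real (nrm l k) * of_real (Z l k x))"
  have coef: "zcoef (fst p) (snd p) u / of_real (nrm (fst p) (snd p)) = Complex (cR p) (cI p)" for p
  proof -
    have "Re (zcoef (fst p) (snd p) u) = (LINT x|surf. Zp p x * Re (u x))"
      "Im (zcoef (fst p) (snd p) u) = (LINT x|surf. Zp p x * Im (u x))"
      unfolding zcoef_def integral_Re[OF integrable_Zu[OF u], symmetric] integral_Im[OF integrable_Zu[OF u], symmetric]
      by simp_all
    thus ?thesis by (simp add: complex_eq_iff cR_def cI_def)
  qed
  have S: "Re (S N x) = (\<Sum>p\<in>idx N. cR p * Zp p x)" "Im (S N x) = (\<Sum>p\<in>idx N. cI p * Zp p x)" for N x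
  proof -
    have "S N x = (\<Sum>p\<in>idx N. Complex (cR p) (cI p) * of_real (Zp p x))"
      unfolding S_def sum_idx[symmetric] coef ..
    thus "Re (S N x) = (\<Sum>p\<in>idx N. cR p * Zp p x)" "Im (S N x) = (\<Sum>p\<in>idx N. cI p * Zp p x)"
      by simp_all
  qed
  have eq: "(\<integral>\<^sup>+ x. ennreal ((cmod (u x - S N x))\<^sup>2) \<partial>surf)
     = ennreal ((LINT x|surf. (Re (u x) - (\<Sum>p\<in>idx N. cR p * Zp p x))\<^sup>2)
         + (LINT x|surf. (Im (u x) - (\<Sum>p\<in>idx N. cI p * Zp p x))\<^sup>2))" for N
  proof -
    have iR: "integrable surf (\<lambda>x. (Re (u x) - (\<Sum>p\<in>idx N. cR p * Zp p x))\<^sup>2)"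
      by (rule integrable_square_diff[OF mR sqR]) (intro cont_intros)
    have iI: "integrable surf (\<lambda>x. (Im (u x) - (\<Sum>p\<in>idx N. cI p * Zp p x))\<^sup>2)"
      by (rule integrable_square_diff[OF mI sqI]) (intro cont_intros)
    have "(\<integral>\<^sup>+ x. ennreal ((cmod (u x - S N x))\<^sup>2) \<partial>surf)
       = (\<integral>\<^sup>+ x. ennreal ((Re (u x) - (\<Sum>p\<in>idx N. cR p * Zp p x))\<^sup>2
           + (Im (u x) - (\<Sum>p\<in>idx N. cI p * Zp p x))\<^sup>2) \<partial>surf)"
      by (simp add: cmod_power2 S)
    also have "\<dots> = ennreal (LINT x|surf. (Re (u x) - (\<Sum>p\<in>idx N. cR p * Zp p x))\<^sup>2
           + (Im (u x) - (\<Sum>p\<in>idx N. cI p * Zp p x))\<^sup>2)"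
      using iR iI by (intro nn_integral_eq_integral) auto
    finally show ?thesis using iR iI by simp
  qed
  have "(\<lambda>N. (LINT x|surf. (Re (u x) - (\<Sum>p\<in>idx N. cR p * Zp p x))\<^sup>2)
         + (LINT x|surf. (Im (u x) - (\<Sum>p\<in>idx N. cI p * Zp p x))\<^sup>2)) \<longlonglongrightarrow> 0"
    using tendsto_add[OF limR limI] by simp
  from tendsto_ennrealI[OF this]
  have "(\<lambda>N. \<integral>\<^sup>+ x. ennreal ((cmod (u x - S N x))\<^sup>2) \<partial>surf) \<longlonglongrightarrow> 0"
    unfolding eq by simp
  thus ?thesis unfolding sph_L2_sums_def S_def .
qed

end

section \<open>Identification with the hyperspherical harmonics\<close>

text \<open>
  Connects \<open>Q\<^sub>k\<close> with the factor \<open>sin\<^sup>k \<theta>\<^sub>1 C\<^sub>k\<^sup>\<lambda>\<^sup>-\<^sup>1\<^sup>/\<^sup>2(cos \<theta>\<^sub>2)\<close> of the harmonics for \<open>n \<ge> 3\<close>. Only the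
  positivity of the constant matters, as it disappears in the normalization.
\<close>

lemma gegenbauer_homogeneous:
  assumes "\<nu> > 0"
  shows "s ^ k * gegenbauer \<nu> k c = gegenbauer \<nu> k 1 * harm_Q (\<nu> + 1/2) k (s * c) (s\<^sup>2)"
    and "gegenbauer \<nu> k 1 > 0"
proof -
  have step: "real (Suc k) * gegenbauer \<nu> (Suc k) 1 = (real k + 2 * \<nu>) * gegenbauer \<nu> k 1" for k
    using gegenbauer_first_order[of \<nu> 1 "Suc k"] by simp
  have pos: "gegenbauer \<nu> k 1 > 0" for k
  proof (induction k)
    case (Suc k)
    have "real (Suc k) * gegenbauer \<nu> (Suc k) 1 > 0"
      unfolding step using Suc assms by (intro mult_pos_pos) auto
    thus ?case by (simp only: zero_less_mult_iff) simp
  qed simp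
  show "gegenbauer \<nu> k 1 > 0" by (rule pos)
  show "s ^ k * gegenbauer \<nu> k c = gegenbauer \<nu> k 1 * harm_Q (\<nu> + 1/2) k (s * c) (s\<^sup>2)"
  proof (induction k rule: less_induct)
    case (less k)
    consider "k = 0" | "k = 1" | j where "k = Suc (Suc j)" by (metis One_nat_def not0_implies_Suc)
    thus ?case
    proof cases
      case 2
      thus ?thesis using gegenbauer_three_term[of 0 \<nu> c] gegenbauer_three_term[of 0 \<nu> 1] by (simp add: One_nat_def)
    next
      case 3
      let ?g = "\<lambda>k. gegenbauer \<nu> k 1"
      let ?Q = "\<lambda>k. harm_Q (\<nu> + 1/2) k (s * c) (s\<^sup>2)"
      let ?m = "Suc j"
      define D where "D = 2 * (real ?m + \<nu>)"
      have D: "D \<noteq> 0" using assms by (simp add: D_def)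
      have lam: "\<nu> + 1/2 \<ge> 1/2" using assms by simp
      have v: "D * harm_v (\<nu> + 1/2) ?m = real ?m" and u: "D * harm_u (\<nu> + 1/2) ?m = real ?m + 2 * \<nu>"
      proof -
        have d: "2 * real ?m + 2 * (\<nu> + 1/2) - 1 = D" "real ?m + 2 * (\<nu> + 1/2) - 1 = real ?m + 2 * \<nu>"
          by (simp_all add: D_def)
        show "D * harm_v (\<nu> + 1/2) ?m = real ?m" "D * harm_u (\<nu> + 1/2) ?m = real ?m + 2 * \<nu>"
          unfolding harm_v_def harm_u_def d using D by simp_all
      qed
      have q: "D * (s * c * ?Q ?m) = (real ?m + 2 * \<nu>) * ?Q (Suc ?m) + real ?m * s\<^sup>2 * ?Q j"
      proof -
        have "D * (s * c * ?Q ?m) = (D * harm_u (\<nu> + 1/2) ?m) * ?Q (Suc ?m)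
            + (D * harm_v (\<nu> + 1/2) ?m) * s\<^sup>2 * ?Q j"
          using harm_Q_mult[OF lam, of "s * c" ?m "s\<^sup>2"]
          by (simp only: ring_distribs mult.assoc diff_Suc_1)
        thus ?thesis by (simp only: u v)
      qed
      have "real (Suc ?m) * (s ^ Suc ?m * gegenbauer \<nu> (Suc ?m) c)
          = s ^ Suc ?m * (real (Suc ?m) * gegenbauer \<nu> (Suc ?m) c)" by (simp only: mult_ac)
      also have "\<dots> = s ^ Suc ?m * (D * c * gegenbauer \<nu> ?m c - (real j + 2 * \<nu>) * gegenbauer \<nu> j c)"
        unfolding gegenbauer_three_term by (simp add: D_def)
      also have "\<dots> = D * (s * c) * (s ^ ?m * gegenbauer \<nu> ?m c) - (real j + 2 * \<nu>) * s\<^sup>2 * (s ^ j * gegenbauer \<nu> j c)"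
        by (simp add: algebra_simps power2_eq_square)
      also have "\<dots> = ?g ?m * (D * (s * c * ?Q ?m)) - ((real j + 2 * \<nu>) * ?g j) * s\<^sup>2 * ?Q j"
        using less[of ?m] less[of j] 3 by (simp add: mult_ac)
      also have "\<dots> = ((real ?m + 2 * \<nu>) * ?g ?m) * ?Q (Suc ?m)"
        unfolding q step[of j, symmetric] by (simp add: algebra_simps del: harm_Q.simps)
      also have "\<dots> = real (Suc ?m) * (?g (Suc ?m) * ?Q (Suc ?m))"
        unfolding step[symmetric] by (simp only: mult_ac)
      finally show ?thesis using 3 by (simp only: mult_cancel_left of_nat_eq_0_iff nat.distinct simp_thms)
    qed simp
  qed
qed

text \<open>
  Connects \<open>Q\<^sub>k\<close> with the harmonics for \<open>n = 2\<close>: both sides satisfy the recursion coming from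
  \<open>w\<^sup>2 = 2 Re(w) w - |w|\<^sup>2\<close>.
\<close>

lemma harm_Q_half_Re_power: "harm_Q (1/2) k (Re w) ((cmod w)\<^sup>2) = Re (w ^ k)"
proof (induction k rule: less_induct)
  case (less k)
  consider "k = 0" | "k = 1" | j where "k = Suc (Suc j)" by (metis One_nat_def not0_implies_Suc)
  thus ?case
  proof cases
    case 3
    have w2: "w * w = 2 * of_real (Re w) * w - of_real ((cmod w)\<^sup>2)"
      by (simp add: complex_eq_iff cmod_power2; simp add: power2_eq_square)
    have "w ^ k = (w * w) * w ^ j" using 3 by simp
    also have "\<dots> = of_real (2 * Re w) * w ^ Suc j - of_real ((cmod w)\<^sup>2) * w ^ j"
      unfolding w2 by (simp add: algebra_simps)
    finally have Rk: "Re (w ^ k) = 2 * Re w * Re (w ^ Suc j) - (cmod w)\<^sup>2 * Re (w ^ j)"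
      by (simp only: minus_complex.simps Re_complex_of_real times_complex.simps Im_complex_of_real
          mult_zero_left diff_0_right)
    have uv: "harm_u (1/2) (Suc j) = 1/2" "harm_v (1/2) (Suc j) = 1/2"
      by (simp_all add: harm_u_def harm_v_def)
    have "harm_Q (1/2) k (Re w) ((cmod w)\<^sup>2) = 2 * Re w * harm_Q (1/2) (Suc j) (Re w) ((cmod w)\<^sup>2)
        - (cmod w)\<^sup>2 * harm_Q (1/2) j (Re w) ((cmod w)\<^sup>2)"
      unfolding 3 harm_Q.simps uv by simp
    also have "\<dots> = Re (w ^ k)"
      using less[of j] less[of "Suc j"] 3 Rk by (simp only: lessI less_Suc_eq simp_thms)
    finally show ?thesis .
  qed (simp_all add: One_nat_def)
qed

context sphere_coords begin

lemma sph_point_coord: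
  assumes "j \<in> {1..n+1}"
  shows "sph_point n ix (\<theta>, \<phi>) $ ix j =
     (if j < n then (\<Prod>k=1..<j. sin (\<theta> k)) * cos (\<theta> j)
       else if j = n then (\<Prod>k=1..<n. sin (\<theta> k)) * cos \<phi>
       else (\<Prod>k=1..<n. sin (\<theta> k)) * sin \<phi>)"
proof -
  have "inv_into {1..n+1} ix (ix j) = j"
    using bij assms by (meson bij_betw_imp_inj_on inv_into_f_f)
  thus ?thesis by (simp only: sph_point_def Let_def case_prod_conv vec_lambda_beta)
qed

context
  fixes x :: "real^'m"
  assumes x: "x \<in> sphere 0 1"
begin

abbreviation "th \<equiv> fst (sph_coords n ix x)"
abbreviation "ph \<equiv> snd (sph_coords n ix x)"

lemma coord: "j \<in> {1..n+1} \<Longrightarrow> x $ ix j =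
     (if j < n then (\<Prod>k=1..<j. sin (th k)) * cos (th j)
       else if j = n then (\<Prod>k=1..<n. sin (th k)) * cos ph
       else (\<Prod>k=1..<n. sin (th k)) * sin ph)"
  using sph_point_coord[of j th ph] sph_coords_exist(2)[OF bij n2 x] by simp

lemma x1_coord: "x1 x = cos (th 1)"
  using coord[of 1] n2 by simp

lemma th1_range: "0 \<le> th 1" "th 1 \<le> pi"
proof -
  have "th \<in> {1..n-1} \<rightarrow>\<^sub>E {0..pi}"
    using sph_coords_exist(1)[OF bij n2 x] unfolding sph_angles_def by (metis mem_Times_iff)
  from PiE_mem[OF this, of 1] have "th 1 \<in> {0..pi}" using n2 by simp
  thus "0 \<le> th 1" "th 1 \<le> pi" by auto
qed

lemma sin_th1: "(sin (th 1))\<^sup>2 = 1 - (x1 x)\<^sup>2"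
  by (simp add: x1_coord sin_squared_eq)

lemma x2_coord: "n \<ge> 3 \<Longrightarrow> x2 x = sin (th 1) * cos (th 2)"
  using coord[of 2] n2 by (simp add: numeral_2_eq_2 One_nat_def)

lemma x23_coord: "n = 2 \<Longrightarrow> x2 x = sin (th 1) * cos ph" "n = 2 \<Longrightarrow> x3 x = sin (th 1) * sin ph"
  using coord[of 2] coord[of 3] by (simp_all add: numeral_2_eq_2 One_nat_def)

end

lemma zonal_x1:
  assumes "zonal n ix f"
  shows "\<exists>G. \<forall>x\<in>sphere 0 1. f x = G (x1 x)"
proof -
  obtain g where g: "\<And>\<theta> \<phi>. (\<theta>, \<phi>) \<in> sph_angles n \<Longrightarrow> f (sph_point n ix (\<theta>, \<phi>)) = g (\<theta> 1)"
    using assms unfolding zonal_def by blast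
  have "f x = g (arccos (x1 x))" if x: "x \<in> sphere 0 1" for x
  proof -
    have "f x = g (fst (sph_coords n ix x) 1)"
      using g[of "fst (sph_coords n ix x)" "snd (sph_coords n ix x)"] sph_coords_exist[OF bij n2 x] by simp
    thus ?thesis using x1_coord[OF x] th1_range[OF x] by (simp add: arccos_cos)
  qed
  thus ?thesis by (intro exI[of _ "\<lambda>t. g (arccos t)"]) blast
qed

definition smass :: real where "smass = measure (surf :: (real^'m) measure) (sphere 0 1)"

lemma smass_pos: "smass > 0"
  unfolding smass_def by (rule surface_measure_pos)

lemma sph_inner_smass:
  fixes f g :: "real^'m \<Rightarrow> complex"
  shows "sph_inner f g = (LINT x|surf. cnj (f x) * g x) / of_real smass"
  by (simp add: sph_inner_def smass_def)

text \<open>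
  For \<open>n = 2\<close> and \<open>k > 0\<close> the square of the real function \<open>Z\<^sub>l\<^sup>k\<close> has half the integral of \<open>|Y|\<^sup>2\<close>
  for the unnormalized complex harmonic \<open>Y\<close>.
\<close>

definition tau :: "nat \<Rightarrow> real" where "tau k = (if n = 2 \<and> k > 0 then 2 else 1)"

lemma tau_pos: "tau k > 0" by (simp add: tau_def)

text \<open>
  The constant for which the Fourier coefficient is \<open>\<integral> Z\<^sub>l\<^sup>k u / \<rho>\<close>; see \<open>coeff_Y_eq\<close>.
\<close>

definition rho :: "nat \<Rightarrow> nat \<Rightarrow> real" where "rho l k = sqrt (tau k * nrm l k * smass)"

lemma rho_pos: "k \<le> l \<Longrightarrow> rho l k > 0"
  using nrm_pos tau_pos smass_pos by (simp add: rho_def)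

lemma Y_ge3_eq:
  assumes n3: "n \<ge> 3" and k: "k \<le> l" and x: "x \<in> sphere 0 1"
  shows "Y_ge3 n ix l k x = of_real (smass / rho l k * Z l k x)"
proof -
  have nu: "lam - 1/2 > 0" using n3 by (simp add: lam_def)
  define \<gamma> where "\<gamma> = gegenbauer (lam - 1/2) k 1"
  have \<gamma>: "\<gamma> > 0" unfolding \<gamma>_def by (rule gegenbauer_homogeneous(2)[OF nu])
  define h where "h = (\<lambda>x. complex_of_real
        (let \<theta>1 = sph_theta n ix 1 x; \<theta>2 = sph_theta n ix 2 x in
         gegenbauer ((real n - 1) / 2 + real k) (l - k) (cos \<theta>1) * sin \<theta>1 ^ k *
         gegenbauer ((real n - 1) / 2 - 1/2) k (cos \<theta>2)))"
  have h: "h x = of_real (\<gamma> * Z l k x)" if x: "x \<in> sphere 0 1" for x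
  proof -
    let ?t = "sph_theta n ix 1 x" and ?t2 = "sph_theta n ix 2 x"
    have "sin ?t ^ k * gegenbauer (lam - 1/2) k (cos ?t2) = \<gamma> * harm_Q lam k (sin ?t * cos ?t2) ((sin ?t)\<^sup>2)"
      using gegenbauer_homogeneous(1)[OF nu, of "sin ?t" k "cos ?t2"] by (simp add: \<gamma>_def)
    also have "\<dots> = \<gamma> * Q k x"
      unfolding sin_th1[OF x] x2_coord[OF x n3, symmetric] ..
    finally have e: "sin ?t ^ k * gegenbauer (lam - 1/2) k (cos ?t2) = \<gamma> * Q k x" .
    have "gegenbauer (lam + real k) (l - k) (cos ?t) * sin ?t ^ k * gegenbauer (lam - 1/2) k (cos ?t2) = \<gamma> * Z l k x"
      unfolding mult.assoc e x1_coord[OF x, symmetric] using k by (simp add: harm_Z_def)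
    thus ?thesis by (simp only: h_def Let_def lam_def[symmetric])
  qed
  have "sph_inner h h = (LINT x|surf. complex_of_real (\<gamma>\<^sup>2 * (Z l k x * Z l k x))) / of_real smass"
    unfolding sph_inner_smass
    by (intro arg_cong2[of _ _ _ _ "(/)"] Bochner_Integration.integral_cong refl)
       (simp add: h power2_eq_square mult_ac)
  also have "\<dots> = of_real (\<gamma>\<^sup>2 * nrm l k / smass)"
    unfolding integral_complex_of_real by (simp add: nrm_def ip_def)
  finally have "Re (sph_inner h h) = \<gamma>\<^sup>2 * nrm l k / smass" by simp
  have sq: "sqrt (Re (sph_inner h h)) = \<gamma> * (rho l k / smass)"
  proof -
    have "(rho l k)\<^sup>2 = nrm l k * smass"
      using n3 nrm_nonneg[of l k] smass_pos by (simp add: rho_def tau_def)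
    hence "\<gamma>\<^sup>2 * nrm l k / smass = (\<gamma> * (rho l k / smass))\<^sup>2"
      using smass_pos by (simp add: power_mult_distrib power_divide) (simp add: power2_eq_square)
    moreover have "0 \<le> \<gamma> * (rho l k / smass)"
      using \<gamma> smass_pos rho_pos[OF k] by (intro mult_nonneg_nonneg divide_nonneg_nonneg) auto
    ultimately show ?thesis by (simp only: \<open>Re (sph_inner h h) = \<gamma>\<^sup>2 * nrm l k / smass\<close> real_sqrt_abs abs_of_nonneg)
  qed
  have "Y_ge3 n ix l k x = sph_normalize h x"
    using k by (simp add: Y_ge3_def h_def Let_def)
  also have "\<dots> = of_real (1 / (\<gamma> * (rho l k / smass))) * of_real (\<gamma> * Z l k x)"
    unfolding sph_normalize_def sq h[OF x] ..
  also have "\<dots> = of_real (smass / rho l k * Z l k x)"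
    using \<gamma> by simp
  finally show ?thesis .
qed

abbreviation W :: "real^'m \<Rightarrow> complex" where "W x \<equiv> Complex (x2 x) (x3 x)"

lemma cmod_W: "n = 2 \<Longrightarrow> x \<in> sphere 0 1 \<Longrightarrow> (cmod (W x))\<^sup>2 = 1 - (x1 x)\<^sup>2"
  using sphere_sum[of x] by (simp add: cmod_power2)

lemma lam_half:
  assumes "n = 2" shows "lam = 1/2"
proof -
  have "real n = 2" using assms by simp
  thus ?thesis unfolding lam_def by simp
qed

lemma tau_eq: "n = 2 \<Longrightarrow> k > 0 \<Longrightarrow> tau k = 2" "n \<ge> 3 \<Longrightarrow> tau k = 1" "tau 0 = 1"
  unfolding tau_def by simp_all

lemma Q_eq_W:
  assumes "n = 2" "x \<in> sphere 0 1"
  shows "Q k x = Re (W x ^ k)"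
  using harm_Q_half_Re_power[of k "W x"] cmod_W[OF assms] by (simp add: lam_half[OF assms(1)])

lemma W_polar:
  assumes n: "n = 2" and x: "x \<in> sphere 0 1"
  shows "W x = of_real (sin (sph_theta 2 ix 1 x)) * cis (sph_phi 2 ix x)"
  using x23_coord[OF x n] n by (simp add: complex_eq_iff)

text \<open>
  Since \<open>Re(w\<^sup>2\<^sup>k) = 2 Re(w\<^sup>k)\<^sup>2 - |w|\<^sup>2\<^sup>k\<close>, the claim is that \<open>Q\<^sub>2\<^sub>k\<close> is orthogonal to \<open>Q\<^sub>0 = 1\<close>.
\<close>

lemma W_square_integral:
  assumes n: "n = 2" and k: "k \<le> l"
  shows "(LINT x|surf. (gegenbauer (lam + real k) (l - k) (x1 x))\<^sup>2 * (cmod (W x)) ^ (2 * k)) = tau k * nrm l k"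
proof (cases "k = 0")
  case True
  thus ?thesis by (simp add: tau_def nrm_def ip_def harm_Z_def power2_eq_square)
next
  case False
  let ?p = "\<lambda>x. gegenbauer (lam + real k) (l - k) (x1 x)"
  define g where "g = (\<lambda>s. complex_of_real ((gegenbauer (lam + real k) (l - k) s)\<^sup>2))"
  have "integrable surf (\<lambda>x. g (x1 x))"
    unfolding g_def by (intro surface_integrable_continuous cont_intros)
  from QQ_orthogonal[OF this, of "2 * k" 0] False have "QQ (2 * k) 0 g = 0" by simp
  moreover have "QQ (2 * k) 0 g = (LINT x|surf. complex_of_real (Q (2 * k) x * (?p x)\<^sup>2))"
    unfolding QQ_def g_def by simp
  ultimately have z: "(LINT x|surf. Q (2 * k) x * (?p x)\<^sup>2) = 0"
    by (simp only: integral_complex_of_real of_real_eq_0_iff)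
  have "(?p x)\<^sup>2 * (cmod (W x)) ^ (2 * k) = 2 * (Z l k x * Z l k x) - Q (2 * k) x * (?p x)\<^sup>2"
    if x: "x \<in> sphere 0 1" for x
  proof -
    have sq: "Re (a\<^sup>2) = 2 * (Re a)\<^sup>2 - (cmod a)\<^sup>2" for a
      by (simp add: cmod_power2) (simp add: power2_eq_square)
    have "Re (W x ^ (2 * k)) = Re ((W x ^ k)\<^sup>2)" by (simp add: power_mult[symmetric] mult.commute)
    also have "\<dots> = 2 * (Re (W x ^ k))\<^sup>2 - (cmod (W x)) ^ (2 * k)"
      unfolding sq by (simp add: norm_power power_mult[symmetric] mult.commute)
    finally have "Q (2 * k) x = 2 * (Q k x)\<^sup>2 - (cmod (W x)) ^ (2 * k)"
      unfolding Q_eq_W[OF n x] .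
    moreover have "a\<^sup>2 * w = 2 * ((a * b) * (a * b)) - (2 * b\<^sup>2 - w) * a\<^sup>2" for a b w :: real
      by (simp add: power2_eq_square algebra_simps)
    ultimately show ?thesis using k by (simp only: harm_Z_def if_True)
  qed
  hence "(LINT x|surf. (?p x)\<^sup>2 * (cmod (W x)) ^ (2 * k))
      = (LINT x|surf. 2 * (Z l k x * Z l k x) - Q (2 * k) x * (?p x)\<^sup>2)"
    by (intro Bochner_Integration.integral_cong refl) simp
  also have "\<dots> = 2 * nrm l k - (LINT x|surf. Q (2 * k) x * (?p x)\<^sup>2)"
  proof -
    have "integrable surf (\<lambda>x. Q (2 * k) x * (?p x)\<^sup>2)"
      by (intro integrable_cont_real cont_intros)
    thus ?thesis using integrable_ZZ by (simp add: nrm_def ip_def)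
  qed
  finally show ?thesis unfolding z using tau_eq(1)[OF n, of k] False by simp
qed

lemma Y_2_eq:
  assumes n: "n = 2" and k: "k \<le> l" and x: "x \<in> sphere 0 1"
  shows "Y_2 ix l (int k) x = of_real (smass / rho l k * gegenbauer (lam + real k) (l - k) (x1 x)) * W x ^ k"
    and "Y_2 ix l (- int k) x = of_real (smass / rho l k * gegenbauer (lam + real k) (l - k) (x1 x)) * cnj (W x) ^ k"
proof -
  define h where "h = (\<lambda>s::int. \<lambda>x.
        let \<theta>1 = sph_theta 2 ix 1 x; \<phi> = sph_phi 2 ix x in
        complex_of_real (gegenbauer (real (nat \<bar>s * int k\<bar>) + 1/2) (l - nat \<bar>s * int k\<bar>) (cos \<theta>1) *
          sin \<theta>1 ^ nat \<bar>s * int k\<bar>) * cis (of_int (s * int k) * \<phi>))"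
  define V where "V = (\<lambda>s::int. \<lambda>x. if s = 1 then W x else cnj (W x))"
  have h: "h s x = of_real (gegenbauer (lam + real k) (l - k) (x1 x)) * V s x ^ k"
    if s: "s = 1 \<or> s = -1" and x: "x \<in> sphere 0 1" for s x
  proof -
    have ab: "nat \<bar>s * int k\<bar> = k" using s by auto
    have "V s x = of_real (sin (sph_theta 2 ix 1 x)) * cis (of_int s * sph_phi 2 ix x)"
      using s W_polar[OF n x] by (auto simp: V_def cis_cnj)
    hence "V s x ^ k = of_real (sin (sph_theta 2 ix 1 x) ^ k) * cis (of_int (s * int k) * sph_phi 2 ix x)"
      by (simp add: power_mult_distrib Complex.DeMoivre mult_ac)
    moreover have "cos (sph_theta 2 ix 1 x) = x1 x" using x1_coord[OF x] n by simp
    ultimately show ?thesis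
      unfolding h_def Let_def ab lam_half[OF n] by (simp add: add.commute mult_ac)
  qed
  have Vm: "cmod (V s x) = cmod (W x)" for s x by (simp add: V_def)
  have sq: "sqrt (Re (sph_inner (h s) (h s))) = rho l k / smass" if s: "s = 1 \<or> s = -1" for s
  proof -
    have "sph_inner (h s) (h s) = (LINT x|surf. complex_of_real
        ((gegenbauer (lam + real k) (l - k) (x1 x))\<^sup>2 * (cmod (W x)) ^ (2 * k))) / of_real smass"
      unfolding sph_inner_smass
    proof (intro arg_cong2[of _ _ _ _ "(/)"] Bochner_Integration.integral_cong refl)
      fix x :: "real^'m" assume "x \<in> space surf"
      hence x: "x \<in> sphere 0 1" by simp
      have "cnj (h s x) * h s x = of_real ((cmod (h s x))\<^sup>2)"
        by (metis complex_norm_square mult.commute)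
      also have "(cmod (h s x))\<^sup>2 = (gegenbauer (lam + real k) (l - k) (x1 x))\<^sup>2 * (cmod (W x)) ^ (2 * k)"
        unfolding h[OF s x] by (simp add: norm_mult norm_power Vm power_mult_distrib power_mult[symmetric] mult.commute)
      finally show "cnj (h s x) * h s x = complex_of_real
        ((gegenbauer (lam + real k) (l - k) (x1 x))\<^sup>2 * (cmod (W x)) ^ (2 * k))" .
    qed
    also have "\<dots> = of_real (tau k * nrm l k / smass)"
      unfolding integral_complex_of_real W_square_integral[OF n k] by simp
    finally have "Re (sph_inner (h s) (h s)) = tau k * nrm l k / smass" by simp
    also have "\<dots> = (tau k * nrm l k * smass) / smass\<^sup>2" using smass_pos by (simp add: power2_eq_square)
    finally show ?thesis using smass_pos by (simp add: rho_def real_sqrt_divide)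
  qed
  have Y: "sph_normalize (h s) x = of_real (smass / rho l k * gegenbauer (lam + real k) (l - k) (x1 x)) * V s x ^ k"
    if s: "s = 1 \<or> s = -1" for s
    unfolding sph_normalize_def sq[OF s] h[OF s x] by simp
  have "Y_2 ix l (int k) x = sph_normalize (h 1) x"
    using k by (simp add: Y_2_def h_def)
  thus "Y_2 ix l (int k) x = of_real (smass / rho l k * gegenbauer (lam + real k) (l - k) (x1 x)) * W x ^ k"
    using Y[of 1] by (simp add: V_def)
  have "Y_2 ix l (- int k) x = sph_normalize (h (-1)) x"
    using k by (simp add: Y_2_def h_def)
  thus "Y_2 ix l (- int k) x = of_real (smass / rho l k * gegenbauer (lam + real k) (l - k) (x1 x)) * cnj (W x) ^ k"
    using Y[of "-1"] by (simp add: V_def)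
qed

lemma Y_sym_eq:
  assumes k: "k \<le> l" and x: "x \<in> sphere 0 1"
  shows "Y_sym n ix l k x = of_real (tau k * smass / rho l k * Z l k x)"
proof (cases "n = 2")
  case True
  let ?c = "smass / rho l k * gegenbauer (lam + real k) (l - k) (x1 x)"
  have Zk: "Z l k x = gegenbauer (lam + real k) (l - k) (x1 x) * Re (W x ^ k)"
    using k Q_eq_W[OF True x, of k] by (simp add: harm_Z_def)
  show ?thesis
  proof (cases "k = 0")
    case k0: True
    have "Y_sym n ix l k x = Y_2 ix l (int k) x" using True k0 by (simp add: Y_sym_def Y_def)
    also have "\<dots> = of_real ?c * W x ^ k" by (rule Y_2_eq(1)[OF True k x])
    finally show ?thesis using k0 Zk by (simp add: tau_def)
  next
    case False
    have "Y_sym n ix l k x = Y_2 ix l (int k) x + Y_2 ix l (- int k) x"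
      using True False by (simp add: Y_sym_def)
    also have "\<dots> = of_real ?c * (W x ^ k + cnj (W x ^ k))"
      unfolding Y_2_eq[OF True k x] by (simp only: complex_cnj_power distrib_left)
    also have "\<dots> = of_real (?c * (2 * Re (W x ^ k)))"
      unfolding complex_add_cnj by simp
    finally show ?thesis unfolding Zk using tau_eq(1)[OF True, of k] False by (simp add: mult_ac)
  qed
next
  case False
  thus ?thesis using Y_ge3_eq[OF _ k x] n2 by (simp add: Y_sym_def Y_def tau_def)
qed

lemma reflection_orthogonal:
  "orthogonal_transformation (\<lambda>x::real^'m. \<chi> i. if i = ix 3 then - (x $ i) else x $ i)"
  unfolding orthogonal_transformation_def
proof safe
  show "linear (\<lambda>x::real^'m. \<chi> i. if i = ix 3 then - (x $ i) else x $ i)"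
    by (rule linearI) (auto simp: vec_eq_iff)
  fix v w :: "real^'m"
  show "(\<chi> i. if i = ix 3 then - (v $ i) else v $ i) \<bullet> (\<chi> i. if i = ix 3 then - (w $ i) else w $ i) = v \<bullet> w"
    unfolding inner_vec_def by (intro sum.cong) auto
qed

text \<open>
  For \<open>n = 2\<close> the reflection in \<open>x\<^sub>3\<close> preserves functions of \<open>x\<^sub>1\<close> and \<open>x\<^sub>2\<close> and conjugates
  \<open>x\<^sub>2 + i x\<^sub>3\<close>, so that only the real part of \<open>(x\<^sub>2 + i x\<^sub>3)\<^sup>k\<close> contributes to the coefficient.
\<close>

lemma coeff_Y_eq:
  assumes u: "sph_square_integrable u" and dep: "plane_dep u"
  shows "coeff_Y n ix l k u = zcoef l k u / of_real (rho l k)"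
proof (cases "k \<le> l")
  case False
  thus ?thesis
    using n2 by (simp add: coeff_Y_def Y_def Y_2_def Y_ge3_def zcoef_def harm_Z_def sph_inner_def)
next
  case k: True
  show ?thesis
  proof (cases "n = 2")
    case False
    hence n3: "n \<ge> 3" using n2 by simp
    have "coeff_Y n ix l k u = (LINT x|surf. of_real (smass / rho l k) * (of_real (Z l k x) * u x)) / of_real smass"
      unfolding coeff_Y_def sph_inner_smass
      by (intro arg_cong2[of _ _ _ _ "(/)"] Bochner_Integration.integral_cong refl)
         (simp add: Y_def False Y_ge3_eq[OF n3 k])
    also have "\<dots> = zcoef l k u / of_real (rho l k)"
      using smass_pos by (simp add: zcoef_def)
    finally show ?thesis .
  next
    case True
    let ?p = "\<lambda>x. gegenbauer (lam + real k) (l - k) (x1 x)"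
    let ?R = "\<lambda>x::real^'m. \<chi> i. if i = ix 3 then - (x $ i) else x $ i"
    have R: "x1 (?R x) = x1 x" "x2 (?R x) = x2 x" "W (?R x) = cnj (W x)" for x
      using ix13 ix23 by (simp_all add: complex_eq_iff)
    have ui: "integrable surf u" by (rule sph_square_integrable_integrable[OF u])
    have um: "u \<in> borel_measurable surf" using ui by auto
    have cW: "continuous_on UNIV W"
      unfolding Complex_eq by (intro continuous_intros)
    have i1: "integrable surf (\<lambda>x. of_real (?p x) * W x ^ k * u x)"
      by (rule surface_integrable_continuous_mult[OF _ ui]) (intro cont_intros cW)
    have i2: "integrable surf (\<lambda>x. of_real (?p x) * cnj (W x) ^ k * u x)"
      by (rule surface_integrable_continuous_mult[OF _ ui]) (intro cont_intros cW)
    have uR: "u (?R x) = u x" if x: "x \<in> sphere 0 1" for x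
    proof -
      have "?R x \<in> sphere 0 1"
        using x orthogonal_transformation_norm[OF reflection_orthogonal, of x] by simp
      thus ?thesis using dep x R unfolding plane_dep_def by blast
    qed
    have reflect: "(LINT x|surf. of_real (?p x) * cnj (W x) ^ k * u x) = (LINT x|surf. of_real (?p x) * W x ^ k * u x)"
    proof -
      have "(LINT x|surf. of_real (?p x) * W x ^ k * u x) = (LINT x|surf. of_real (?p (?R x)) * W (?R x) ^ k * u (?R x))"
        by (rule surface_integral_orthogonal[OF reflection_orthogonal, symmetric]) (use i1 in auto)
      also have "\<dots> = (LINT x|surf. of_real (?p x) * cnj (W x) ^ k * u x)"
        unfolding R by (intro Bochner_Integration.integral_cong refl) (simp add: uR complex_cnj)
      finally show ?thesis ..
    qed
    have "zcoef l k u = (LINT x|surf. (of_real (?p x) * W x ^ k * u x + of_real (?p x) * cnj (W x) ^ k * u x) / 2)"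
      unfolding zcoef_def
    proof (rule Bochner_Integration.integral_cong[OF refl])
      fix x :: "real^'m" assume "x \<in> space surf"
      hence x: "x \<in> sphere 0 1" by simp
      have "of_real (Z l k x) = of_real (?p x) * ((W x ^ k + cnj (W x ^ k)) / 2)"
        unfolding complex_add_cnj using k Q_eq_W[OF True x, of k] by (simp add: harm_Z_def)
      thus "of_real (Z l k x) * u x = (of_real (?p x) * W x ^ k * u x + of_real (?p x) * cnj (W x) ^ k * u x) / 2"
        by (simp add: algebra_simps add_divide_distrib)
    qed
    also have "\<dots> = (LINT x|surf. of_real (?p x) * cnj (W x) ^ k * u x)"
      using i1 i2 reflect by simp
    finally have z: "zcoef l k u = (LINT x|surf. of_real (?p x) * cnj (W x) ^ k * u x)" .
    have "coeff_Y n ix l k u = (LINT x|surf. of_real (smass / rho l k) * (of_real (?p x) * cnj (W x) ^ k * u x)) / of_real smass"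
      unfolding coeff_Y_def sph_inner_smass
      by (intro arg_cong2[of _ _ _ _ "(/)"] Bochner_Integration.integral_cong refl)
         (simp add: Y_def True Y_2_eq(1)[OF True k])
    also have "\<dots> = zcoef l k u / of_real (rho l k)"
      using smass_pos by (simp add: z)
    finally show ?thesis .
  qed
qed

text \<open>
  Each term of the expansion is the orthogonal projection to the line spanned by \<open>Z\<^sub>l\<^sup>k\<close>, whichever
  normalization is used.
\<close>

lemma coeff_Y_mult_Y_sym:
  assumes u: "sph_square_integrable u" "plane_dep u" and k: "k \<le> l" and x: "x \<in> sphere 0 1"
  shows "coeff_Y n ix l k u * Y_sym n ix l k x = zcoef l k u / of_real (nrm l k) * of_real (Z l k x)"
proof -
  have "tau k * smass / (rho l k * rho l k) = 1 / nrm l k"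
    using nrm_pos[OF k] tau_pos[of k] smass_pos by (simp add: rho_def)
  note e = this
  have "zcoef l k u / of_real (rho l k) * of_real (tau k * smass / rho l k * Z l k x)
      = zcoef l k u * of_real (tau k * smass / (rho l k * rho l k)) * of_real (Z l k x)"
    by simp
  also have "\<dots> = zcoef l k u / of_real (nrm l k) * of_real (Z l k x)"
    unfolding e by simp
  finally show ?thesis unfolding coeff_Y_eq[OF u] Y_sym_eq[OF k x] .
qed

end

section \<open>Coefficients of the derivatives\<close>

lemma vector_derivative_shift:
  fixes h :: "real \<Rightarrow> 'b::real_normed_vector"
  shows "vector_derivative (\<lambda>s. h (s + c)) (at t) = vector_derivative h (at (t + c))"
proof -
  have *: "((\<lambda>s. g (s + c)) has_vector_derivative D) (at t)"
    if "(g has_vector_derivative D) (at (t + c))" for g :: "real \<Rightarrow> 'b" and D c t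
  proof -
    have "((\<lambda>s. s + c) has_vector_derivative 1) (at t)"
      by (auto intro!: derivative_eq_intros)
    from vector_diff_chain_at[OF this that] show ?thesis by (simp add: o_def)
  qed
  have "((\<lambda>s. h (s + c)) has_vector_derivative D) (at t) \<longleftrightarrow> (h has_vector_derivative D) (at (t + c))" for D
    using *[of h D t c] *[of "\<lambda>s. h (s + c)" D "t + c" "- c"] by auto
  thus ?thesis unfolding vector_derivative_def by simp
qed

lemma higher_vderiv_shift:
  "higher_vderiv i (\<lambda>s. h (s + c)) t = higher_vderiv i h (t + c)"
proof (induction i arbitrary: t)
  case (Suc i)
  hence "higher_vderiv i (\<lambda>s. h (s + c)) = (\<lambda>t. higher_vderiv i h (t + c))" by auto
  thus ?case by (simp add: higher_vderiv_def vector_derivative_shift)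
qed (simp add: higher_vderiv_def)

text \<open>
  Along an orbit the derivatives of \<open>f\<close> at angle \<open>0\<close> become ordinary derivatives of a function of
  one variable.
\<close>

lemma rot_deriv_orbit:
  assumes "ix 1 \<noteq> ix 2"
  shows "rot_deriv ix i f (rot ix t x) = higher_vderiv i (\<lambda>\<Theta>. f (rot ix \<Theta> x)) t"
  using higher_vderiv_shift[of i "\<lambda>\<Theta>. f (rot ix \<Theta> x)" t 0]
  by (simp add: rot_deriv_def rot_add[OF assms])

lemma rot_deriv_0 [simp]: "rot_deriv ix 0 f = f"
  by (rule ext) (simp add: rot_deriv_def higher_vderiv_def)

lemma rot_deriv_has_deriv:
  assumes ne: "ix 1 \<noteq> ix 2" and d: "rot_differentiable ix d f" "i < d" and x: "x \<in> sphere 0 1"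
  shows "((\<lambda>t. rot_deriv ix i f (rot ix t x)) has_vector_derivative
      rot_deriv ix (Suc i) f (rot ix t x)) (at t)"
proof -
  have "higher_vderiv i (\<lambda>\<Theta>. f (rot ix \<Theta> x)) differentiable at t"
    using d x by (auto simp: rot_differentiable_def)
  thus ?thesis
    unfolding rot_deriv_orbit[OF ne] using vector_derivative_works[of "higher_vderiv i (\<lambda>\<Theta>. f (rot ix \<Theta> x))" "at t"]
    by (simp add: higher_vderiv_def)
qed

lemma termwise_derivative_sums:
  fixes \<phi> \<psi> :: "nat \<Rightarrow> real \<Rightarrow> 'b::banach"
  assumes der: "\<And>l t. (\<phi> l has_vector_derivative \<psi> l t) (at t)"
    and bound: "\<And>l t. norm (\<psi> l t) \<le> M l" and M: "summable M"
    and sums: "\<And>t. (\<lambda>l. \<phi> l t) sums F t"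
    and F: "(F has_vector_derivative D) (at t)"
  shows "(\<lambda>l. \<psi> l t) sums D"
proof -
  define g' where "g' = (\<lambda>t. \<Sum>l. \<psi> l t)"
  have ul: "uniform_limit UNIV (\<lambda>n t. \<Sum>l<n. \<psi> l t) g' sequentially"
    unfolding g'_def using bound M by (intro Weierstrass_m_test) auto
  have "\<exists>g. \<forall>t\<in>UNIV. (\<lambda>l. \<phi> l t) sums g t \<and> (g has_derivative (\<lambda>h. h *\<^sub>R g' t)) (at t within UNIV)"
  proof (rule has_derivative_series[where f' = "\<lambda>l t h. h *\<^sub>R \<psi> l t" and x = 0])
    fix e :: real assume "e > 0"
    with ul have "\<forall>\<^sub>F n in sequentially. \<forall>t\<in>UNIV. dist (\<Sum>l<n. \<psi> l t) (g' t) < e"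
      by (simp add: uniform_limit_iff)
    thus "\<forall>\<^sub>F n in sequentially. \<forall>t\<in>UNIV. \<forall>h. norm ((\<Sum>l<n. h *\<^sub>R \<psi> l t) - h *\<^sub>R g' t) \<le> e * norm h"
    proof eventually_elim
      case (elim n)
      show ?case
      proof (intro ballI allI)
        fix t h :: real
        have "norm ((\<Sum>l<n. h *\<^sub>R \<psi> l t) - h *\<^sub>R g' t) = \<bar>h\<bar> * norm ((\<Sum>l<n. \<psi> l t) - g' t)"
          by (simp add: scaleR_sum_right[symmetric] scaleR_diff_right[symmetric])
        also have "\<dots> \<le> \<bar>h\<bar> * e"
          using elim by (intro mult_left_mono) (auto simp: dist_norm less_imp_le)
        finally show "norm ((\<Sum>l<n. h *\<^sub>R \<psi> l t) - h *\<^sub>R g' t) \<le> e * norm h" by (simp add: mult.commute)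
      qed
    qed
  qed (use der sums in \<open>auto simp: has_vector_derivative_def\<close>)
  then obtain g where g: "\<And>t. (\<lambda>l. \<phi> l t) sums g t" "\<And>t. (g has_vector_derivative g' t) (at t)"
    by (auto simp: has_vector_derivative_def)
  have "g = F" using g(1) sums sums_unique2 by blast
  hence "D = g' t" using g(2) F vector_derivative_unique_at by blast
  moreover have "summable (\<lambda>l. \<psi> l t)" using bound M by (rule summable_comparison_test'[rotated])
  ultimately show ?thesis unfolding g'_def by (simp add: summable_sums)
qed

context sphere_coords begin

lemma rot_deriv_plane_dep:
  assumes "zonal n ix f"
  shows "plane_dep (rot_deriv ix i f)"
  unfolding plane_dep_def
proof (intro ballI impI)
  fix x y :: "real^'m"
  assume x: "x \<in> sphere 0 1" and y: "y \<in> sphere 0 1" and eq: "x1 x = x1 y" "x2 x = x2 y"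
  obtain G where G: "\<And>x. x \<in> sphere 0 1 \<Longrightarrow> f x = G (x1 x)" using zonal_x1[OF assms] by blast
  have "x1 (rot ix t x) = x1 (rot ix t y)" for t
    by (simp add: rot_def eq)
  hence "f (rot ix t x) = f (rot ix t y)" for t
    using G rot_sphere[OF ix12 x, of t] rot_sphere[OF ix12 y, of t] by metis
  thus "rot_deriv ix i f x = rot_deriv ix i f y" unfolding rot_deriv_def by simp
qed

text \<open>
  Integration by parts moves the derivative to \<open>Z\<^sub>l\<^sup>k\<close>, where the ladder relation applies.
\<close>

lemma zcoef_deriv:
  fixes u u' :: "real^'m \<Rightarrow> complex"
  assumes u: "sph_square_integrable u" and u': "sph_square_integrable u'"
    and der: "\<And>x t. x \<in> sphere 0 1 \<Longrightarrow>
      ((\<lambda>t. u (rot ix t x)) has_vector_derivative u' (rot ix t x)) (at t)"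
  shows "zcoef l k u' = of_real (ladder_up lam k) * zcoef l (Suc k) u
      - of_real (ladder_down lam l k) * zcoef l (k - 1) u"
proof -
  define D where "D = (\<lambda>x. ladder_down lam l k * Z l (k - 1) x - ladder_up lam k * Z l (Suc k) x)"
  define H' where "H' = (\<lambda>x. of_real (Z l k x) * u' x + of_real (D x) * u x)"
  have H': "H' x = of_real (Z l k x) * u' x + (of_real (ladder_down lam l k) * (of_real (Z l (k - 1) x) * u x)
      - of_real (ladder_up lam k) * (of_real (Z l (Suc k) x) * u x))" for x
    by (simp add: H'_def D_def algebra_simps)
  note i = integrable_Zu[OF u] integrable_Zu[OF u']
  have "(LINT x|surf. H' x) = 0"
  proof (rule surface_integral_rot_derivative[OF ix12, where H = "\<lambda>x. of_real (Z l k x) * u x"])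
    fix x :: "real^'m" and t assume x: "x \<in> sphere 0 1"
    have "((\<lambda>t. complex_of_real (Z l k (rot ix t x))) has_vector_derivative complex_of_real (D (rot ix t x))) (at t)"
      unfolding D_def by (rule has_vector_derivative_of_real[OF Z_rot_deriv])
    from has_vector_derivative_mult[OF this der[OF x]]
    show "((\<lambda>t. of_real (Z l k (rot ix t x)) * u (rot ix t x)) has_vector_derivative H' (rot ix t x)) (at t)"
      by (simp add: H'_def)
  next
    show "integrable surf H'"
      unfolding H' using i by simp
  qed
  hence "zcoef l k u' + (of_real (ladder_down lam l k) * zcoef l (k - 1) u
      - of_real (ladder_up lam k) * zcoef l (Suc k) u) = 0"
    unfolding H' zcoef_def using i by simp
  thus ?thesis by (simp add: add_eq_0_iff2)
qed

lemma zcoef_beyond: "k > l \<Longrightarrow> zcoef l k u = 0"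
  by (simp add: zcoef_def harm_Z_def)

text \<open>
  A zonal function is a weight in \<open>x\<^sub>1\<close>, and \<open>Q\<^sub>k\<close> is orthogonal to \<open>Q\<^sub>0 = 1\<close> for every such weight.
\<close>

lemma zcoef_zonal:
  assumes z: "zonal n ix f" and u: "sph_square_integrable f" and k: "k > 0"
  shows "zcoef l k f = 0"
proof (cases "k \<le> l")
  case True
  obtain G where G: "\<And>x. x \<in> sphere 0 1 \<Longrightarrow> f x = G (x1 x)" using zonal_x1[OF z] by blast
  define g where "g = (\<lambda>s. of_real (gegenbauer (lam + real k) (l - k) s) * G s)"
  have "integrable surf (\<lambda>x. of_real (gegenbauer (lam + real k) (l - k) (x1 x)) * f x)"
    by (rule surface_integrable_continuous_mult[OF _ sph_square_integrable_integrable[OF u]]) (intro cont_intros)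
  also have "integrable surf (\<lambda>x. of_real (gegenbauer (lam + real k) (l - k) (x1 x)) * f x)
      \<longleftrightarrow> integrable surf (\<lambda>x. g (x1 x))"
    by (intro Bochner_Integration.integrable_cong refl) (simp add: g_def G)
  finally have "QQ k 0 g = 0" using k by (intro QQ_orthogonal) auto
  moreover have "zcoef l k f = QQ k 0 g"
    unfolding zcoef_def QQ_def
    by (intro Bochner_Integration.integral_cong refl) (use True in \<open>simp add: harm_Z_def g_def G\<close>)
  ultimately show ?thesis by simp
qed (simp add: zcoef_beyond)

lemma ladder_product:
  "ladder_up lam k * ladder_down lam l (Suc k) =
     harm_u lam k * harm_v lam (Suc k) * ((real l - real k) * (real l + real k + 2 * lam))"
proof -
  have "lam + real k \<noteq> 0" using lam_ge by simp
  thus ?thesis by (simp add: ladder_up_def ladder_down_Suc[OF lam_ge])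
qed

text \<open>
  For \<open>n = 2\<close> the function \<open>Z\<^sub>l\<^sup>1\<close> is shared by \<open>Y\<^sub>l\<^sup>1\<close> and \<open>Y\<^sub>l\<^sup>-\<^sup>1\<close>, whereas \<open>Z\<^sub>l\<^sup>0\<close> belongs to \<open>Y\<^sub>l\<^sup>0\<close>
  alone; this is where the factor \<open>2\<close> comes from.
\<close>

lemma beta_square:
  assumes "k < l"
  shows "(beta n l k)\<^sup>2 * (if n = 2 \<and> k = 0 then 2 else 1) = ladder_up lam k * ladder_down lam l (Suc k)"
    and "beta n l k \<ge> 0"
proof -
  have pos: "(real l - real k) * (real l + real k + 2 * lam) \<ge> 0"
    using assms lam_ge by (intro mult_nonneg_nonneg) auto
  have uv: "harm_u lam k * harm_v lam (Suc k) \<ge> 0"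
    using harm_u_pos[OF lam_ge, of k] harm_v_pos[OF lam_ge, of "Suc k"] by simp
  have "(beta n l k)\<^sup>2 * (if n = 2 \<and> k = 0 then 2 else 1) = ladder_up lam k * ladder_down lam l (Suc k)
      \<and> beta n l k \<ge> 0"
  proof (cases "n = 2")
    case True
    have half: "2 * lam = 1" using lam_half[OF True] by simp
    have b: "beta n l k = sqrt ((real l - real k) * (real l + real k + 2 * lam)) / 2"
      unfolding beta_def half using True by simp
    have uvk: "harm_u lam k * harm_v lam (Suc k) = (if k = 0 then 1/2 else 1/4)"
      unfolding harm_u_def harm_v_def half by (simp add: field_simps)
    show ?thesis unfolding ladder_product uvk b using pos True by (simp add: power_divide)
  next
    case False
    hence n3: "n \<ge> 3" using n2 by simp
    have nz: "2 * lam + 2 * real k - 1 > 0" "2 * lam + 2 * real k + 1 > 0" "2 * lam + real k - 1 > 0"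
    proof -
      have "2 * lam = real n - 1" "real n \<ge> 3" using n3 by (simp_all add: lam_def)
      thus "2 * lam + 2 * real k - 1 > 0" "2 * lam + 2 * real k + 1 > 0" "2 * lam + real k - 1 > 0"
        by linarith+
    qed
    have b: "beta n l k = sqrt ((real k + 1) * (2 * lam + real k - 1) * (real l - real k) * (2 * lam + real l + real k) /
              ((2 * lam + 2 * real k - 1) * (2 * lam + 2 * real k + 1)))"
      using False by (simp add: beta_def Let_def lam_def)
    have "harm_u lam k = (real k + 2 * lam - 1) / (2 * real k + 2 * lam - 1)"
      using nz by (simp add: harm_u_def)
    moreover have "harm_v lam (Suc k) = (real k + 1) / (2 * real k + 2 * lam + 1)"
      by (simp add: harm_v_def algebra_simps)
    ultimately have uvk: "harm_u lam k * harm_v lam (Suc k) = (real k + 1) * (2 * lam + real k - 1) /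
       ((2 * lam + 2 * real k - 1) * (2 * lam + 2 * real k + 1))"
      by (simp add: algebra_simps)
    have "(real k + 1) * (2 * lam + real k - 1) * (real l - real k) * (2 * lam + real l + real k) /
              ((2 * lam + 2 * real k - 1) * (2 * lam + 2 * real k + 1))
        = ladder_up lam k * ladder_down lam l (Suc k)"
      unfolding ladder_product uvk by (simp add: algebra_simps)
    hence "beta n l k = sqrt (ladder_up lam k * ladder_down lam l (Suc k))" unfolding b by simp
    moreover have "ladder_up lam k * ladder_down lam l (Suc k) \<ge> 0"
      unfolding ladder_product using pos uv by simp
    ultimately show ?thesis using False by simp
  qed
  thus "(beta n l k)\<^sup>2 * (if n = 2 \<and> k = 0 then 2 else 1) = ladder_up lam k * ladder_down lam l (Suc k)"
    "beta n l k \<ge> 0" by blast+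
qed

text \<open>
  Passing to normalized functions multiplies the ladder constants by quotients of norms; by
  \<open>ip_ladder\<close> this makes both of them the square root of their product, up to the factor from
  \<^const>\<open>tau\<close>.
\<close>

lemma rho_ratio:
  assumes k: "k < l"
  shows "ladder_up lam k * rho l (Suc k) / rho l k = (if n = 2 \<and> k = 0 then 2 else 1) * beta n l k"
    and "ladder_down lam l (Suc k) * rho l k / rho l (Suc k) = beta n l k"
proof -
  define U where "U = ladder_up lam k"
  define D where "D = ladder_down lam l (Suc k)"
  define e :: real where "e = (if n = 2 \<and> k = 0 then 2 else 1)"
  have UD: "U > 0" "D > 0" "e > 0"
    using ladder_up_pos[OF lam_ge, of k] ladder_down_pos[OF lam_ge k] by (simp_all add: U_def D_def e_def)
  have b: "(beta n l k)\<^sup>2 * e = U * D" "beta n l k \<ge> 0"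
    using beta_square[OF k] by (simp_all add: U_def D_def e_def)
  have r: "rho l k > 0" "rho l (Suc k) > 0" using rho_pos k by auto
  have tau: "tau (Suc k) = e * tau k"
    by (simp add: tau_def e_def)
  have sq: "(rho l (Suc k))\<^sup>2 = e * D / U * (rho l k)\<^sup>2"
  proof -
    have rho2: "(rho l k)\<^sup>2 = tau k * nrm l k * smass" for k
      unfolding rho_def
      by (intro real_sqrt_pow2 mult_nonneg_nonneg nrm_nonneg less_imp_le smass_pos tau_pos)
    show ?thesis unfolding rho2 tau nrm_Suc_k U_def D_def
      by (simp only: times_divide_eq_left times_divide_eq_right mult_ac)
  qed
  have "(U * rho l (Suc k) / rho l k)\<^sup>2 = (e * beta n l k)\<^sup>2"
  proof -
    have "(U * rho l (Suc k) / rho l k)\<^sup>2 = U\<^sup>2 * (rho l (Suc k))\<^sup>2 / (rho l k)\<^sup>2"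
      by (simp add: power_mult_distrib power_divide)
    also have "\<dots> = e * (U * D)" unfolding sq using UD r by (simp add: power2_eq_square)
    also have "\<dots> = (e * beta n l k)\<^sup>2" unfolding b(1)[symmetric] by (simp add: power2_eq_square)
    finally show ?thesis .
  qed
  hence "U * rho l (Suc k) / rho l k = e * beta n l k"
    by (rule power2_eq_imp_eq) (use UD r b(2) in auto)
  thus "ladder_up lam k * rho l (Suc k) / rho l k = (if n = 2 \<and> k = 0 then 2 else 1) * beta n l k"
    by (simp add: U_def e_def)
  have "(D * rho l k / rho l (Suc k))\<^sup>2 = (beta n l k)\<^sup>2"
  proof -
    have "(D * rho l k / rho l (Suc k))\<^sup>2 = D\<^sup>2 * (rho l k)\<^sup>2 / (rho l (Suc k))\<^sup>2"
      by (simp add: power_mult_distrib power_divide)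
    also have "\<dots> = U * D / e" unfolding sq using UD r by (simp add: power2_eq_square)
    also have "\<dots> = (beta n l k)\<^sup>2" unfolding b(1)[symmetric] using UD by simp
    finally show ?thesis .
  qed
  hence "D * rho l k / rho l (Suc k) = beta n l k"
    by (rule power2_eq_imp_eq) (use UD r b(2) in auto)
  thus "ladder_down lam l (Suc k) * rho l k / rho l (Suc k) = beta n l k" by (simp add: D_def)
qed

definition acoef :: "nat \<Rightarrow> nat \<Rightarrow> (real^'m \<Rightarrow> complex) \<Rightarrow> complex" where
  "acoef l k u = zcoef l k u / of_real (rho l k)"

lemma acoef_deriv:
  fixes u u' :: "real^'m \<Rightarrow> complex"
  assumes u: "sph_square_integrable u" and u': "sph_square_integrable u'"
    and der: "\<And>x t. x \<in> sphere 0 1 \<Longrightarrow>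
      ((\<lambda>t. u (rot ix t x)) has_vector_derivative u' (rot ix t x)) (at t)"
  shows "acoef l k u' = of_real ((if n = 2 \<and> k = 0 then 2 else 1) * beta n l k) * acoef l (Suc k) u
      - (if k = 0 then 0 else of_real (beta n l (k - 1)) * acoef l (k - 1) u)"
proof -
  have rec: "zcoef l k u' = of_real (ladder_up lam k) * zcoef l (Suc k) u
      - of_real (ladder_down lam l k) * zcoef l (k - 1) u"
    by (rule zcoef_deriv[OF u u' der])
  have up: "of_real (ladder_up lam k) * zcoef l (Suc k) u / of_real (rho l k)
     = of_real ((if n = 2 \<and> k = 0 then 2 else 1) * beta n l k) * acoef l (Suc k) u"
  proof (cases "k < l")
    case True
    have "rho l (Suc k) > 0" using True by (intro rho_pos) simp
    thus ?thesis unfolding rho_ratio(1)[OF True, symmetric] acoef_def by simp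
  qed (simp add: acoef_def zcoef_beyond)
  have down: "of_real (ladder_down lam l k) * zcoef l (k - 1) u / of_real (rho l k)
     = (if k = 0 then 0 else of_real (beta n l (k - 1)) * acoef l (k - 1) u)" if "k \<le> l"
  proof (cases k)
    case 0
    thus ?thesis by (simp add: ladder_down_def)
  next
    case (Suc j)
    hence j: "j < l" using that by simp
    have "rho l j > 0" using j by (intro rho_pos) simp
    hence "of_real (beta n l j) * acoef l j u = of_real (ladder_down lam l (Suc j)) * zcoef l j u / of_real (rho l (Suc j))"
      unfolding rho_ratio(2)[OF j, symmetric] acoef_def by simp
    thus ?thesis by (simp add: Suc)
  qed
  show ?thesis
  proof (cases "k \<le> l")
    case True
    have "acoef l k u' = of_real (ladder_up lam k) * zcoef l (Suc k) u / of_real (rho l k)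
        - of_real (ladder_down lam l k) * zcoef l (k - 1) u / of_real (rho l k)"
      unfolding acoef_def rec by (simp add: diff_divide_distrib)
    thus ?thesis unfolding up down[OF True] .
  next
    case False
    then obtain j where j: "k = Suc j" "j \<ge> l" by (cases k) auto
    have "of_real (beta n l j) * acoef l j u = 0"
    proof (cases "j = l")
      case True
      have "beta n l l = 0" by (simp add: beta_def Let_def)
      thus ?thesis using True by simp
    qed (use j in \<open>simp add: acoef_def zcoef_beyond\<close>)
    thus ?thesis using False j by (simp add: acoef_def zcoef_beyond)
  qed
qed

context
  fixes f :: "real^'m \<Rightarrow> complex" and d :: nat
  assumes z: "zonal n ix f" and diff: "rot_differentiable ix d f"
begin

lemma rot_deriv_square_integrable: "i \<le> d \<Longrightarrow> sph_square_integrable (rot_deriv ix i f)"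
  using diff by (simp add: rot_differentiable_def)

lemma coeff_Y_rot_deriv: "i \<le> d \<Longrightarrow> coeff_Y n ix l k (rot_deriv ix i f) = acoef l k (rot_deriv ix i f)"
  unfolding acoef_def by (intro coeff_Y_eq rot_deriv_square_integrable rot_deriv_plane_dep[OF z])

lemma acoef_rot_deriv_Suc:
  "i < d \<Longrightarrow> acoef l k (rot_deriv ix (Suc i) f) =
     of_real ((if n = 2 \<and> k = 0 then 2 else 1) * beta n l k) * acoef l (Suc k) (rot_deriv ix i f)
      - (if k = 0 then 0 else of_real (beta n l (k - 1)) * acoef l (k - 1) (rot_deriv ix i f))"
  by (intro acoef_deriv rot_deriv_square_integrable rot_deriv_has_deriv[OF ix12 diff]) auto

lemma acoef_rot_deriv_vanish: "i \<le> d \<Longrightarrow> k > i \<or> odd (k + i) \<Longrightarrow> acoef l k (rot_deriv ix i f) = 0"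
proof (induction i arbitrary: k)
  case 0
  hence "k > 0" by (cases k) auto
  thus ?case using zcoef_zonal[OF z, of k l] rot_deriv_square_integrable[of 0] by (simp add: acoef_def)
next
  case (Suc i)
  have "acoef l (Suc k) (rot_deriv ix i f) = 0" using Suc.prems by (intro Suc.IH) auto
  moreover have "acoef l (k - 1) (rot_deriv ix i f) = 0" if "k \<noteq> 0"
  proof (rule Suc.IH)
    show "k - 1 > i \<or> odd (k - 1 + i)" using Suc.prems(2) that by (cases k) auto
  qed (use Suc.prems in simp)
  ultimately show ?case using Suc.prems(1) by (simp add: acoef_rot_deriv_Suc)
qed

text \<open>
  The sum over indices \<open>k \<le> d\<close> of the parity of \<open>d\<close> may be taken over all \<open>k \<le> l\<close>, because the
  remaining coefficients vanish.
\<close>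

lemma partial_sum_eq:
  assumes x: "x \<in> sphere 0 1"
  shows "(\<Sum>j=0..d div 2. deriv_coeff n ix f l (2*j + d mod 2) d * Y_sym n ix l (2*j + d mod 2) x)
     = (\<Sum>k\<le>l. zcoef l k (rot_deriv ix d f) / of_real (nrm l k) * of_real (Z l k x))"
proof -
  define F where "F = (\<lambda>k. deriv_coeff n ix f l k d * Y_sym n ix l k x)"
  have dc: "deriv_coeff n ix f l k d = acoef l k (rot_deriv ix d f)" for k
    unfolding deriv_coeff_def by (rule coeff_Y_rot_deriv) simp
  have F0: "F k = 0" if "k > l \<or> k > d \<or> odd (k + d)" for k
    using that acoef_rot_deriv_vanish[of d k l] by (auto simp: F_def dc acoef_def zcoef_beyond)
  have inj: "inj_on (\<lambda>j. 2*j + d mod 2) {0..d div 2}" by (auto simp: inj_on_def)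
  have "(\<Sum>j=0..d div 2. F (2*j + d mod 2)) = sum F ((\<lambda>j. 2*j + d mod 2) ` {0..d div 2})"
    by (simp add: sum.reindex[OF inj])
  also have "\<dots> = sum F {..max l d}"
  proof (rule sum.mono_neutral_left)
    have "2 * j + d mod 2 \<le> d" if "j \<le> d div 2" for j
      using that mult_div_mod_eq[of 2 d] by linarith
    thus "(\<lambda>j. 2*j + d mod 2) ` {0..d div 2} \<subseteq> {..max l d}"
      by (auto intro!: max.coboundedI2)
    show "\<forall>k\<in>{..max l d} - (\<lambda>j. 2*j + d mod 2) ` {0..d div 2}. F k = 0"
    proof
      fix k assume k: "k \<in> {..max l d} - (\<lambda>j. 2*j + d mod 2) ` {0..d div 2}"
      have "k > d \<or> odd (k + d)"
      proof (rule ccontr)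
        assume "\<not> (k > d \<or> odd (k + d))"
        hence kd: "k \<le> d" "even (k + d)" by auto
        have "k mod 2 = d mod 2" using kd(2) by presburger
        hence "k = 2 * (k div 2) + d mod 2" using mult_div_mod_eq[of 2 k] by linarith
        moreover have "k div 2 \<in> {0..d div 2}" using kd(1) by (simp add: div_le_mono)
        ultimately have "k \<in> (\<lambda>j. 2*j + d mod 2) ` {0..d div 2}" by (rule image_eqI)
        thus False using k by blast
      qed
      thus "F k = 0" using F0 by blast
    qed
  qed simp
  also have "\<dots> = sum F {..l}"
    by (rule sum.mono_neutral_right) (auto simp: F0)
  also have "\<dots> = (\<Sum>k\<le>l. zcoef l k (rot_deriv ix d f) / of_real (nrm l k) * of_real (Z l k x))"
    unfolding F_def deriv_coeff_def
    by (intro sum.cong refl coeff_Y_mult_Y_sym rot_deriv_square_integrable rot_deriv_plane_dep[OF z] x) auto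
  finally show ?thesis by (simp add: F_def)
qed

end

end

section \<open>Pointwise convergence\<close>

context sphere_coords begin

text \<open>
  The square mean of \<open>u - a Z\<^sub>l\<^sup>k\<close> is nonnegative when \<open>a Z\<^sub>l\<^sup>k\<close> is the projection of \<open>u\<close>.
\<close>

lemma zcoef_bessel:
  fixes u :: "real^'m \<Rightarrow> complex"
  assumes u: "sph_square_integrable u" and k: "k \<le> l"
  shows "(cmod (zcoef l k u))\<^sup>2 \<le> nrm l k * (LINT x|surf. (cmod (u x))\<^sup>2)"
proof -
  define a where "a = zcoef l k u / of_real (nrm l k)"
  have N: "nrm l k > 0" by (rule nrm_pos[OF k])
  have sq: "integrable surf (\<lambda>x. (cmod (u x))\<^sup>2)"
    using u by (simp add: sph_square_integrable_def)
  note iZu = integrable_Zu[OF u, of l k]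
  define r where "r = (\<lambda>x. Re (cnj a * (of_real (Z l k x) * u x)))"
  have iRe: "integrable surf r"
    unfolding r_def using iZu by (intro integrable_Re) simp
  have ZZ: "integrable surf (\<lambda>x. (cmod a)\<^sup>2 * (Z l k x * Z l k x))"
    using integrable_ZZ by simp
  have expand: "(cmod (u x - a * of_real (Z l k x)))\<^sup>2
      = (cmod (u x))\<^sup>2 - 2 * r x + (cmod a)\<^sup>2 * (Z l k x * Z l k x)" for x
    unfolding r_def by (simp add: cmod_power2) (simp add: power2_eq_square algebra_simps)
  have "0 \<le> (LINT x|surf. (cmod (u x - a * of_real (Z l k x)))\<^sup>2)"
    by (rule Bochner_Integration.integral_nonneg) simp
  also have "\<dots> = (LINT x|surf. (cmod (u x))\<^sup>2) - 2 * Re (cnj a * zcoef l k u) + (cmod a)\<^sup>2 * nrm l k"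
  proof -
    have "(LINT x|surf. r x) = Re (cnj a * zcoef l k u)"
      unfolding r_def zcoef_def using iZu by (subst integral_Re) auto
    thus ?thesis unfolding expand using sq iRe ZZ by (simp add: nrm_def ip_def)
  qed
  also have "Re (cnj a * zcoef l k u) = (cmod a)\<^sup>2 * nrm l k"
  proof -
    have "zcoef l k u = a * of_real (nrm l k)" using N by (simp add: a_def)
    hence "cnj a * zcoef l k u = (a * cnj a) * of_real (nrm l k)" by (simp add: mult_ac)
    also have "\<dots> = of_real ((cmod a)\<^sup>2 * nrm l k)"
      unfolding complex_norm_square[symmetric] by simp
    finally show ?thesis by simp
  qed
  finally have "(cmod a)\<^sup>2 * nrm l k \<le> (LINT x|surf. (cmod (u x))\<^sup>2)" by linarith
  moreover have "(cmod (zcoef l k u))\<^sup>2 = nrm l k * ((cmod a)\<^sup>2 * nrm l k)"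
    using N by (simp add: a_def norm_divide power_divide power2_eq_square)
  ultimately show ?thesis using N by (simp add: mult_left_mono)
qed

lemma ladder_up_le: "k \<le> l \<Longrightarrow> ladder_up lam k \<le> 2 * (1 + lam) * (real l + 1)\<^sup>2"
proof -
  assume k: "k \<le> l"
  have "ladder_up lam k \<le> 2 * (lam + real k) * 1"
    unfolding ladder_up_def using harm_u_le_1[OF lam_ge, of k] lam_ge by (intro mult_left_mono) auto
  also have "\<dots> \<le> 2 * ((1 + lam) * (real l + 1))"
  proof -
    define P where "P = real l * lam"
    have "0 \<le> P" unfolding P_def using lam_ge by simp
    moreover have e: "(1 + lam) * (real l + 1) = 1 + lam + real l + P"
      by (simp add: P_def algebra_simps)
    moreover have "real k \<le> real l" using k by simp
    ultimately show ?thesis unfolding e by simp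
  qed
  also have "\<dots> \<le> 2 * ((1 + lam) * (real l + 1)\<^sup>2)"
    using lam_ge by (intro mult_left_mono) (auto simp: power2_eq_square)
  finally show ?thesis by (simp only: mult.assoc)
qed

lemma ladder_down_le: "k \<le> l \<Longrightarrow> ladder_down lam l (Suc k) \<le> 2 * (1 + lam) * (real l + 1)\<^sup>2"
proof -
  assume k: "k \<le> l"
  have nn: "0 \<le> (real l - real k) * (real l + real k + 2 * lam)"
    using k lam_ge by (intro mult_nonneg_nonneg) auto
  have "ladder_down lam l (Suc k) \<le> harm_v lam (Suc k) * ((real l - real k) * (real l + real k + 2 * lam)) / 1"
    unfolding ladder_down_Suc[OF lam_ge]
    using nn lam_ge harm_v_pos[OF lam_ge, of "Suc k"] by (intro divide_left_mono) auto
  also have "\<dots> \<le> 1 * ((real l - real k) * (real l + real k + 2 * lam))"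
    using mult_right_mono[OF harm_v_le_1[OF lam_ge, of "Suc k"] nn] by simp
  also have "\<dots> \<le> (real l + 1) * (2 * ((1 + lam) * (real l + 1)))"
    unfolding mult_1
  proof (rule mult_mono)
    show "real l + real k + 2 * lam \<le> 2 * ((1 + lam) * (real l + 1))"
    proof -
      define P where "P = real l * lam"
    have "0 \<le> P" unfolding P_def using lam_ge by simp
      moreover have e: "(1 + lam) * (real l + 1) = 1 + lam + real l + P"
        by (simp add: P_def algebra_simps)
      moreover have "real k \<le> real l" using k by simp
      ultimately show ?thesis unfolding e using lam_ge by simp
    qed
  qed (use k lam_ge in auto)
  also have "\<dots> = 2 * (1 + lam) * (real l + 1)\<^sup>2" by (simp add: power2_eq_square)
  finally show ?thesis .
qed

lemma harm_Q_bounded: "\<exists>G. \<forall>x\<in>sphere 0 1. \<bar>Q k x\<bar> \<le> G"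
proof -
  have "continuous_on UNIV (Q k)" by (intro cont_intros)
  hence "bounded (Q k ` sphere 0 1)"
    by (intro compact_imp_bounded compact_continuous_image) (auto intro: continuous_on_subset)
  then obtain G where "\<forall>y\<in>Q k ` sphere 0 1. norm y \<le> G" unfolding bounded_iff by blast
  thus ?thesis by auto
qed

lemma Z_bounded: "\<exists>G\<ge>0. \<forall>l. \<forall>x\<in>sphere 0 1. \<bar>Z l k x\<bar> \<le> G * (real l + 1) ^ (n + 2 * k)"
proof -
  obtain G where G: "\<And>x. x \<in> sphere 0 1 \<Longrightarrow> \<bar>Q k x\<bar> \<le> G" using harm_Q_bounded by blast
  define G' where "G' = max G 0"
  have "\<bar>Z l k x\<bar> \<le> G' * (real l + 1) ^ (n + 2 * k)" if x: "x \<in> sphere 0 1" for l x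
  proof (cases "k \<le> l")
    case True
    have "\<bar>gegenbauer (lam + real k) (l - k) (x1 x)\<bar> \<le> real (Suc (l - k)) ^ (n + 2 * k)"
    proof (rule gegenbauer_bound)
      have "2 * lam = real n - 1" by (simp add: lam_def)
      thus "2 * (lam + real k) \<le> real (n + 2 * k)" by simp
    qed (use lam_ge abs_x1_le[OF x] in auto)
    also have "\<dots> \<le> (real l + 1) ^ (n + 2 * k)" by (intro power_mono) auto
    finally have "\<bar>gegenbauer (lam + real k) (l - k) (x1 x)\<bar> * \<bar>Q k x\<bar> \<le> (real l + 1) ^ (n + 2 * k) * G'"
      using G[OF x] by (intro mult_mono) (auto simp: G'_def)
    thus ?thesis using True by (simp add: harm_Z_def abs_mult mult.commute)
  next
    case False
    thus ?thesis by (simp add: harm_Z_def G'_def)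
  qed
  thus ?thesis by (intro exI[of _ G']) (auto simp: G'_def)
qed

context
  fixes f :: "real^'m \<Rightarrow> complex"
  assumes z: "zonal n ix f" and smooth: "\<And>m. rot_differentiable ix m f"
begin

abbreviation zc :: "nat \<Rightarrow> nat \<Rightarrow> nat \<Rightarrow> complex" where
  "zc l k i \<equiv> zcoef l k (rot_deriv ix i f)"

text \<open>
  The coefficients with respect to the unnormalized \<open>Z\<^sub>l\<^sup>k\<close>; their recursion is the one for repeated
  derivatives of \<open>Z\<^sub>l\<^sup>0\<close>.
\<close>

definition yc :: "nat \<Rightarrow> nat \<Rightarrow> nat \<Rightarrow> complex" where
  "yc l k i = zc l k i / of_real (nrm l k)"

text \<open>
  The term of degree \<open>l\<close> in the expansion of \<open>f\<^sup>(\<^sup>i\<^sup>)\<close>.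
\<close>

definition T :: "nat \<Rightarrow> nat \<Rightarrow> real^'m \<Rightarrow> complex" where
  "T l i x = (\<Sum>k\<le>l. yc l k i * of_real (Z l k x))"

lemma smooth_square_integrable: "sph_square_integrable (rot_deriv ix i f)"
  by (rule rot_deriv_square_integrable[OF z smooth[of i]]) simp

lemma smooth_orbit_deriv: "x \<in> sphere 0 1 \<Longrightarrow> ((\<lambda>t. rot_deriv ix i f (rot ix t x)) has_vector_derivative
      rot_deriv ix (Suc i) f (rot ix t x)) (at t)"
  by (rule rot_deriv_has_deriv[OF ix12 smooth[of "Suc i"]]) auto

lemma zc_Suc: "zc l k (Suc i) = of_real (ladder_up lam k) * zc l (Suc k) i
      - of_real (ladder_down lam l k) * zc l (k - 1) i"
  by (rule zcoef_deriv[OF smooth_square_integrable smooth_square_integrable smooth_orbit_deriv])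

lemma zc_vanish: "k > i \<Longrightarrow> zc l k i = 0"
proof (cases "k \<le> l")
  case True
  assume "k > i"
  hence "acoef l k (rot_deriv ix i f) = 0" by (intro acoef_rot_deriv_vanish[OF z smooth[of i]]) auto
  thus ?thesis using rho_pos[OF True] by (simp add: acoef_def)
qed (simp add: zcoef_beyond)

lemma yc_beyond: "k > l \<Longrightarrow> yc l k i = 0" and yc_vanish: "k > i \<Longrightarrow> yc l k i = 0"
  by (simp_all add: yc_def zcoef_beyond zc_vanish)

lemma yc_Suc:
  assumes k: "k \<le> l"
  shows "yc l k (Suc i) = of_real (ladder_down lam l (Suc k)) * yc l (Suc k) i
      - (if k = 0 then 0 else of_real (ladder_up lam (k - 1)) * yc l (k - 1) i)"
proof -
  have a: "of_real (ladder_up lam k) * zc l (Suc k) i / of_real (nrm l k)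
      = of_real (ladder_down lam l (Suc k)) * yc l (Suc k) i"
  proof (cases "k < l")
    case True
    have "ladder_down lam l (Suc k) \<noteq> 0" "ladder_up lam k \<noteq> 0" "nrm l k \<noteq> 0"
      using ladder_down_pos[OF lam_ge True] ladder_up_pos[OF lam_ge, of k] nrm_pos[OF k] by auto
    thus ?thesis by (simp add: yc_def nrm_Suc_k)
  qed (use k in \<open>simp add: yc_beyond zcoef_beyond\<close>)
  have b: "of_real (ladder_down lam l k) * zc l (k - 1) i / of_real (nrm l k)
      = (if k = 0 then 0 else of_real (ladder_up lam (k - 1)) * yc l (k - 1) i)"
  proof (cases k)
    case 0
    thus ?thesis by (simp add: ladder_down_def)
  next
    case (Suc j)
    have "j < l" "j \<le> l" using k Suc by auto
    hence "ladder_down lam l (Suc j) \<noteq> 0" "ladder_up lam j \<noteq> 0" "nrm l j \<noteq> 0"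
      using ladder_down_pos[OF lam_ge \<open>j < l\<close>] ladder_up_pos[OF lam_ge, of j] nrm_pos[OF \<open>j \<le> l\<close>] by auto
    thus ?thesis by (simp add: Suc yc_def nrm_Suc_k)
  qed
  show ?thesis unfolding yc_def[of l k] zc_Suc diff_divide_distrib a b ..
qed

text \<open>
  By \<open>yc_Suc\<close>, differentiating the term of degree \<open>l\<close> in the series of \<open>f\<^sup>(\<^sup>i\<^sup>)\<close> gives the one in the
  series of \<open>f\<^sup>(\<^sup>i\<^sup>+\<^sup>1\<^sup>)\<close>.
\<close>

lemma T_rot_deriv:
  "((\<lambda>t. T l i (rot ix t x)) has_vector_derivative T l (Suc i) (rot ix t x)) (at t)"
proof -
  let ?x = "rot ix t x"
  let ?D = "\<lambda>k. complex_of_real (ladder_down lam l k)" and ?U = "\<lambda>k. complex_of_real (ladder_up lam k)"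
  let ?Z = "\<lambda>k. complex_of_real (Z l k ?x)"
  have "((\<lambda>t. T l i (rot ix t x)) has_vector_derivative (\<Sum>k\<le>l. yc l k i *
      of_real (ladder_down lam l k * Z l (k - 1) ?x - ladder_up lam k * Z l (Suc k) ?x))) (at t)"
    unfolding T_def
    by (intro has_vector_derivative_sum has_vector_derivative_mult_right has_vector_derivative_of_real Z_rot_deriv)
  also have "(\<Sum>k\<le>l. yc l k i * of_real (ladder_down lam l k * Z l (k - 1) ?x - ladder_up lam k * Z l (Suc k) ?x))
     = (\<Sum>k\<le>l. yc l k i * ?D k * ?Z (k - 1)) - (\<Sum>k\<le>l. yc l k i * ?U k * ?Z (Suc k))"
    by (simp add: sum_subtractf[symmetric] algebra_simps)
  also have "(\<Sum>k\<le>l. yc l k i * ?D k * ?Z (k - 1)) = (\<Sum>k<l. yc l (Suc k) i * ?D (Suc k) * ?Z k)"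
    by (subst sum.atMost_shift) (simp add: ladder_down_def)
  also have "\<dots> = (\<Sum>k\<le>l. ?D (Suc k) * yc l (Suc k) i * ?Z k)"
    by (simp add: lessThan_Suc_atMost[symmetric] yc_beyond mult.commute)
  also have "(\<Sum>k\<le>l. yc l k i * ?U k * ?Z (Suc k)) = (\<Sum>k<l. ?U k * yc l k i * ?Z (Suc k))"
    by (simp add: lessThan_Suc_atMost[symmetric] harm_Z_def mult.commute)
  also have "\<dots> = (\<Sum>k\<le>l. (if k = 0 then 0 else ?U (k - 1) * yc l (k - 1) i) * ?Z k)"
    by (subst sum.atMost_shift) simp
  also have "(\<Sum>k\<le>l. ?D (Suc k) * yc l (Suc k) i * ?Z k)
       - (\<Sum>k\<le>l. (if k = 0 then 0 else ?U (k - 1) * yc l (k - 1) i) * ?Z k) = T l (Suc i) ?x"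
    unfolding T_def sum_subtractf[symmetric]
    by (intro sum.cong refl) (simp add: yc_Suc left_diff_distrib)
  finally show ?thesis .
qed

lemma yc_bound:
  "cmod (yc l k i) \<le> (4 * (1 + lam) * (real l + 1)\<^sup>2) ^ i * cmod (yc l 0 0)"
proof (induction i arbitrary: k)
  case 0
  show ?case by (cases "k = 0") (simp_all add: yc_vanish)
next
  case (Suc i)
  let ?B = "2 * (1 + lam) * (real l + 1)\<^sup>2"
  let ?R = "(4 * (1 + lam) * (real l + 1)\<^sup>2) ^ i * cmod (yc l 0 0)"
  have B: "?B \<ge> 0" and R: "?R \<ge> 0" using lam_ge by auto
  show ?case
  proof (cases "k \<le> l")
    case True
    have D: "0 \<le> ladder_down lam l (Suc k)"
      using True lam_ge harm_v_pos[OF lam_ge, of "Suc k"] by (simp add: ladder_down_Suc[OF lam_ge])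
    have "cmod (of_real (ladder_down lam l (Suc k)) * yc l (Suc k) i) \<le> ?B * ?R"
      unfolding norm_mult using D ladder_down_le[OF True] Suc.IH[of "Suc k"] B by (intro mult_mono) auto
    moreover have "cmod (if k = 0 then 0 else of_real (ladder_up lam (k - 1)) * yc l (k - 1) i) \<le> ?B * ?R"
    proof (cases "k = 0")
      case True
      thus ?thesis using B R by simp
    next
      case False
      have "cmod (of_real (ladder_up lam (k - 1)) * yc l (k - 1) i) \<le> ?B * ?R"
        unfolding norm_mult using ladder_up_pos[OF lam_ge, of "k - 1"] ladder_up_le[of "k - 1" l] True
          Suc.IH[of "k - 1"] B by (intro mult_mono) auto
      thus ?thesis using False by simp
    qed
    ultimately have "cmod (yc l k (Suc i)) \<le> ?B * ?R + ?B * ?R"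
      unfolding yc_Suc[OF True] using norm_triangle_ineq4 by (meson add_mono order_trans)
    also have "\<dots> = (4 * (1 + lam) * (real l + 1)\<^sup>2) ^ Suc i * cmod (yc l 0 0)"
      by simp
    finally show ?thesis .
  next
    case False
    thus ?thesis using lam_ge by (simp add: yc_beyond)
  qed
qed

lemma T_bound:
  "\<exists>C\<ge>0. \<exists>q. \<forall>l. \<forall>x\<in>sphere 0 1. cmod (T l i x) \<le> C * (real l + 1) ^ q * cmod (yc l 0 0)"
proof -
  obtain G where G: "\<And>k. G k \<ge> 0" "\<And>k l x. x \<in> sphere 0 1 \<Longrightarrow> \<bar>Z l k x\<bar> \<le> G k * (real l + 1) ^ (n + 2 * k)"
    using Z_bounded by metis
  define C where "C = (4 * (1 + lam)) ^ i * (\<Sum>k\<le>i. G k)"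
  have "cmod (T l i x) \<le> C * (real l + 1) ^ (2 * i + (n + 2 * i)) * cmod (yc l 0 0)"
    if x: "x \<in> sphere 0 1" for l x
  proof -
    let ?R = "(4 * (1 + lam) * (real l + 1)\<^sup>2) ^ i * cmod (yc l 0 0)"
    have R: "?R \<ge> 0" using lam_ge by auto
    have "cmod (T l i x) \<le> (\<Sum>k\<le>l. cmod (yc l k i) * \<bar>Z l k x\<bar>)"
      unfolding T_def by (rule order_trans[OF norm_sum]) (simp add: norm_mult)
    also have "\<dots> = (\<Sum>k\<in>{..l} \<inter> {..i}. cmod (yc l k i) * \<bar>Z l k x\<bar>)"
      by (rule sum.mono_neutral_right) (auto simp: yc_vanish)
    also have "\<dots> \<le> (\<Sum>k\<le>i. cmod (yc l k i) * \<bar>Z l k x\<bar>)"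
      by (intro sum_mono2) auto
    also have "\<dots> \<le> (\<Sum>k\<le>i. ?R * (G k * (real l + 1) ^ (n + 2 * i)))"
    proof (rule sum_mono)
      fix k assume k: "k \<in> {..i}"
      have "\<bar>Z l k x\<bar> \<le> G k * (real l + 1) ^ (n + 2 * k)" by (rule G(2)[OF x])
      also have "\<dots> \<le> G k * (real l + 1) ^ (n + 2 * i)"
        using G(1)[of k] k by (intro mult_left_mono power_increasing) auto
      finally show "cmod (yc l k i) * \<bar>Z l k x\<bar> \<le> ?R * (G k * (real l + 1) ^ (n + 2 * i))"
        using yc_bound R by (intro mult_mono) auto
    qed
    also have "\<dots> = ?R * ((\<Sum>k\<le>i. G k) * (real l + 1) ^ (n + 2 * i))"
      by (simp only: sum_distrib_left[symmetric] sum_distrib_right[symmetric])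
    also have "\<dots> = C * (real l + 1) ^ (2 * i + (n + 2 * i)) * cmod (yc l 0 0)"
      unfolding power_add[of _ "2 * i"]
      by (simp add: C_def power_mult_distrib power_mult[symmetric] mult_ac)
    finally show ?thesis .
  qed
  moreover have "C \<ge> 0" using G(1) lam_ge by (auto simp: C_def intro!: mult_nonneg_nonneg sum_nonneg)
  ultimately show ?thesis by blast
qed

text \<open>
  The top coefficient of \<open>f\<^sup>(\<^sup>m\<^sup>)\<close> comes from \<open>a\<^sub>l\<^sup>0(f)\<close> alone, by \<open>m\<close> downward steps of the recursion.
  These contribute the square of each downward constant; the norm of \<open>Z\<^sub>l\<^sup>m\<close> accounts for one
  quotient of a downward and an upward constant per step, which leaves the product of both.
\<close>

lemma zc_chain:
  "(cmod (zc l m m))\<^sup>2 * nrm l 0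
     = (cmod (zc l 0 0))\<^sup>2 * nrm l m * (\<Prod>k<m. ladder_up lam k * ladder_down lam l (Suc k))"
proof (induction m)
  case (Suc m)
  let ?D = "ladder_down lam l (Suc m)" and ?U = "ladder_up lam m"
  have "zc l (Suc m) (Suc m) = - (of_real ?D * zc l m m)"
    unfolding zc_Suc using zc_vanish[of m "Suc (Suc m)" l] by simp
  hence "(cmod (zc l (Suc m) (Suc m)))\<^sup>2 * nrm l 0 = ?D\<^sup>2 * ((cmod (zc l m m))\<^sup>2 * nrm l 0)"
    by (simp add: norm_mult power_mult_distrib)
  also have "\<dots> = ?D * ((cmod (zc l 0 0))\<^sup>2 * (?D * nrm l m) * (\<Prod>k<m. ladder_up lam k * ladder_down lam l (Suc k)))"
    unfolding Suc.IH by (simp add: power2_eq_square)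
  also have "?D * nrm l m = ?U * nrm l (Suc m)"
    unfolding nrm_Suc_k using ladder_up_pos[OF lam_ge, of m] by simp
  finally show ?case by (simp add: mult_ac)
qed simp

text \<open>
  Bessel's inequality for the top coefficient of \<open>f\<^sup>(\<^sup>m\<^sup>)\<close> bounds \<open>|a\<^sub>l\<^sup>0(f)|\<^sup>2\<close> by a constant over the
  product of \<open>\<beta>\<^sub>l\<^sub>,\<^sub>k\<^sup>2\<close> for \<open>k < m\<close>, and each factor is at least a fixed positive multiple of \<open>l + 1\<close>
  once \<open>l \<ge> m\<close>.
\<close>

lemma coefficient_decay:
  "\<exists>C\<ge>0. \<forall>\<^sub>F l in sequentially. cmod (yc l 0 0) \<le> C / (real l + 1) ^ p"
proof -
  \<comment> \<open>One of the \<open>2 p + 1\<close> factors \<open>l + 1\<close> compensates the lower bound for the norm of \<open>Z\<^sub>l\<^sup>0\<close>.\<close>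
  define m where "m = 2 * p + 1"
  define E where "E = (LINT x|surf. (cmod (rot_deriv ix m f x))\<^sup>2)"
  define c where "c = (\<Prod>k<m. harm_u lam k * harm_v lam (Suc k))"
  have E: "E \<ge> 0" unfolding E_def by (rule Bochner_Integration.integral_nonneg) simp
  have c: "c > 0" unfolding c_def
    using harm_u_pos[OF lam_ge] harm_v_pos[OF lam_ge] by (intro prod_pos) simp
  define C where "C = sqrt (2 * E / (c * smass))"
  have C2: "C\<^sup>2 = 2 * E / (c * smass)" "C \<ge> 0" using E c smass_pos by (simp_all add: C_def)
  have "cmod (yc l 0 0) \<le> C / (real l + 1) ^ p" if l: "l \<ge> m" for l
  proof -
    define P where "P = (\<Prod>k<m. ladder_up lam k * ladder_down lam l (Suc k))"
    define L where "L = real l + 1"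
    have L: "L \<ge> 1" by (simp add: L_def)
    have N: "nrm l m > 0" "nrm l 0 > 0" using l by (auto intro: nrm_pos)
    have "c * L ^ m = (\<Prod>k<m. harm_u lam k * harm_v lam (Suc k) * L)"
      by (simp add: c_def prod.distrib)
    also have "\<dots> \<le> P"
      unfolding P_def
    proof (rule prod_mono, intro conjI)
      fix k assume k: "k \<in> {..<m}"
      have uv: "harm_u lam k * harm_v lam (Suc k) > 0"
        using harm_u_pos[OF lam_ge] harm_v_pos[OF lam_ge] by simp
      thus "0 \<le> harm_u lam k * harm_v lam (Suc k) * L" using L by simp
      have "1 * L \<le> (real l - real k) * (real l + real k + 2 * lam)"
        using k l lam_ge by (intro mult_mono) (auto simp: L_def)
      thus "harm_u lam k * harm_v lam (Suc k) * L \<le> ladder_up lam k * ladder_down lam l (Suc k)"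
        unfolding ladder_product using uv by (intro mult_left_mono) auto
    qed
    finally have P: "c * L ^ m \<le> P" .
    have "(cmod (zc l 0 0))\<^sup>2 * nrm l m * P = (cmod (zc l m m))\<^sup>2 * nrm l 0"
      unfolding P_def by (rule zc_chain[symmetric])
    also have "\<dots> \<le> (nrm l m * E) * nrm l 0"
      unfolding E_def using zcoef_bessel[OF smooth_square_integrable l, of m] N by (intro mult_right_mono) auto
    finally have "nrm l m * ((cmod (zc l 0 0))\<^sup>2 * P) \<le> nrm l m * (E * nrm l 0)"
      by (simp add: mult_ac)
    hence zP: "(cmod (zc l 0 0))\<^sup>2 * P \<le> E * nrm l 0" using N by simp
    have "(cmod (zc l 0 0))\<^sup>2 * (c * L ^ m) \<le> (cmod (zc l 0 0))\<^sup>2 * P"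
      using P by (intro mult_left_mono) auto
    hence "(cmod (zc l 0 0))\<^sup>2 * (c * L ^ m) \<le> E * nrm l 0" using zP by simp
    moreover have y: "(cmod (zc l 0 0))\<^sup>2 = (cmod (yc l 0 0))\<^sup>2 * (nrm l 0)\<^sup>2"
      using N by (simp add: yc_def norm_divide power_divide)
    ultimately have "nrm l 0 * ((cmod (yc l 0 0))\<^sup>2 * (c * L ^ m) * nrm l 0) \<le> nrm l 0 * E"
      by (simp add: power2_eq_square mult_ac)
    hence "(cmod (yc l 0 0))\<^sup>2 * (c * L ^ m) * nrm l 0 \<le> E" using N by simp
    moreover have "smass / (2 * L) \<le> nrm l 0"
    proof -
      have "smass / (2 * L) \<le> smass * (lam / (real l + lam))"
      proof -
        have "1 / (2 * L) \<le> lam / (real l + lam)"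
        proof -
          have "real l * 1 \<le> real l * (2 * lam)" using lam_ge by (intro mult_left_mono) auto
          hence "real l + lam \<le> lam * (2 * L)" using lam_ge by (simp add: L_def algebra_simps)
          hence "lam / (lam * (2 * L)) \<le> lam / (real l + lam)"
            using lam_ge L by (intro divide_left_mono mult_pos_pos) auto
          thus ?thesis using lam_ge by simp
        qed
        thus ?thesis using smass_pos mult_left_mono[of "1 / (2 * L)" "lam / (real l + lam)" smass] by simp
      qed
      also have "\<dots> \<le> nrm l 0" using nrm_0_lower[of l] by (simp add: nrm_0_0 smass_def)
      finally show ?thesis .
    qed
    ultimately have "(cmod (yc l 0 0))\<^sup>2 * (c * L ^ m) * (smass / (2 * L)) \<le> E"
    proof -
      assume a: "(cmod (yc l 0 0))\<^sup>2 * (c * L ^ m) * nrm l 0 \<le> E" "smass / (2 * L) \<le> nrm l 0"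
      have "(cmod (yc l 0 0))\<^sup>2 * (c * L ^ m) * (smass / (2 * L)) \<le> (cmod (yc l 0 0))\<^sup>2 * (c * L ^ m) * nrm l 0"
        using a(2) c L by (intro mult_left_mono mult_nonneg_nonneg) auto
      thus ?thesis using a(1) by simp
    qed
    moreover have "(cmod (yc l 0 0))\<^sup>2 * (c * L ^ m) * (smass / (2 * L))
        = (cmod (yc l 0 0))\<^sup>2 * c * smass * (L ^ m / (2 * L))" by simp
    moreover have "L ^ m / (2 * L) = L ^ (2 * p) / 2" using L by (simp add: m_def power_add)
    ultimately have "(cmod (yc l 0 0))\<^sup>2 * c * smass * (L ^ (2 * p) / 2) \<le> E"
      by (simp only:)
    hence "(cmod (yc l 0 0))\<^sup>2 \<le> 2 * E / (c * smass) / L ^ (2 * p)"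
      using c smass_pos L by (simp add: field_simps)
    also have "\<dots> = (C / L ^ p)\<^sup>2"
      by (simp add: C2 power_divide power_mult[symmetric] mult.commute)
    finally show ?thesis
      unfolding L_def by (rule power2_le_imp_le) (use C2 in auto)
  qed
  thus ?thesis using C2(2) by (auto simp: eventually_sequentially)
qed

lemma T_summable_bound:
  "\<exists>M. summable M \<and> (\<forall>l. \<forall>x\<in>sphere 0 1. cmod (T l i x) \<le> M l)"
proof -
  obtain C q where C: "C \<ge> 0" "\<And>l x. x \<in> sphere 0 1 \<Longrightarrow> cmod (T l i x) \<le> C * (real l + 1) ^ q * cmod (yc l 0 0)"
    using T_bound[of i] by blast
  define M where "M = (\<lambda>l. C * (real l + 1) ^ q * cmod (yc l 0 0))"
  obtain C' where C': "C' \<ge> 0" "\<forall>\<^sub>F l in sequentially. cmod (yc l 0 0) \<le> C' / (real l + 1) ^ (q + 2)"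
    using coefficient_decay[of "q + 2"] by blast
  have "summable (\<lambda>l. inverse (real (Suc l) ^ 2))"
    using inverse_power_summable[of 2, where 'a = real] by (subst summable_Suc_iff) simp
  hence s: "summable (\<lambda>l. C * C' * inverse (real (Suc l) ^ 2))" by (rule summable_mult)
  have "\<forall>\<^sub>F l in sequentially. norm (M l) \<le> C * C' * inverse (real (Suc l) ^ 2)"
    using C'(2)
  proof eventually_elim
    case (elim l)
    have "norm (M l) = C * (real l + 1) ^ q * cmod (yc l 0 0)" using C(1) by (simp add: M_def)
    also have "\<dots> \<le> C * (real l + 1) ^ q * (C' / (real l + 1) ^ (q + 2))"
      using elim C(1) by (intro mult_left_mono) auto
    also have "\<dots> = C * C' * inverse (real (Suc l) ^ 2)"
    proof -
      define L where "L = real l + 1"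
      have L: "L > 0" "real (Suc l) = L" by (simp_all add: L_def)
      show ?thesis unfolding L_def[symmetric] L(2) power_add using L(1) by (simp add: field_simps)
    qed
    finally show ?case .
  qed
  from summable_comparison_test_ev[OF this s] have "summable M" .
  thus ?thesis using C(2) unfolding M_def by blast
qed

text \<open>
  On the great circle through the pole in the \<open>x\<^sub>1x\<^sub>2\<close>-plane \<open>f\<close> is differentiable, and every value
  of \<open>f\<close> is attained there, at the angle \<open>arccos x\<^sub>1\<close>.
\<close>

lemma smooth_zonal_continuous: "continuous_on (sphere 0 1) f"
proof -
  define e1 :: "real^'m" where "e1 = axis (ix 1) 1"
  have e1: "e1 \<in> sphere 0 1" "x1 e1 = 1" "x2 e1 = 0"
    using ix12 by (simp_all add: e1_def axis_def norm_axis_1[unfolded axis_def])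
  obtain G where G: "\<And>x. x \<in> sphere 0 1 \<Longrightarrow> f x = G (x1 x)" using zonal_x1[OF z] by blast
  define h where "h = (\<lambda>t. f (rot ix t e1))"
  have h: "h t = G (cos t)" for t
    unfolding h_def G[OF rot_sphere[OF ix12 e1(1)]] by (simp add: rot_def e1)
  have "(h has_vector_derivative rot_deriv ix (Suc 0) f (rot ix t e1)) (at t)" for t
    using smooth_orbit_deriv[OF e1(1), of 0 t] by (simp add: h_def)
  hence "continuous_on UNIV h"
    by (intro continuous_at_imp_continuous_on) (auto intro: has_vector_derivative_continuous)
  hence "continuous_on (sphere 0 1) (\<lambda>x. h (arccos (x1 x)))"
  proof (rule continuous_on_compose2)
    show "continuous_on (sphere 0 1) (\<lambda>x. arccos (x1 x))"
    proof (rule continuous_on_arccos)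
      show "\<forall>x\<in>sphere 0 1. - 1 \<le> x1 x \<and> x1 x \<le> 1" using abs_x1_le by (auto simp: abs_le_iff)
    qed (intro continuous_intros)
  qed simp
  moreover have "h (arccos (x1 x)) = f x" if "x \<in> sphere 0 1" for x
    using abs_x1_le[OF that] G[OF that] by (simp add: h)
  ultimately show ?thesis by (rule continuous_on_eq)
qed

text \<open>
  The uniform limit \<open>\<Phi>\<close> of the series equals \<open>f\<close> almost everywhere by Fatou's lemma and the
  convergence in square mean. Both are continuous and nonempty open sets have positive measure.
\<close>

lemma series_sums_f:
  assumes x: "x \<in> sphere 0 1"
  shows "(\<lambda>l. T l 0 x) sums f x"
proof -
  obtain M where M: "summable M" "\<And>l x. x \<in> sphere 0 1 \<Longrightarrow> cmod (T l 0 x) \<le> M l"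
    using T_summable_bound[of 0] by blast
  define \<Phi> where "\<Phi> = (\<lambda>x. \<Sum>l. T l 0 x)"
  have ul: "uniform_limit (sphere 0 1) (\<lambda>N x. \<Sum>l<N. T l 0 x) \<Phi> sequentially"
    unfolding \<Phi>_def using M by (intro Weierstrass_m_test) auto
  have cT: "continuous_on UNIV (T l i)" for l i
    unfolding T_def by (intro cont_intros)
  have c\<Phi>: "continuous_on (sphere 0 1) \<Phi>"
    by (rule uniform_limit_theorem[OF _ ul])
       (auto intro!: always_eventually continuous_intros continuous_on_subset[OF cT])
  have sums: "(\<lambda>l. T l 0 x) sums \<Phi> x" if "x \<in> sphere 0 1" for x
    unfolding \<Phi>_def using M that by (intro summable_sums summable_comparison_test'[OF M(1)]) auto
  have L2: "(\<lambda>N. \<integral>\<^sup>+ x. ennreal ((cmod (f x - (\<Sum>l<N. T l 0 x)))\<^sup>2) \<partial>surf) \<longlonglongrightarrow> 0"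
    using plane_dep_expansion[OF smooth_square_integrable[of 0] rot_deriv_plane_dep[OF z, of 0]]
    unfolding sph_L2_sums_def T_def yc_def by simp
  have fm [measurable]: "f \<in> borel_measurable surf"
    using smooth_square_integrable[of 0] by (simp add: sph_square_integrable_def)
  have Tm [measurable]: "T l 0 \<in> borel_measurable surf" for l
    by (rule surface_continuous_measurable[OF cT])
  define w where "w = (\<lambda>N x. ennreal ((cmod (f x - (\<Sum>l<N. T l 0 x)))\<^sup>2))"
  have wm: "w N \<in> borel_measurable surf" for N unfolding w_def by measurable
  have "(\<integral>\<^sup>+ x. liminf (\<lambda>N. w N x) \<partial>surf) \<le> liminf (\<lambda>N. \<integral>\<^sup>+ x. w N x \<partial>surf)"
    by (rule nn_integral_liminf[OF wm])
  also have "\<dots> = 0" using L2 unfolding w_def by (intro lim_imp_Liminf) auto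
  finally have "(\<integral>\<^sup>+ x. liminf (\<lambda>N. w N x) \<partial>surf) = 0" by simp
  moreover have "(\<lambda>x. liminf (\<lambda>N. w N x)) \<in> borel_measurable surf"
    using wm by measurable
  ultimately have AE0: "AE x in surf. liminf (\<lambda>N. w N x) = 0"
    by (simp add: nn_integral_0_iff_AE)
  have lim: "liminf (\<lambda>N. w N x) = ennreal ((cmod (f x - \<Phi> x))\<^sup>2)" if "x \<in> sphere 0 1" for x
  proof (rule lim_imp_Liminf)
    have "(\<lambda>N. (cmod (f x - (\<Sum>l<N. T l 0 x)))\<^sup>2) \<longlonglongrightarrow> (cmod (f x - \<Phi> x))\<^sup>2"
      using sums[OF that] unfolding sums_def by (intro tendsto_intros)
    thus "(\<lambda>N. w N x) \<longlonglongrightarrow> ennreal ((cmod (f x - \<Phi> x))\<^sup>2)"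
      unfolding w_def by (rule tendsto_ennrealI)
  qed simp
  have AE: "AE x in surf. f x - \<Phi> x = 0"
    using AE0 by (rule AE_mp) (auto intro!: AE_I2 simp: lim)
  have "f x - \<Phi> x = 0"
  proof (rule ccontr)
    assume ne: "f x - \<Phi> x \<noteq> 0"
    have "continuous_on (sphere 0 1) (\<lambda>x. f x - \<Phi> x)"
      by (intro continuous_intros smooth_zonal_continuous c\<Phi>)
    then obtain U where U: "open U" "U \<inter> sphere 0 1 = (\<lambda>x. f x - \<Phi> x) -` (- {0}) \<inter> sphere 0 1"
      using continuous_on_open_invariant[of "sphere 0 1" "\<lambda>x. f x - \<Phi> x"] by (metis open_Compl closed_singleton)
    have "x \<in> U" using U(2) x ne by blast
    hence pos: "emeasure surf (U \<inter> sphere 0 1) > 0" using surface_open_pos[OF U(1) _ x] by blast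
    have "U \<inter> sphere 0 1 \<in> sets surf"
      unfolding sets_surface sets_restrict_space using U(1) by (metis Int_commute imageI borel_open)
    moreover have "{x \<in> space surf. \<not> (f x - \<Phi> x = 0)} = U \<inter> sphere 0 1"
      unfolding U(2) by auto
    ultimately have "emeasure surf (U \<inter> sphere 0 1) = 0"
      using AE_iff_measurable[of "U \<inter> sphere 0 1" surf "\<lambda>x. f x - \<Phi> x = 0"] AE by blast
    thus False using pos by simp
  qed
  thus ?thesis using sums[OF x] by simp
qed

theorem series_sums_rot_deriv:
  "x \<in> sphere 0 1 \<Longrightarrow> (\<lambda>l. T l i x) sums rot_deriv ix i f x"
proof (induction i arbitrary: x)
  case 0
  thus ?case using series_sums_f by simp
next
  case (Suc i)
  obtain M where M: "summable M" "\<And>l x. x \<in> sphere 0 1 \<Longrightarrow> cmod (T l (Suc i) x) \<le> M l"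
    using T_summable_bound[of "Suc i"] by blast
  have "(\<lambda>l. T l (Suc i) (rot ix 0 x)) sums rot_deriv ix (Suc i) f (rot ix 0 x)"
  proof (rule termwise_derivative_sums[where \<phi> = "\<lambda>l t. T l i (rot ix t x)"])
    show "((\<lambda>t. T l i (rot ix t x)) has_vector_derivative T l (Suc i) (rot ix t x)) (at t)" for l t
      by (rule T_rot_deriv)
    show "norm (T l (Suc i) (rot ix t x)) \<le> M l" for l t
      by (rule M(2)[OF rot_sphere[OF ix12 Suc.prems]])
    show "(\<lambda>l. T l i (rot ix t x)) sums rot_deriv ix i f (rot ix t x)" for t
      by (rule Suc.IH[OF rot_sphere[OF ix12 Suc.prems]])
    show "((\<lambda>t. rot_deriv ix i f (rot ix t x)) has_vector_derivative rot_deriv ix (Suc i) f (rot ix 0 x)) (at 0)"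
      by (rule smooth_orbit_deriv[OF Suc.prems])
  qed (rule M(1))
  thus ?case by simp
qed

end

end

theorem theorem4p3:
  fixes n d :: nat and ix :: "nat \<Rightarrow> 'm::finite" and f :: "real^'m \<Rightarrow> complex"
  assumes "n \<ge> 2"
    and "bij_betw ix {1..n+1} UNIV"
    and "zonal n ix f"
    and "sph_L2_sums (\<lambda>l x. coeff_Y n ix l 0 f * Y n ix l 0 x) f"
    and "rot_differentiable ix d f"
  shows
    "let a = deriv_coeff n ix f;
         e = d mod 2;
         S = (\<lambda>l x. \<Sum>j=0..d div 2. a l (2*j+e) d * Y_sym n ix l (2*j+e) x)
     in
       sph_L2_sums S (rot_deriv ix d f) \<and>
       ((\<forall>m. rot_differentiable ix m f) \<longrightarrow>
          (\<forall>x\<in>sphere 0 1. (\<lambda>l. S l x) sums rot_deriv ix d f x)) \<and>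
       (odd d \<longrightarrow>
          (\<forall>l j. a l (2*j+1) d =
                   beta n l (2*j+1) * a l (2*j+2) (d-1) - beta n l (2*j) * a l (2*j) (d-1)) \<and>
          (\<forall>l j. a l (2*j) d = 0)) \<and>
       (even d \<and> d > 0 \<longrightarrow>
          (\<forall>l. n \<ge> 3 \<longrightarrow> a l 0 d = beta n l 0 * a l 1 (d-1)) \<and>
          (\<forall>l. n = 2 \<longrightarrow> a l 0 d = 2 * beta n l 0 * a l 1 (d-1)) \<and>
          (\<forall>l. \<forall>j\<ge>1. a l (2*j) d =
                   beta n l (2*j) * a l (2*j+1) (d-1) - beta n l (2*j-1) * a l (2*j-1) (d-1)) \<and>
          (\<forall>l j. a l (2*j+1) d = 0))"
proof -
  interpret sphere_coords n ix using assms(1,2) by unfold_locales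
  note z = assms(3) and diff = assms(5)
  define a where "a = deriv_coeff n ix f"
  define S where "S = (\<lambda>l x. \<Sum>j=0..d div 2. a l (2*j+d mod 2) d * Y_sym n ix l (2*j+d mod 2) x)"
  have a: "a l k i = acoef l k (rot_deriv ix i f)" if "i \<le> d" for l k i
    unfolding a_def deriv_coeff_def by (rule coeff_Y_rot_deriv[OF z diff that])
  have S: "S l x = (\<Sum>k\<le>l. zcoef l k (rot_deriv ix d f) / of_real (nrm l k) * of_real (Z l k x))"
    if "x \<in> sphere 0 1" for l x
    unfolding S_def a_def by (rule partial_sum_eq[OF z diff that])
  have step: "a l k (Suc i) =
     of_real ((if n = 2 \<and> k = 0 then 2 else 1) * beta n l k) * a l (Suc k) i
      - (if k = 0 then 0 else of_real (beta n l (k - 1)) * a l (k - 1) i)" if "Suc i = d" for l k i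
    using that acoef_rot_deriv_Suc[OF z diff, of i] by (simp add: a)
  have vanish: "a l k d = 0" if "odd (k + d)" for l k
    unfolding a[OF order.refl] by (rule acoef_rot_deriv_vanish[OF z diff]) (use that in auto)
  have 1: "sph_L2_sums S (rot_deriv ix d f)"
  proof -
    have "sph_L2_sums (\<lambda>l x. \<Sum>k\<le>l. zcoef l k (rot_deriv ix d f) / of_real (nrm l k) * of_real (Z l k x)) (rot_deriv ix d f)"
      by (rule plane_dep_expansion[OF rot_deriv_square_integrable[OF z diff order.refl] rot_deriv_plane_dep[OF z]])
    moreover have "(\<integral>\<^sup>+ x. ennreal ((cmod (rot_deriv ix d f x - (\<Sum>l<N. S l x)))\<^sup>2) \<partial>surf)
       = (\<integral>\<^sup>+ x. ennreal ((cmod (rot_deriv ix d f x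
            - (\<Sum>l<N. \<Sum>k\<le>l. zcoef l k (rot_deriv ix d f) / of_real (nrm l k) * of_real (Z l k x))))\<^sup>2) \<partial>surf)" for N
      by (intro nn_integral_cong) (simp add: S)
    ultimately show ?thesis unfolding sph_L2_sums_def by (simp only:)
  qed
  have 2: "\<forall>x\<in>sphere 0 1. (\<lambda>l. S l x) sums rot_deriv ix d f x" if "\<forall>m. rot_differentiable ix m f"
  proof
    fix x :: "real^'m" assume x: "x \<in> sphere 0 1"
    have sm: "\<And>m. rot_differentiable ix m f" using that by blast
    show "(\<lambda>l. S l x) sums rot_deriv ix d f x"
      using series_sums_rot_deriv[OF z sm x, of d]
      by (simp add: S[OF x] T_def[OF z sm] yc_def[OF z sm])
  qed
  have 3: "a l (2*j+1) d = of_real (beta n l (2*j+1)) * a l (2*j+2) (d-1) - of_real (beta n l (2*j)) * a l (2*j) (d-1)"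
    if "odd d" for l j
    using step[of "d - 1" l "2*j+1"] that by (simp add: odd_pos)
  have 4: "a l 0 d = of_real ((if n = 2 then 2 else 1) * beta n l 0) * a l 1 (d-1)" if "d > 0" for l
    using step[of "d - 1" l 0] that by (simp add: One_nat_def)
  have 5: "a l (2*j) d = of_real (beta n l (2*j)) * a l (2*j+1) (d-1) - of_real (beta n l (2*j-1)) * a l (2*j-1) (d-1)"
    if "d > 0" "j \<ge> 1" for l j
    using step[of "d - 1" l "2*j"] that by (simp add: One_nat_def)
  have 6: "a l (2*j) d = 0" if "odd d" for l j
    using that by (intro vanish) simp
  have 7: "a l (2*j+1) d = 0" if "even d" for l j
    using that by (intro vanish) simp
  have 8: "n \<ge> 3 \<Longrightarrow> d > 0 \<Longrightarrow> a l 0 d = beta n l 0 * a l 1 (d-1)"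
    and 9: "n = 2 \<Longrightarrow> d > 0 \<Longrightarrow> a l 0 d = 2 * beta n l 0 * a l 1 (d-1)" for l
    by (simp_all add: 4)
  show ?thesis
    unfolding Let_def a_def[symmetric]
  proof (intro conjI)
    show "sph_L2_sums (\<lambda>l x. \<Sum>j=0..d div 2. a l (2*j+d mod 2) d * Y_sym n ix l (2*j+d mod 2) x) (rot_deriv ix d f)"
      using 1 unfolding S_def .
    show "(\<forall>m. rot_differentiable ix m f) \<longrightarrow> (\<forall>x\<in>sphere 0 1.
        (\<lambda>l. \<Sum>j=0..d div 2. a l (2*j+d mod 2) d * Y_sym n ix l (2*j+d mod 2) x) sums rot_deriv ix d f x)"
      using 2 unfolding S_def by blast
  qed ((use 3 6 in blast) | (use 5 7 8 9 in \<open>intro impI conjI allI; elim conjE; blast\<close>))+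
qed

end
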